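(* Let $V$ be a real separable reflexive Banach space and $H$ a separable Hilbert space forming an evolution triple $V\hookrightarrow H\hookrightarrow V'$, let $0<T<\infty$, and let $K_n$ ($n\in\mathbb N$) and $K$ be closed and convex subsets of $V$. Then the following assertions are equivalent: (i) $K_n$ converges to $K$ in the sense of Mosco. (ii) $L^2((0,T),K_n)$ converges to $L^2((0,T),K)$ in the sense of Mosco. (iii) $W((0,T),V,V')\cap L^2((0,T),K_n)$ converges to $W((0,T),V,V')\cap L^2((0,T),K)$ in the sense of Mosco.
   Context: Evolution triple: $V$ is continuously and densely embedded in $H$, $H$ is identified with its dual $H'$, and so $V\hookrightarrow H\hookrightarrow V'$ with continuous dense embeddings. $L^2((0,T),V)$ is the Bochner-Lebesgue space. $W((0,T),V,V'):=\{u\in L^2((0,T),V): u'\in L^2((0,T),V')\}$, where $u'$ is the derivative in the sense of distributions with values in $V'$, with norm $\|u\|_W=\left(\int_0^T\|u(t)\|_V^2\,dt+\int_0^T\|u'(t)\|_{V'}^2\,dt\right)^{1/2}$. For a closed convex $C\subset V$, $L^2((0,T),C):=\{u\in L^2((0,T),V): u(t)\in C \text{ for a.e. } t\in(0,T)\}$. "$K_n$ converges to $K$ in the sense of Mosco" means: (M1) for every $u\in K$ there exists a sequence $u_n\in K_n$ with $u_n\to u$ strongly in $V$; and (M2) if $(n_k)$ is a sequence of indices converging to $\infty$, $(u_k)$ is a sequence with $u_k\in K_{n_k}$ for every $k$, and $u_k\rightharpoonup u$ weakly in $V$, then $u\in K$. "$L^2((0,T),K_n)$ converges to $L^2((0,T),K)$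 in the sense of Mosco" means: (M1') for every $u\in L^2((0,T),K)$ there exists a sequence $u_n\in L^2((0,T),K_n)$ with $u_n\to u$ strongly in $L^2((0,T),V)$; and (M2') if $(n_k)$ is a sequence of indices converging to $\infty$, $u_k\in L^2((0,T),K_{n_k})$ for every $k$, and $u_k\rightharpoonup u$ weakly in $L^2((0,T),V)$, then $u\in L^2((0,T),K)$. "$W((0,T),V,V')\cap L^2((0,T),K_n)$ converges to $W((0,T),V,V')\cap L^2((0,T),K)$ in the sense of Mosco" means: (M1'') for every $u\in W((0,T),V,V')\cap L^2((0,T),K)$ there exists a sequence $u_n\in W((0,T),V,V')\cap L^2((0,T),K_n)$ converging strongly to $u$ in $W((0,T),V,V')$; and (M2'') if $(n_k)$ is a sequence of indices converging to $\infty$, $u_k\in W((0,T),V,V')\cap L^2((0,T),K_{n_k})$ for every $k$, $u_k\rightharpoonup u$ weakly in $L^2((0,T),V)$ and $u_k'\rightharpoonup w$ weakly in $L^2((0,T),V')$, then $u'=w$ and $u\in W((0,T),V,V')\cap L^2((0,T),K)$. *)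

theory Defs
  imports "HOL-Analysis.Analysis"
begin

section \<open>Evolution triples\<close>

text \<open>The dual of a Banach space \<open>'v\<close> is the type of bounded linear functionals
  \<open>'v \<Rightarrow>\<^sub>L real\<close> with the operator norm. Reflexivity is surjectivity of the canonical
  map into the bidual.\<close>

definition reflexive_space :: "'v::real_normed_vector itself \<Rightarrow> bool" where
  "reflexive_space _ \<longleftrightarrow>
    (\<forall>\<Phi> :: ('v \<Rightarrow>\<^sub>L real) \<Rightarrow>\<^sub>L real. \<exists>v::'v. \<forall>f. blinfun_apply \<Phi> f = blinfun_apply f v)"

text \<open>\<open>V\<close> and \<open>H\<close> are different types, so the inclusion of \<open>V\<close> in \<open>H\<close> is an injective
  bounded linear map \<open>j\<close> with dense range.\<close>

definition evolution_triple ::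
    "('v::{banach, second_countable_topology} \<Rightarrow>\<^sub>L
      'h::{real_inner, banach, second_countable_topology}) \<Rightarrow> bool" where
  "evolution_triple j \<longleftrightarrow>
    inj (blinfun_apply j) \<and> closure (range (blinfun_apply j)) = UNIV"

text \<open>The embedding of \<open>V\<close> into \<open>V'\<close> through \<open>H = H'\<close>:
  \<open>dual_embed j u v = \<langle>j u, j v\<rangle>\<close>.\<close>

definition dual_embed ::
    "('v::real_normed_vector \<Rightarrow>\<^sub>L 'h::real_inner) \<Rightarrow> 'v \<Rightarrow> ('v \<Rightarrow>\<^sub>L real)" where
  "dual_embed j u = blinfun_inner_right (blinfun_apply j u) o\<^sub>L j"

section \<open>Bochner-Lebesgue spaces\<close>

text \<open>The Bochner integral of the library is restricted to value types in the class
  \<open>second_countable_topology\<close>, of which the dual \<open>'v \<Rightarrow>\<^sub>L real\<close> is not an instance. The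
  definitions below repeat the standard ones for an arbitrary normed value space.\<close>

definition bochner_measurable :: "'a measure \<Rightarrow> ('a \<Rightarrow> 'b::real_normed_vector) \<Rightarrow> bool" where
  "bochner_measurable M f \<longleftrightarrow>
    (\<exists>s. (\<forall>n. simple_function M (s n)) \<and> (AE x in M. (\<lambda>n::nat. s n x) \<longlonglongrightarrow> f x))"

definition has_bochner_int ::
    "'a measure \<Rightarrow> ('a \<Rightarrow> 'b::real_normed_vector) \<Rightarrow> 'b \<Rightarrow> bool" where
  "has_bochner_int M f I \<longleftrightarrow>
    bochner_measurable M f \<and>
    (\<exists>s. (\<forall>n. Bochner_Integration.simple_bochner_integrable M (s n)) \<and>
         (\<lambda>n::nat. \<integral>\<^sup>+x. ennreal (norm (f x - s n x)) \<partial>M) \<longlonglongrightarrow> 0 \<and>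
         (\<lambda>n. Bochner_Integration.simple_bochner_integral M (s n)) \<longlonglongrightarrow> I)"

abbreviation time_measure :: "real \<Rightarrow> real measure" where
  "time_measure T \<equiv> lebesgue_on {0<..<T}"

text \<open>Elements of \<open>L\<^sup>2((0,T),X)\<close> are represented by functions, without passing to the
  quotient by equality almost everywhere; \<open>L2_norm\<close> is the corresponding seminorm.\<close>

definition L2_space :: "real \<Rightarrow> (real \<Rightarrow> 'b::real_normed_vector) set" where
  "L2_space T = {u. bochner_measurable (time_measure T) u \<and>
                    integrable (time_measure T) (\<lambda>t. (norm (u t))\<^sup>2)}"

definition L2_norm :: "real \<Rightarrow> (real \<Rightarrow> 'b::real_normed_vector) \<Rightarrow> real" where
  "L2_norm T u = sqrt (\<integral>t. (norm (u t))\<^sup>2 \<partial>time_measure T)"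

definition L2_values_in :: "real \<Rightarrow> 'b::real_normed_vector set \<Rightarrow> (real \<Rightarrow> 'b) set" where
  "L2_values_in T C = {u \<in> L2_space T. AE t in time_measure T. u t \<in> C}"

text \<open>Boundedness with respect to the seminorm makes these functionals invariant under changes
  on null sets, so they are exactly the bounded linear functionals on the quotient space.\<close>

definition L2_functional ::
    "real \<Rightarrow> ((real \<Rightarrow> 'b::real_normed_vector) \<Rightarrow> real) \<Rightarrow> bool" where
  "L2_functional T \<Lambda> \<longleftrightarrow>
    (\<forall>u\<in>L2_space T. \<forall>v\<in>L2_space T. \<Lambda> (\<lambda>t. u t + v t) = \<Lambda> u + \<Lambda> v) \<and>
    (\<forall>c. \<forall>u\<in>L2_space T. \<Lambda> (\<lambda>t. c *\<^sub>R u t) = c * \<Lambda> u) \<and>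
    (\<exists>B. \<forall>u\<in>L2_space T. \<bar>\<Lambda> u\<bar> \<le> B * L2_norm T u)"

definition L2_weak_conv ::
    "real \<Rightarrow> (nat \<Rightarrow> real \<Rightarrow> 'b::real_normed_vector) \<Rightarrow> (real \<Rightarrow> 'b) \<Rightarrow> bool" where
  "L2_weak_conv T u v \<longleftrightarrow> (\<forall>\<Lambda>. L2_functional T \<Lambda> \<longrightarrow> (\<lambda>k. \<Lambda> (u k)) \<longlonglongrightarrow> \<Lambda> v)"

section \<open>Distributional derivatives and the space \<open>W\<close>\<close>

definition test_function :: "real \<Rightarrow> (real \<Rightarrow> real) \<Rightarrow> bool" where
  "test_function T \<phi> \<longleftrightarrow>
    (\<forall>k x. ((deriv ^^ k) \<phi>) differentiable (at x)) \<and>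
    compact (closure {x. \<phi> x \<noteq> 0}) \<and> closure {x. \<phi> x \<noteq> 0} \<subseteq> {0<..<T}"

text \<open>\<open>w = u'\<close> in the sense of \<open>V'\<close>-valued distributions:
  \<open>\<integral> \<phi>'(t) u(t) dt = - \<integral> \<phi>(t) w(t) dt\<close> in \<open>V'\<close> for every test function \<open>\<phi>\<close>.\<close>

definition has_distr_deriv ::
    "real \<Rightarrow> ('v::real_normed_vector \<Rightarrow>\<^sub>L 'h::real_inner) \<Rightarrow>
      (real \<Rightarrow> 'v) \<Rightarrow> (real \<Rightarrow> ('v \<Rightarrow>\<^sub>L real)) \<Rightarrow> bool" where
  "has_distr_deriv T j u w \<longleftrightarrow>
    (\<forall>\<phi>. test_function T \<phi> \<longrightarrow>
      (\<exists>I. has_bochner_int (time_measure T) (\<lambda>t. deriv \<phi> t *\<^sub>R dual_embed j (u t)) I \<and>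
           has_bochner_int (time_measure T) (\<lambda>t. \<phi> t *\<^sub>R w t) (- I)))"

definition W_space ::
    "real \<Rightarrow> ('v::real_normed_vector \<Rightarrow>\<^sub>L 'h::real_inner) \<Rightarrow> (real \<Rightarrow> 'v) set" where
  "W_space T j = {u \<in> L2_space T. \<exists>w \<in> L2_space T. has_distr_deriv T j u w}"

text \<open>The derivative of \<open>u \<in> W\<close> is unique up to equality almost everywhere;
  \<open>distr_deriv\<close> selects a representative.\<close>

definition distr_deriv ::
    "real \<Rightarrow> ('v::real_normed_vector \<Rightarrow>\<^sub>L 'h::real_inner) \<Rightarrow>
      (real \<Rightarrow> 'v) \<Rightarrow> real \<Rightarrow> ('v \<Rightarrow>\<^sub>L real)" where
  "distr_deriv T j u = (SOME w. w \<in> L2_space T \<and> has_distr_deriv T j u w)"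

definition W_norm ::
    "real \<Rightarrow> ('v::real_normed_vector \<Rightarrow>\<^sub>L 'h::real_inner) \<Rightarrow> (real \<Rightarrow> 'v) \<Rightarrow> real" where
  "W_norm T j u = sqrt ((\<integral>t. (norm (u t))\<^sup>2 \<partial>time_measure T) +
                        (\<integral>t. (norm (distr_deriv T j u t))\<^sup>2 \<partial>time_measure T))"

section \<open>Mosco convergence\<close>

definition mosco_conv :: "(nat \<Rightarrow> 'v::real_normed_vector set) \<Rightarrow> 'v set \<Rightarrow> bool" where
  "mosco_conv Kn K \<longleftrightarrow>
    (\<forall>u\<in>K. \<exists>un. (\<forall>n. un n \<in> Kn n) \<and> un \<longlonglongrightarrow> u) \<and>
    (\<forall>nk::nat \<Rightarrow> nat. \<forall>uk u.
      filterlim nk at_top sequentially \<longrightarrow>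
      (\<forall>k. uk k \<in> Kn (nk k)) \<longrightarrow>
      (\<forall>f :: 'v \<Rightarrow>\<^sub>L real. (\<lambda>k. blinfun_apply f (uk k)) \<longlonglongrightarrow> blinfun_apply f u) \<longrightarrow>
      u \<in> K)"

definition mosco_conv_L2 ::
    "real \<Rightarrow> (nat \<Rightarrow> 'v::real_normed_vector set) \<Rightarrow> 'v set \<Rightarrow> bool" where
  "mosco_conv_L2 T Kn K \<longleftrightarrow>
    (\<forall>u\<in>L2_values_in T K. \<exists>un. (\<forall>n. un n \<in> L2_values_in T (Kn n)) \<and>
      (\<lambda>n. L2_norm T (\<lambda>t. un n t - u t)) \<longlonglongrightarrow> 0) \<and>
    (\<forall>nk::nat \<Rightarrow> nat. \<forall>uk. \<forall>u\<in>L2_space T.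
      filterlim nk at_top sequentially \<longrightarrow>
      (\<forall>k. uk k \<in> L2_values_in T (Kn (nk k))) \<longrightarrow>
      L2_weak_conv T uk u \<longrightarrow>
      u \<in> L2_values_in T K)"

definition mosco_conv_W ::
    "real \<Rightarrow> ('v::real_normed_vector \<Rightarrow>\<^sub>L 'h::real_inner) \<Rightarrow>
      (nat \<Rightarrow> 'v set) \<Rightarrow> 'v set \<Rightarrow> bool" where
  "mosco_conv_W T j Kn K \<longleftrightarrow>
    (\<forall>u \<in> W_space T j \<inter> L2_values_in T K. \<exists>un. (\<forall>n. un n \<in> W_space T j \<inter> L2_values_in T (Kn n)) \<and>
      (\<lambda>n. W_norm T j (\<lambda>t. un n t - u t)) \<longlonglongrightarrow> 0) \<and>
    (\<forall>nk::nat \<Rightarrow> nat. \<forall>uk. \<forall>u\<in>L2_space T. \<forall>w\<in>L2_space T.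
      filterlim nk at_top sequentially \<longrightarrow>
      (\<forall>k. uk k \<in> W_space T j \<inter> L2_values_in T (Kn (nk k))) \<longrightarrow>
      L2_weak_conv T uk u \<longrightarrow>
      L2_weak_conv T (\<lambda>k. distr_deriv T j (uk k)) w \<longrightarrow>
      has_distr_deriv T j u w \<and> u \<in> W_space T j \<inter> L2_values_in T K)"

end

(* (ii) => (i) and (iii) => (i): apply the convergence to constant functions; a sequence that is close
   in L^2 to a constant is close to it at some time.

   (i) => (ii), (iii), condition (M2): the average of u_k over a set A of positive measure lies in
   K_{n_k} and converges weakly to the average of u over A.  If u took values outside K on a set of
   positive measure, then it would take values in a ball B disjoint from K on such an A, and the
   average of u over A would lie both in B and in K.

   (i) => (ii), (iii), condition (M1): divide (0,T) into cells of length h and let a_i be the mean of u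
   over the i-th cell with respect to a smooth weight rho_i.  The piecewise affine interpolant Q_h u of
   the a_i has values in K, and replacing each a_i by a recovery sequence in K_n approximates it by
   K_n-valued piecewise affine functions.  Since rho_i - rho_{i+1} = psi_i' for a nonnegative test
   function psi_i of integral h, the slopes of Q_h u in V' are means of u' with weight psi_i / h.  Hence
   both Q_h u and (Q_h u)' are of the form sum_i c_i(t) int kappa_i g with local nonnegative weights.
   These operators are uniformly bounded on L^2 and converge to the identity on continuous
   functions, so Q_h u -> u in W.  The same argument with g the difference of two distributional
   derivatives of u gives their uniqueness. *)

theory Submission
  imports Defs
begin

section \<open>The Bochner integral for arbitrary Banach spaces\<close>

text \<open>The weights are smooth because a distributional derivative is tested only with smooth
  functions of compact support; with indicators of cells as weights, the antiderivative of a
  difference of neighbours would be a tent, which is not admissible. Ordinary mollification reaches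
  beyond the interval near 0 and \<open>T\<close>, whereas each weight here stays inside its own
  cell. Interpolating the means, instead of using a step function, makes the derivative in V' an L^2
  function. All values are convex combinations of finitely many points of \<open>K\<close>, so only
  finitely many nodes are perturbed, and on a fixed mesh convergence of the nodes in V gives
  convergence of values and slopes. The slopes live in V', whose type carries no separability. The
  integral is therefore developed for general value spaces over a finite complete measure:
  finiteness makes every simple function integrable, completeness makes a.e. limits
  measurable.\<close>

locale finite_complete_measure = finite_measure M + complete_measure M for M :: "'a measure"
begin

lemma simple_bochner_integrable_iff:
  "Bochner_Integration.simple_bochner_integrable M s \<longleftrightarrow> simple_function M s"
  by (auto simp: Bochner_Integration.simple_bochner_integrable.simps)

section \<open>Measurability of a.e. limits of simple functions\<close>

lemma bochner_measurable_simple: "simple_function M s \<Longrightarrow> bochner_measurable M s"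
  unfolding bochner_measurable_def by (rule exI[of _ "\<lambda>_. s"]) auto

text \<open>Continuity of \<open>p\<close> is phrased as a rule on sequences, so that any
  \<open>tendsto\<close> rule can be plugged in directly.\<close>

lemma bochner_measurable_compose2:
  assumes f: "bochner_measurable M f" and g: "bochner_measurable M g"
    and p: "\<And>F G a b. F \<longlonglongrightarrow> a \<Longrightarrow> G \<longlonglongrightarrow> b \<Longrightarrow> (\<lambda>n::nat. p (F n) (G n)) \<longlonglongrightarrow> p a b"
  shows "bochner_measurable M (\<lambda>x. p (f x) (g x))"
proof -
  obtain s t where s: "\<And>n. simple_function M (s n)" "AE x in M. (\<lambda>n::nat. s n x) \<longlonglongrightarrow> f x"
    and t: "\<And>n. simple_function M (t n)" "AE x in M. (\<lambda>n::nat. t n x) \<longlonglongrightarrow> g x"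
    using f g unfolding bochner_measurable_def by auto
  show ?thesis unfolding bochner_measurable_def
  proof (intro exI[of _ "\<lambda>n x. p (s n x) (t n x)"] conjI allI)
    show "simple_function M (\<lambda>x. p (s n x) (t n x))" for n
      using s(1) t(1) by (rule simple_function_compose2)
    show "AE x in M. (\<lambda>n. p (s n x) (t n x)) \<longlonglongrightarrow> p (f x) (g x)"
      using s(2) t(2) by eventually_elim (rule p)
  qed
qed

lemma bochner_measurable_add:
  "bochner_measurable M f \<Longrightarrow> bochner_measurable M g \<Longrightarrow> bochner_measurable M (\<lambda>x. f x + g x)"
  by (rule bochner_measurable_compose2) (auto intro: tendsto_add)

lemma bochner_measurable_diff:
  "bochner_measurable M f \<Longrightarrow> bochner_measurable M g \<Longrightarrow> bochner_measurable M (\<lambda>x. f x - g x)"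
  by (rule bochner_measurable_compose2) (auto intro: tendsto_diff)

lemma bochner_measurable_bounded_linear:
  assumes "bounded_linear L" and f: "bochner_measurable M f"
  shows "bochner_measurable M (\<lambda>x. L (f x))"
  using f f by (rule bochner_measurable_compose2) (rule bounded_linear.tendsto[OF assms(1)])

lemma bochner_measurable_borel:
  fixes f :: "'a \<Rightarrow> 'b::{real_normed_vector, second_countable_topology}"
  assumes "f \<in> borel_measurable M"
  shows "bochner_measurable M f"
proof -
  obtain s where "\<And>n. simple_function M (s n)" "\<And>x. x \<in> space M \<Longrightarrow> (\<lambda>n. s n x) \<longlonglongrightarrow> f x"
    using borel_measurable_implies_sequence_metric[OF assms, of 0] by auto
  then show ?thesis
    unfolding bochner_measurable_def by (intro exI[of _ s]) auto
qed

lemma bochner_measurable_scaleR: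
  fixes g :: "'a \<Rightarrow> real"
  assumes "g \<in> borel_measurable M" "bochner_measurable M f"
  shows "bochner_measurable M (\<lambda>x. g x *\<^sub>R f x)"
  using bochner_measurable_borel[OF assms(1)] assms(2)
  by (rule bochner_measurable_compose2) (auto intro: tendsto_scaleR)

lemma bochner_measurable_const: "bochner_measurable M (\<lambda>_. x)"
  by (rule bochner_measurable_simple) simp

text \<open>Completeness of the measure: the two preimages differ by a null set, so measurability of
  one gives that of the other.\<close>

lemma borel_measurable_AE_eq:
  assumes f: "f \<in> borel_measurable M" and ae: "AE x in M. f x = g x"
  shows "g \<in> borel_measurable M"
proof (rule measurableI)
  fix A assume A: "A \<in> sets (borel :: 'b measure)"
  show "g -` A \<inter> space M \<in> sets M"
  proof (rule in_sets_AE)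
    show "AE x in M. x \<in> f -` A \<inter> space M \<longleftrightarrow> x \<in> g -` A \<inter> space M"
      using ae by eventually_elim auto
  qed (use f A in auto)
qed simp

text \<open>After the approximants are set to 0 on the exceptional null set they converge
  everywhere, so the modified limit is Borel; completeness then undoes the modification.\<close>

lemma bochner_measurable_imp_borel:
  fixes f :: "'a \<Rightarrow> 'b::real_normed_vector"
  assumes "bochner_measurable M f"
  shows "f \<in> borel_measurable M"
proof -
  obtain s where s: "\<And>n. simple_function M (s n)" "AE x in M. (\<lambda>n::nat. s n x) \<longlonglongrightarrow> f x"
    using assms unfolding bochner_measurable_def by auto
  obtain N where N: "N \<in> null_sets M" "\<And>x. x \<in> space M - N \<Longrightarrow> (\<lambda>n. s n x) \<longlonglongrightarrow> f x"
    using AE_E3[OF s(2)] by metis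
  let ?g = "\<lambda>x. if x \<in> N then 0 else f x"
  have "?g \<in> borel_measurable M"
  proof (rule borel_measurable_LIMSEQ_metric)
    show "(\<lambda>x. if x \<in> N then 0 else s n x) \<in> borel_measurable M" for n
      using s(1)[of n] N(1)
      by (intro borel_measurable_simple_function simple_function_If_set) (auto simp: Int_absorb1 sets.sets_into_space)
    show "(\<lambda>n. if x \<in> N then 0 else s n x) \<longlonglongrightarrow> ?g x" if "x \<in> space M" for x
      using N(2)[of x] that by auto
  qed
  moreover have "AE x in M. ?g x = f x"
    using AE_not_in[OF N(1)] by eventually_elim auto
  ultimately show ?thesis by (rule borel_measurable_AE_eq)
qed

lemma bochner_measurable_norm:
  assumes "bochner_measurable M f" shows "(\<lambda>x. norm (f x)) \<in> borel_measurable M"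
  using bochner_measurable_imp_borel[OF assms] by measurable

text \<open>Approximants with a dominating function. Cutting off where the norm exceeds
  \<open>2 * norm (f x)\<close> is harmless: the cut is eventually inactive if \<open>f x\<close> is
  nonzero, and it yields exactly 0 if \<open>f x = 0\<close>.\<close>

lemma bochner_approx:
  fixes f :: "'a \<Rightarrow> 'b::real_normed_vector"
  assumes "bochner_measurable M f"
  obtains s where "\<And>n. simple_function M (s n)" "AE x in M. (\<lambda>n::nat. s n x) \<longlonglongrightarrow> f x"
    "\<And>n x. norm (s n x) \<le> 2 * norm (f x)"
proof -
  obtain s where s: "\<And>n. simple_function M (s n)" "AE x in M. (\<lambda>n::nat. s n x) \<longlonglongrightarrow> f x"
    using assms unfolding bochner_measurable_def by auto
  have [measurable]: "f \<in> borel_measurable M" "\<And>n. s n \<in> borel_measurable M"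
    using bochner_measurable_imp_borel[OF assms] s(1) by (auto intro: borel_measurable_simple_function)
  define t where "t n x = (if norm (s n x) \<le> 2 * norm (f x) then s n x else 0)" for n x
  show ?thesis
  proof (rule that)
    show "simple_function M (t n)" for n
      unfolding t_def using s(1) by (intro simple_function_If) auto
    show "norm (t n x) \<le> 2 * norm (f x)" for n x by (simp add: t_def)
    show "AE x in M. (\<lambda>n. t n x) \<longlonglongrightarrow> f x"
      using s(2)
    proof eventually_elim
      case (elim x)
      show ?case
      proof (cases "f x = 0")
        case True
        then have "(\<lambda>n. t n x) = (\<lambda>_. 0)" by (auto simp: t_def)
        then show ?thesis using True by simp
      next
        case False
        have "(\<lambda>n. norm (s n x)) \<longlonglongrightarrow> norm (f x)" using elim by (rule tendsto_norm)
        then have "\<forall>\<^sub>F n in sequentially. norm (s n x) < 2 * norm (f x)"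
          by (rule order_tendstoD) (use False in simp)
        then have "\<forall>\<^sub>F n in sequentially. s n x = t n x"
          by eventually_elim (simp add: t_def)
        then show ?thesis using elim by (rule Lim_transform_eventually[rotated])
      qed
    qed
  qed
qed

section \<open>Existence and rules of the integral\<close>

lemma nn_norm_eq_integral:
  "integrable M f \<Longrightarrow> (\<And>x. 0 \<le> f x) \<Longrightarrow> (\<integral>\<^sup>+x. ennreal (f x) \<partial>M) = ennreal (\<integral>x. f x \<partial>M)"
  by (rule nn_integral_eq_integral) auto

lemma simple_bochner_integral_norm_le:
  fixes s :: "'a \<Rightarrow> 'b::real_normed_vector"
  assumes "simple_function M s"
  shows "ennreal (norm (Bochner_Integration.simple_bochner_integral M s)) \<le> (\<integral>\<^sup>+x. ennreal (norm (s x)) \<partial>M)"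
proof -
  have s: "Bochner_Integration.simple_bochner_integrable M s"
    using assms by (simp add: simple_bochner_integrable_iff)
  have "Bochner_Integration.simple_bochner_integrable M (\<lambda>x. norm (s x))"
    using assms simple_function_compose1[OF assms, of norm] by (simp add: simple_bochner_integrable_iff)
  then have "(\<integral>\<^sup>+x. ennreal (norm (s x)) \<partial>M) = ennreal (Bochner_Integration.simple_bochner_integral M (\<lambda>x. norm (s x)))"
    by (rule Bochner_Integration.simple_bochner_integral_eq_nn_integral[symmetric]) simp
  then show ?thesis
    using Bochner_Integration.simple_bochner_integral_norm_bound[OF s] by (simp add: ennreal_leI)
qed

text \<open>The simple integrals form a Cauchy sequence, since their differences are bounded by the
  L^1 distances of the approximants to \<open>f\<close>; completeness of the value space provides
  the limit.\<close>

lemma ex_has_bochner_int: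
  fixes f :: "'a \<Rightarrow> 'b::banach"
  assumes f: "bochner_measurable M f" and int: "integrable M (\<lambda>x. norm (f x))"
  obtains I where "has_bochner_int M f I"
proof -
  obtain s where s: "\<And>n. simple_function M (s n)" "AE x in M. (\<lambda>n::nat. s n x) \<longlonglongrightarrow> f x"
    and bound: "\<And>n x. norm (s n x) \<le> 2 * norm (f x)"
    using bochner_approx[OF f] by metis
  have [measurable]: "f \<in> borel_measurable M" "\<And>n. s n \<in> borel_measurable M"
    using bochner_measurable_imp_borel[OF f] s(1) by (auto intro: borel_measurable_simple_function)
  let ?S = "Bochner_Integration.simple_bochner_integral M"
  have meas: "(\<lambda>x. norm (f x - s n x)) \<in> borel_measurable M" for n
    by (intro bochner_measurable_norm bochner_measurable_diff f bochner_measurable_simple s)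
  have le: "norm (f x - s n x) \<le> 3 * norm (f x)" for n x
    using norm_triangle_ineq4[of "f x" "s n x"] bound[of n x] by simp
  have int_d: "integrable M (\<lambda>x. norm (f x - s n x))" for n
    by (rule Bochner_Integration.integrable_bound[where f="\<lambda>x. 3 * norm (f x)"])
       (use int le meas in auto)
  have "(\<lambda>n. \<integral>x. norm (f x - s n x) \<partial>M) \<longlonglongrightarrow> (\<integral>x. 0 \<partial>M)"
  proof (rule integral_dominated_convergence[where w="\<lambda>x. 3 * norm (f x)"])
    show "AE x in M. (\<lambda>n. norm (f x - s n x)) \<longlonglongrightarrow> 0"
      using s(2) by eventually_elim (auto intro!: tendsto_eq_intros)
  qed (use int le meas in auto)
  then have lim: "(\<lambda>n. \<integral>x. norm (f x - s n x) \<partial>M) \<longlonglongrightarrow> 0" by simp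
  have nn: "(\<integral>\<^sup>+x. ennreal (norm (f x - s n x)) \<partial>M) = ennreal (\<integral>x. norm (f x - s n x) \<partial>M)" for n
    by (rule nn_norm_eq_integral) (use int_d in auto)
  have diff: "norm (?S (s m) - ?S (s n)) \<le> (\<integral>x. norm (f x - s m x) \<partial>M) + (\<integral>x. norm (f x - s n x) \<partial>M)" for m n
  proof -
    have sd: "simple_function M (\<lambda>x. s m x - s n x)"
      using s(1) by (intro simple_function_diff)
    have "ennreal (norm (?S (s m) - ?S (s n))) = ennreal (norm (?S (\<lambda>x. s m x - s n x)))"
      using s(1) by (subst Bochner_Integration.simple_bochner_integral_diff) (auto simp: simple_bochner_integrable_iff)
    also have "\<dots> \<le> (\<integral>\<^sup>+x. ennreal (norm (s m x - s n x)) \<partial>M)"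
      by (rule simple_bochner_integral_norm_le[OF sd])
    also have "\<dots> \<le> (\<integral>\<^sup>+x. ennreal (norm (f x - s m x) + norm (f x - s n x)) \<partial>M)"
      by (intro nn_integral_mono ennreal_leI) norm
    also have "\<dots> = ennreal (\<integral>x. (norm (f x - s m x) + norm (f x - s n x)) \<partial>M)"
      by (rule nn_norm_eq_integral) (use int_d in auto)
    also have "(\<integral>x. (norm (f x - s m x) + norm (f x - s n x)) \<partial>M) = (\<integral>x. norm (f x - s m x) \<partial>M) + (\<integral>x. norm (f x - s n x) \<partial>M)"
      using int_d by simp
    finally show ?thesis
      by (subst (asm) ennreal_le_iff) (auto intro!: add_nonneg_nonneg integral_nonneg_AE)
  qed
  have "Cauchy (\<lambda>n. ?S (s n))"
  proof (rule metric_CauchyI)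
    fix e :: real assume "0 < e"
    then have "\<forall>\<^sub>F n in sequentially. (\<integral>x. norm (f x - s n x) \<partial>M) < e / 2"
      using lim by (intro order_tendstoD) auto
    then obtain N where N: "\<And>n. n \<ge> N \<Longrightarrow> (\<integral>x. norm (f x - s n x) \<partial>M) < e / 2"
      by (auto simp: eventually_sequentially)
    show "\<exists>N. \<forall>m\<ge>N. \<forall>n\<ge>N. dist (?S (s m)) (?S (s n)) < e"
    proof (intro exI[of _ N] allI impI)
      fix m n assume "N \<le> m" "N \<le> n"
      then show "dist (?S (s m)) (?S (s n)) < e"
        using diff[of m n] N[of m] N[of n] by (simp add: dist_norm)
    qed
  qed
  then obtain I where I: "(\<lambda>n. ?S (s n)) \<longlonglongrightarrow> I"
    using Cauchy_convergent_iff convergent_def by metis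
  have "has_bochner_int M f I"
    unfolding has_bochner_int_def
  proof (intro conjI exI[of _ s] allI)
    show "(\<lambda>n. \<integral>\<^sup>+ x. ennreal (norm (f x - s n x)) \<partial>M) \<longlonglongrightarrow> 0"
      unfolding nn using tendsto_ennrealI[OF lim] by simp
  qed (use f s I in \<open>auto simp: simple_bochner_integrable_iff\<close>)
  then show ?thesis by (rule that)
qed

lemma has_bochner_intE:
  assumes "has_bochner_int M f I"
  obtains s where "bochner_measurable M f" "\<And>n. simple_function M (s n)"
    "(\<lambda>n::nat. \<integral>\<^sup>+ x. ennreal (norm (f x - s n x)) \<partial>M) \<longlonglongrightarrow> 0"
    "(\<lambda>n. Bochner_Integration.simple_bochner_integral M (s n)) \<longlonglongrightarrow> I"
    "\<And>n. (\<lambda>x. norm (f x - s n x)) \<in> borel_measurable M"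
proof -
  obtain s where f: "bochner_measurable M f" and s: "\<And>n. simple_function M (s n)"
    and "(\<lambda>n::nat. \<integral>\<^sup>+ x. ennreal (norm (f x - s n x)) \<partial>M) \<longlonglongrightarrow> 0"
    "(\<lambda>n. Bochner_Integration.simple_bochner_integral M (s n)) \<longlonglongrightarrow> I"
    using assms unfolding has_bochner_int_def by (auto simp: simple_bochner_integrable_iff)
  moreover have "(\<lambda>x. norm (f x - s n x)) \<in> borel_measurable M" for n
    by (intro bochner_measurable_norm bochner_measurable_diff f bochner_measurable_simple s)
  ultimately show ?thesis by (intro that) auto
qed

lemma nn_integral_norm_le_add:
  assumes "g \<in> borel_measurable M" "h \<in> borel_measurable M"
    and "\<And>x. f x \<le> g x + h x" "\<And>x. 0 \<le> g x" "\<And>x. 0 \<le> h x"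
  shows "(\<integral>\<^sup>+x. ennreal (f x) \<partial>M) \<le> (\<integral>\<^sup>+x. ennreal (g x) \<partial>M) + (\<integral>\<^sup>+x. ennreal (h x) \<partial>M)"
proof -
  have "(\<integral>\<^sup>+x. ennreal (f x) \<partial>M) \<le> (\<integral>\<^sup>+x. ennreal (g x) + ennreal (h x) \<partial>M)"
    using assms(3-5) by (intro nn_integral_mono) (simp add: ennreal_leI flip: ennreal_plus)
  then show ?thesis
    using assms(1,2) by (subst (asm) nn_integral_add) auto
qed

text \<open>Stated in \<open>ennreal\<close>, so that no integrability has to be supplied; applied
  to the difference of \<open>f\<close> with itself it gives uniqueness of the integral.\<close>

lemma has_bochner_int_norm_le_nn:
  fixes f :: "'a \<Rightarrow> 'b::real_normed_vector"
  assumes "has_bochner_int M f I"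
  shows "ennreal (norm I) \<le> (\<integral>\<^sup>+x. ennreal (norm (f x)) \<partial>M)"
proof -
  let ?S = "Bochner_Integration.simple_bochner_integral M"
  obtain s where f: "bochner_measurable M f" and s: "\<And>n. simple_function M (s n)"
    and lim: "(\<lambda>n::nat. \<integral>\<^sup>+ x. ennreal (norm (f x - s n x)) \<partial>M) \<longlonglongrightarrow> 0"
    and I: "(\<lambda>n. ?S (s n)) \<longlonglongrightarrow> I"
    and meas: "\<And>n. (\<lambda>x. norm (f x - s n x)) \<in> borel_measurable M"
    by (rule has_bochner_intE[OF assms], rule that)
  have le: "ennreal (norm (?S (s n))) \<le> (\<integral>\<^sup>+x. ennreal (norm (f x)) \<partial>M) + (\<integral>\<^sup>+ x. ennreal (norm (f x - s n x)) \<partial>M)" for n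
  proof -
    have "norm (s n x) \<le> norm (f x) + norm (f x - s n x)" for x by norm
    then show ?thesis
      using simple_bochner_integral_norm_le[OF s, of n] nn_integral_norm_le_add[OF bochner_measurable_norm[OF f] meas[of n]]
      by (meson norm_ge_zero order_trans)
  qed
  have "(\<lambda>n. ennreal (norm (?S (s n)))) \<longlonglongrightarrow> ennreal (norm I)"
    by (intro tendsto_ennrealI tendsto_norm I)
  moreover have "(\<lambda>n. (\<integral>\<^sup>+x. ennreal (norm (f x)) \<partial>M) + (\<integral>\<^sup>+ x. ennreal (norm (f x - s n x)) \<partial>M))
      \<longlonglongrightarrow> (\<integral>\<^sup>+x. ennreal (norm (f x)) \<partial>M)"
    using tendsto_add[OF tendsto_const lim] by simp
  ultimately show ?thesis
    by (rule LIMSEQ_le) (use le in auto)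
qed

lemma has_bochner_int_norm_le:
  fixes f :: "'a \<Rightarrow> 'b::real_normed_vector"
  assumes "has_bochner_int M f I" "integrable M (\<lambda>x. norm (f x))"
  shows "norm I \<le> (\<integral>x. norm (f x) \<partial>M)"
  using has_bochner_int_norm_le_nn[OF assms(1)] nn_norm_eq_integral[OF assms(2)]
  by (simp add: integral_nonneg_AE)

lemma has_bochner_int_diff:
  fixes f g :: "'a \<Rightarrow> 'b::real_normed_vector"
  assumes "has_bochner_int M f I" "has_bochner_int M g J"
  shows "has_bochner_int M (\<lambda>x. f x - g x) (I - J)"
proof -
  let ?S = "Bochner_Integration.simple_bochner_integral M"
  obtain s where f: "bochner_measurable M f" and s: "\<And>n. simple_function M (s n)"
    and lim: "(\<lambda>n::nat. \<integral>\<^sup>+ x. ennreal (norm (f x - s n x)) \<partial>M) \<longlonglongrightarrow> 0"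
    and I: "(\<lambda>n. ?S (s n)) \<longlonglongrightarrow> I"
    and meas: "\<And>n. (\<lambda>x. norm (f x - s n x)) \<in> borel_measurable M"
    by (rule has_bochner_intE[OF assms(1)], rule that)
  obtain t where g: "bochner_measurable M g" and t: "\<And>n. simple_function M (t n)"
    and lim': "(\<lambda>n::nat. \<integral>\<^sup>+ x. ennreal (norm (g x - t n x)) \<partial>M) \<longlonglongrightarrow> 0"
    and J: "(\<lambda>n. ?S (t n)) \<longlonglongrightarrow> J"
    and meas': "\<And>n. (\<lambda>x. norm (g x - t n x)) \<in> borel_measurable M"
    by (rule has_bochner_intE[OF assms(2)], rule that)
  show ?thesis unfolding has_bochner_int_def
  proof (intro conjI exI[of _ "\<lambda>n x. s n x - t n x"] allI)
    show "bochner_measurable M (\<lambda>x. f x - g x)" by (rule bochner_measurable_diff[OF f g])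
    show "Bochner_Integration.simple_bochner_integrable M (\<lambda>x. s n x - t n x)" for n
      unfolding simple_bochner_integrable_iff using s t by (rule simple_function_diff)
    have "?S (\<lambda>x. s n x - t n x) = ?S (s n) - ?S (t n)" for n
      using s t by (intro Bochner_Integration.simple_bochner_integral_diff) (auto simp: simple_bochner_integrable_iff)
    then show "(\<lambda>n. ?S (\<lambda>x. s n x - t n x)) \<longlonglongrightarrow> I - J"
      using tendsto_diff[OF I J] by simp
    have "norm (f x - g x - (s n x - t n x)) \<le> norm (f x - s n x) + norm (g x - t n x)" for n x
      by norm
    then have le: "(\<integral>\<^sup>+ x. ennreal (norm (f x - g x - (s n x - t n x))) \<partial>M) \<le>
      (\<integral>\<^sup>+ x. ennreal (norm (f x - s n x)) \<partial>M) + (\<integral>\<^sup>+ x. ennreal (norm (g x - t n x)) \<partial>M)" for n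
      by (intro nn_integral_norm_le_add meas meas') auto
    have "(\<lambda>n. (\<integral>\<^sup>+ x. ennreal (norm (f x - s n x)) \<partial>M) + (\<integral>\<^sup>+ x. ennreal (norm (g x - t n x)) \<partial>M)) \<longlonglongrightarrow> 0"
      using tendsto_add[OF lim lim'] by simp
    from tendsto_sandwich[OF _ _ tendsto_const this] le show "(\<lambda>n. \<integral>\<^sup>+ x. ennreal (norm (f x - g x - (s n x - t n x))) \<partial>M) \<longlonglongrightarrow> 0"
      by simp
  qed
qed

lemma has_bochner_int_bounded_linear:
  fixes f :: "'a \<Rightarrow> 'b::real_normed_vector"
  assumes "bounded_linear L" "has_bochner_int M f I"
  shows "has_bochner_int M (\<lambda>x. L (f x)) (L I)"
proof -
  interpret L: bounded_linear L by fact
  obtain s where f: "bochner_measurable M f" and s: "\<And>n. simple_function M (s n)"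
    and lim: "(\<lambda>n::nat. \<integral>\<^sup>+ x. ennreal (norm (f x - s n x)) \<partial>M) \<longlonglongrightarrow> 0"
    and I: "(\<lambda>n. Bochner_Integration.simple_bochner_integral M (s n)) \<longlonglongrightarrow> I"
    and meas: "\<And>n. (\<lambda>x. norm (f x - s n x)) \<in> borel_measurable M"
    by (rule has_bochner_intE[OF assms(2)], rule that)
  obtain C where C: "C > 0" "\<And>x. norm (L x) \<le> norm x * C" using L.pos_bounded by blast
  show ?thesis unfolding has_bochner_int_def
  proof (intro conjI exI[of _ "\<lambda>n x. L (s n x)"] allI)
    show "bochner_measurable M (\<lambda>x. L (f x))" by (rule bochner_measurable_bounded_linear[OF assms(1) f])
    show "Bochner_Integration.simple_bochner_integrable M (\<lambda>x. L (s n x))" for n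
      unfolding simple_bochner_integrable_iff using s by (rule simple_function_compose1)
    have "Bochner_Integration.simple_bochner_integral M (\<lambda>x. L (s n x)) = L (Bochner_Integration.simple_bochner_integral M (s n))" for n
      using s by (intro Bochner_Integration.simple_bochner_integral_linear L.linear_axioms) (auto simp: simple_bochner_integrable_iff)
    then show "(\<lambda>n. Bochner_Integration.simple_bochner_integral M (\<lambda>x. L (s n x))) \<longlonglongrightarrow> L I"
      using L.tendsto[OF I] by simp
    have le: "(\<integral>\<^sup>+ x. ennreal (norm (L (f x) - L (s n x))) \<partial>M) \<le>
      ennreal C * (\<integral>\<^sup>+ x. ennreal (norm (f x - s n x)) \<partial>M)" for n
    proof -
      have "norm (L (f x) - L (s n x)) \<le> C * norm (f x - s n x)" for x
        using C(2)[of "f x - s n x"] by (simp add: L.diff mult.commute)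
      then have "(\<integral>\<^sup>+ x. ennreal (norm (L (f x) - L (s n x))) \<partial>M) \<le> (\<integral>\<^sup>+ x. ennreal C * ennreal (norm (f x - s n x)) \<partial>M)"
        using C(1) by (intro nn_integral_mono) (simp add: ennreal_leI flip: ennreal_mult)
      also have "\<dots> = ennreal C * (\<integral>\<^sup>+ x. ennreal (norm (f x - s n x)) \<partial>M)"
        using meas by (intro nn_integral_cmult) auto
      finally show ?thesis .
    qed
    have "(\<lambda>n. ennreal C * (\<integral>\<^sup>+ x. ennreal (norm (f x - s n x)) \<partial>M)) \<longlonglongrightarrow> 0"
      using ennreal_tendsto_cmult[OF _ lim, of "ennreal C"] by simp
    from tendsto_sandwich[OF _ _ tendsto_const this] le show "(\<lambda>n. \<integral>\<^sup>+ x. ennreal (norm (L (f x) - L (s n x))) \<partial>M) \<longlonglongrightarrow> 0"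
      by simp
  qed
qed

text \<open>For separable value types the two notions differ only in the measurability clause. This
  gives access to the integral calculus for scalar functions and for V-valued averages.\<close>

lemma has_bochner_int_iff_lebesgue:
  fixes f :: "'a \<Rightarrow> 'b::{real_normed_vector, second_countable_topology}"
  shows "has_bochner_int M f I \<longleftrightarrow> has_bochner_integral M f I"
proof -
  have "bochner_measurable M f \<longleftrightarrow> f \<in> borel_measurable M"
    using bochner_measurable_borel bochner_measurable_imp_borel by metis
  then show ?thesis
    unfolding has_bochner_int_def has_bochner_integral.simps by blast
qed

lemma has_bochner_int_scaleR_const:
  assumes "integrable M g"
  shows "has_bochner_int M (\<lambda>x. g x *\<^sub>R y) ((\<integral>x. g x \<partial>M) *\<^sub>R y)"
  using has_bochner_int_bounded_linear[OF bounded_linear_scaleR_left]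
    has_bochner_integral_integrable[OF assms] has_bochner_int_iff_lebesgue[of g] by blast

lemma has_bochner_int_unique:
  fixes f :: "'a \<Rightarrow> 'b::real_normed_vector"
  assumes "has_bochner_int M f I" "has_bochner_int M f J"
  shows "I = J"
  using has_bochner_int_norm_le_nn[OF has_bochner_int_diff[OF assms]] by simp

lemma has_bochner_int_add:
  fixes f g :: "'a \<Rightarrow> 'b::real_normed_vector"
  assumes "has_bochner_int M f I" "has_bochner_int M g J"
  shows "has_bochner_int M (\<lambda>x. f x + g x) (I + J)"
  using has_bochner_int_diff[OF assms(1) has_bochner_int_bounded_linear[OF bounded_linear_minus[OF bounded_linear_ident] assms(2)]]
  by simp

lemma has_bochner_int_sum:
  fixes f :: "'i \<Rightarrow> 'a \<Rightarrow> 'b::real_normed_vector"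
  assumes "finite A" "\<And>i. i \<in> A \<Longrightarrow> has_bochner_int M (f i) (I i)"
  shows "has_bochner_int M (\<lambda>x. \<Sum>i\<in>A. f i x) (\<Sum>i\<in>A. I i)"
  using assms
proof (induction A rule: finite_induct)
  case empty
  then show ?case using has_bochner_int_scaleR_const[of "\<lambda>_. 0" 0] by simp
next
  case (insert i A)
  then show ?case using has_bochner_int_add[of "f i" "I i"] by simp
qed

end

section \<open>Square integrable functions\<close>

lemma finite_complete_measure_time: "finite_complete_measure (time_measure T)"
proof (intro finite_complete_measure.intro)
  show "finite_measure (time_measure T)"
    by (rule finite_measure_lebesgue_on) simp
  show "complete_measure (time_measure T)"
  proof
    fix A B assume "B \<subseteq> A" "A \<in> null_sets (time_measure T)"
    then have "A \<in> null_sets lebesgue" "A \<subseteq> {0<..<T}"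
      by (auto simp: null_sets_restrict_space)
    then have "B \<in> sets lebesgue"
      using \<open>B \<subseteq> A\<close> null_sets_completion_subset by blast
    then show "B \<in> sets (time_measure T)"
      using \<open>B \<subseteq> A\<close> \<open>A \<subseteq> {0<..<T}\<close> by (auto simp: sets_restrict_space image_iff)
  qed
qed

interpretation time: finite_complete_measure "time_measure T" for T
  by (rule finite_complete_measure_time)

text \<open>Estimates use the squared seminorm, which is a plain integral; the inequality
  \<open>(a + b)^2 <= 2 * a^2 + 2 * b^2\<close> plays the part of the triangle inequality and is the
  source of the factors 2 below.\<close>

abbreviation L2_sq :: "real \<Rightarrow> (real \<Rightarrow> 'b::real_normed_vector) \<Rightarrow> real" where
  "L2_sq T u \<equiv> \<integral>t. (norm (u t))\<^sup>2 \<partial>time_measure T"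

lemma measure_time: "0 \<le> T \<Longrightarrow> measure (time_measure T) {0<..<T} = T"
  by (simp add: measure_restrict_space)

lemma borel_imp_time_measurable:
  "f \<in> borel_measurable borel \<Longrightarrow> f \<in> borel_measurable (time_measure T)"
  by (intro measurable_restrict_space1 measurable_completion) simp

lemma AE_time_in: "AE t in time_measure T. t \<in> {0<..<T}"
  using AE_space[of "time_measure T"] by simp

lemma norm_power2_add_le:
  fixes x y :: "'b::real_normed_vector"
  shows "(norm (x + y))\<^sup>2 \<le> 2 * (norm x)\<^sup>2 + 2 * (norm y)\<^sup>2"
proof -
  have "(norm (x + y))\<^sup>2 \<le> (norm x + norm y)\<^sup>2"
    by (intro power_mono norm_triangle_ineq) simp
  also have "\<dots> \<le> 2 * (norm x)\<^sup>2 + 2 * (norm y)\<^sup>2"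
    using sum_squares_bound[of "norm x" "norm y"] by (simp add: power2_sum)
  finally show ?thesis .
qed

lemma L2_spaceD:
  assumes "u \<in> L2_space T"
  shows "bochner_measurable (time_measure T) u" "integrable (time_measure T) (\<lambda>t. (norm (u t))\<^sup>2)"
    "(\<lambda>t. norm (u t)) \<in> borel_measurable (time_measure T)"
  using assms time.bochner_measurable_norm by (auto simp: L2_space_def)

lemma L2_space_dominated:
  assumes v: "v \<in> L2_space T" and u: "bochner_measurable (time_measure T) u"
    and le: "\<And>t. norm (u t) \<le> B * norm (v t)"
  shows "u \<in> L2_space T"
proof -
  have "integrable (time_measure T) (\<lambda>t. (norm (u t))\<^sup>2)"
  proof (rule Bochner_Integration.integrable_bound)
    show "integrable (time_measure T) (\<lambda>t. B\<^sup>2 * (norm (v t))\<^sup>2)"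
      using L2_spaceD(2)[OF v] by simp
    show "(\<lambda>t. (norm (u t))\<^sup>2) \<in> borel_measurable (time_measure T)"
      using time.bochner_measurable_norm[OF u] by measurable
    have "(norm (u t))\<^sup>2 \<le> (B * norm (v t))\<^sup>2" for t
      by (intro power_mono le) simp
    then show "AE t in time_measure T. norm ((norm (u t))\<^sup>2) \<le> norm (B\<^sup>2 * (norm (v t))\<^sup>2)"
      by (simp add: power_mult_distrib)
  qed
  with u show ?thesis by (simp add: L2_space_def)
qed

lemma L2_space_bounded:
  assumes "bochner_measurable (time_measure T) u" "\<And>t. norm (u t) \<le> B"
  shows "u \<in> L2_space T"
proof -
  have "(\<lambda>_. 1::real) \<in> L2_space T"
    by (auto simp: L2_space_def intro: time.bochner_measurable_const)
  then show ?thesis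
    by (rule L2_space_dominated[of _ _ _ B]) (use assms in auto)
qed

lemma L2_space_const: "(\<lambda>_. x) \<in> L2_space T"
  by (rule L2_space_bounded[of _ _ "norm x"]) (auto intro: time.bochner_measurable_const)

lemma L2_space_add:
  assumes "u \<in> L2_space T" "v \<in> L2_space T"
  shows "(\<lambda>t. u t + v t) \<in> L2_space T"
proof -
  have m: "bochner_measurable (time_measure T) (\<lambda>t. u t + v t)"
    using assms by (intro time.bochner_measurable_add L2_spaceD)
  have "integrable (time_measure T) (\<lambda>t. (norm (u t + v t))\<^sup>2)"
  proof (rule Bochner_Integration.integrable_bound)
    show "integrable (time_measure T) (\<lambda>t. 2 * (norm (u t))\<^sup>2 + 2 * (norm (v t))\<^sup>2)"
      using assms[THEN L2_spaceD(2)] by simp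
    show "(\<lambda>t. (norm (u t + v t))\<^sup>2) \<in> borel_measurable (time_measure T)"
      using time.bochner_measurable_norm[OF m] by measurable
  qed (use norm_power2_add_le in auto)
  with m show ?thesis by (simp add: L2_space_def)
qed

lemma L2_space_bounded_linear:
  assumes "bounded_linear L" "u \<in> L2_space T"
  shows "(\<lambda>t. L (u t)) \<in> L2_space T"
proof -
  obtain K where "\<And>x. norm (L x) \<le> norm x * K" using bounded_linear.bounded[OF assms(1)] by blast
  then have "norm (L (u t)) \<le> K * norm (u t)" for t by (simp add: mult.commute)
  then show ?thesis
    by (rule L2_space_dominated[OF assms(2) time.bochner_measurable_bounded_linear[OF assms(1) L2_spaceD(1)[OF assms(2)]]])
qed

lemma L2_space_scaleR_bounded:
  assumes "g \<in> borel_measurable (time_measure T)" "\<And>t. \<bar>g t\<bar> \<le> B" "u \<in> L2_space T"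
  shows "(\<lambda>t. g t *\<^sub>R u t) \<in> L2_space T"
  by (rule L2_space_dominated[OF assms(3) time.bochner_measurable_scaleR[OF assms(1) L2_spaceD(1)[OF assms(3)]]])
     (simp, rule mult_right_mono[OF assms(2)], simp)

lemma L2_space_diff:
  assumes "u \<in> L2_space T" "v \<in> L2_space T"
  shows "(\<lambda>t. u t - v t) \<in> L2_space T"
  using L2_space_add[OF assms(1) L2_space_bounded_linear[OF bounded_linear_minus[OF bounded_linear_ident] assms(2)]]
  by simp

lemma L2_space_sum:
  assumes "\<And>i. i \<in> A \<Longrightarrow> u i \<in> L2_space T"
  shows "(\<lambda>t. \<Sum>i\<in>A. u i t) \<in> L2_space T"
  using assms by (induction A rule: infinite_finite_induct) (auto intro: L2_space_const L2_space_add)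

lemma L2_integrable_norm:
  assumes "u \<in> L2_space T"
  shows "integrable (time_measure T) (\<lambda>t. norm (u t))"
proof (rule Bochner_Integration.integrable_bound)
  show "integrable (time_measure T) (\<lambda>t. 1 + (norm (u t))\<^sup>2)"
    using L2_spaceD(2)[OF assms] by simp
  have "norm (u t) \<le> 1 + (norm (u t))\<^sup>2" for t
    using sum_squares_bound[of "norm (u t)" 1] by (simp add: power2_eq_square) (smt (verit) norm_ge_zero mult_nonneg_nonneg)
  then show "AE t in time_measure T. norm (norm (u t)) \<le> norm (1 + (norm (u t))\<^sup>2)"
    by simp
qed (use L2_spaceD(3)[OF assms] in auto)

lemma L2_sq_nonneg: "0 \<le> L2_sq T u"
  by (rule integral_nonneg_AE) simp

lemma L2_sq_add_le:
  assumes "u \<in> L2_space T" "v \<in> L2_space T"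
  shows "L2_sq T (\<lambda>t. u t + v t) \<le> 2 * L2_sq T u + 2 * L2_sq T v"
proof -
  have "L2_sq T (\<lambda>t. u t + v t) \<le> (\<integral>t. 2 * (norm (u t))\<^sup>2 + 2 * (norm (v t))\<^sup>2 \<partial>time_measure T)"
    using assms[THEN L2_spaceD(2)] L2_spaceD(2)[OF L2_space_add[OF assms]]
    by (intro integral_mono norm_power2_add_le) simp_all
  also have "\<dots> = 2 * L2_sq T u + 2 * L2_sq T v"
    using assms[THEN L2_spaceD(2)] by simp
  finally show ?thesis .
qed

lemma L2_sq_diff_le:
  assumes "u \<in> L2_space T" "v \<in> L2_space T" "w \<in> L2_space T"
  shows "L2_sq T (\<lambda>t. u t - w t) \<le> 2 * L2_sq T (\<lambda>t. u t - v t) + 2 * L2_sq T (\<lambda>t. v t - w t)"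
  using L2_sq_add_le[OF L2_space_diff[OF assms(1,2)] L2_space_diff[OF assms(2,3)]] by simp

lemma L2_sq_le_const:
  assumes "u \<in> L2_space T" "0 \<le> T" "0 \<le> B" "\<And>t. t \<in> {0<..<T} \<Longrightarrow> norm (u t) \<le> B"
  shows "L2_sq T u \<le> B\<^sup>2 * T"
proof -
  have "L2_sq T u \<le> (\<integral>t. B\<^sup>2 \<partial>time_measure T)"
    using assms by (intro integral_mono_AE L2_spaceD) (auto intro: power_mono)
  then show ?thesis using assms(2) by (simp add: measure_time mult.commute)
qed

lemma L2_sq_AE_zero:
  assumes "u \<in> L2_space T" "L2_sq T u = 0"
  shows "AE t in time_measure T. u t = 0"
  using integral_nonneg_eq_0_iff_AE[OF L2_spaceD(2)[OF assms(1)]] assms(2) by simp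

text \<open>Jensen's inequality for the square, by expanding \<open>k * (g - m)^2 >= 0\<close> at
  the weighted mean \<open>m\<close>. Mass at most 1 is enough because the mass multiplies
  \<open>m^2\<close> in the expansion.\<close>

lemma power2_weighted_integral_le:
  fixes g k :: "'a \<Rightarrow> real"
  assumes k: "integrable M k" "\<And>x. 0 \<le> k x" "(\<integral>x. k x \<partial>M) \<le> 1"
    and g: "integrable M (\<lambda>x. k x * g x)" "integrable M (\<lambda>x. k x * (g x)\<^sup>2)"
  shows "(\<integral>x. k x * g x \<partial>M)\<^sup>2 \<le> (\<integral>x. k x * (g x)\<^sup>2 \<partial>M)"
proof -
  define m where "m = (\<integral>x. k x * g x \<partial>M)"
  have "0 \<le> (\<integral>x. k x * (g x - m)\<^sup>2 \<partial>M)"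
    using k(2) by (intro integral_nonneg_AE) auto
  also have "(\<integral>x. k x * (g x - m)\<^sup>2 \<partial>M) = (\<integral>x. k x * (g x)\<^sup>2 - 2 * m * (k x * g x) + m\<^sup>2 * k x \<partial>M)"
    by (intro arg_cong[where f="integral\<^sup>L M"] ext) (simp add: power2_eq_square algebra_simps)
  also have "\<dots> = (\<integral>x. k x * (g x)\<^sup>2 \<partial>M) - 2 * m * m + m\<^sup>2 * (\<integral>x. k x \<partial>M)"
    using k g by (simp add: m_def)
  also have "\<dots> \<le> (\<integral>x. k x * (g x)\<^sup>2 \<partial>M) - m\<^sup>2"
    using mult_left_mono[OF k(3), of "m\<^sup>2"] by (simp add: power2_eq_square)
  finally show ?thesis by (simp add: m_def)
qed

text \<open>Dense functions of the form scalar coefficient times fixed vector: on them a kernel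
  operator acts through the coefficients, so convergence of vector-valued operators becomes a scalar
  question.\<close>

lemma L2_dense_continuous:
  fixes u :: "real \<Rightarrow> 'b::real_normed_vector"
  assumes u: "u \<in> L2_space T" and e: "0 < e"
  obtains Y :: "'b set" and c :: "'b \<Rightarrow> real \<Rightarrow> real"
  where "finite Y" "\<And>y. continuous_on UNIV (c y)" "\<And>y t. 0 \<le> c y t" "\<And>y t. c y t \<le> 1"
    "L2_sq T (\<lambda>t. u t - (\<Sum>y\<in>Y. c y t *\<^sub>R y)) < e"
proof -
  obtain s where s: "\<And>n. simple_function (time_measure T) (s n)"
    and lim: "AE x in time_measure T. (\<lambda>n::nat. s n x) \<longlonglongrightarrow> u x"
    and bound: "\<And>n x. norm (s n x) \<le> 2 * norm (u x)"
    by (rule time.bochner_approx[OF L2_spaceD(1)[OF u]], rule that)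
  have s_L2: "s n \<in> L2_space T" for n
    by (rule L2_space_dominated[OF u _ bound]) (intro time.bochner_measurable_simple s)
  have us: "(\<lambda>t. u t - s n t) \<in> L2_space T" for n by (intro L2_space_diff u s_L2)
  have "(\<lambda>n. L2_sq T (\<lambda>t. u t - s n t)) \<longlonglongrightarrow> (\<integral>t. 0 \<partial>time_measure T)"
  proof (rule integral_dominated_convergence[where w="\<lambda>t. 9 * (norm (u t))\<^sup>2"])
    show "AE t in time_measure T. (\<lambda>n. (norm (u t - s n t))\<^sup>2) \<longlonglongrightarrow> 0"
      using lim by eventually_elim (auto intro!: tendsto_eq_intros)
    have "norm (u t - s n t) \<le> 3 * norm (u t)" for n t
      using norm_triangle_ineq4[of "u t" "s n t"] bound[of n t] by simp
    then have "(norm (u t - s n t))\<^sup>2 \<le> (3 * norm (u t))\<^sup>2" for n t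
      by (intro power_mono) auto
    then show "AE t in time_measure T. norm ((norm (u t - s n t))\<^sup>2) \<le> 9 * (norm (u t))\<^sup>2" for n
      by (simp add: power_mult_distrib)
  qed (use L2_spaceD(2)[OF u] L2_spaceD(2)[OF us] in auto)
  then have "\<forall>\<^sub>F n in sequentially. L2_sq T (\<lambda>t. u t - s n t) < e / 4"
    using e by (intro order_tendstoD) auto
  then obtain n where n: "L2_sq T (\<lambda>t. u t - s n t) < e / 4"
    by (auto simp: eventually_sequentially)
  define Y where "Y = s n ` {0<..<T}"
  have Y: "finite Y" using s[of n] by (simp add: Y_def simple_function_def)
  define A where "A y = s n -` {y} \<inter> {0<..<T}" for y
  have A: "A y \<in> sets lebesgue" for y
    using simple_functionD(2)[OF s[of n], of "{y}"]
    by (simp add: A_def sets_restrict_space_iff)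
  have s_eq: "s n t = (\<Sum>y\<in>Y. indicat_real (A y) t *\<^sub>R y)" if "t \<in> {0<..<T}" for t
  proof -
    have "indicat_real (A y) t *\<^sub>R y = (if y = s n t then y else 0)" for y
      using that by (auto simp: A_def indicator_def)
    then show ?thesis
      using Y that by (simp add: Y_def)
  qed
  have "\<exists>N g. negligible N \<and> (\<forall>k::nat. continuous_on UNIV (g k)) \<and> (\<forall>x. x \<notin> N \<longrightarrow> (\<lambda>k. g k x) \<longlonglongrightarrow> indicat_real (A y) x)" for y
    using indicator_measurable_on[OF A[of y]] by (simp add: measurable_on_def)
  then have "\<forall>y. \<exists>N g. negligible N \<and> (\<forall>k::nat. continuous_on UNIV (g k)) \<and> (\<forall>x. x \<notin> N \<longrightarrow> (\<lambda>k. g k x) \<longlonglongrightarrow> indicat_real (A y) x)"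
    by blast
  from choice[OF this] obtain N where
    "\<forall>y. \<exists>g. negligible (N y) \<and> (\<forall>k::nat. continuous_on UNIV (g k)) \<and> (\<forall>x. x \<notin> N y \<longrightarrow> (\<lambda>k. g k x) \<longlonglongrightarrow> indicat_real (A y) x)" ..
  from choice[OF this] obtain g where N: "\<And>y. negligible (N y)" and g: "\<And>y k. continuous_on UNIV (g y (k::nat))"
    and g_lim: "\<And>y x. x \<notin> N y \<Longrightarrow> (\<lambda>k. g y k x) \<longlonglongrightarrow> indicat_real (A y) x"
    by blast
  \<comment> \<open>\<open>measurable_on\<close> supplies continuous functions that tend to the
    indicator off a negligible set. Clipping to [0,1] preserves the limit and gives a constant bound
    for dominated convergence.\<close>
  define c where "c k y t = max 0 (min 1 (g y k t))" for k y t
  have c_cont: "continuous_on UNIV (c k y)" for k y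
    unfolding c_def by (intro continuous_intros g)
  have c01: "0 \<le> c k y t" "c k y t \<le> 1" for k y t by (auto simp: c_def)
  have c_lim: "(\<lambda>k. c k y t) \<longlonglongrightarrow> indicat_real (A y) t" if "t \<notin> N y" for y t
  proof -
    have "(\<lambda>k. c k y t) \<longlonglongrightarrow> max 0 (min 1 (indicat_real (A y) t))"
      unfolding c_def by (intro tendsto_intros g_lim that)
    then show ?thesis by (simp add: indicator_def split: if_splits)
  qed
  have N_null: "AE t in time_measure T. t \<notin> N y" for y
  proof -
    have "AE t in lebesgue. t \<notin> N y"
      using N[of y] by (intro AE_not_in) (simp add: negligible_iff_null_sets)
    then show ?thesis
      by (subst AE_restrict_space_iff) (auto elim: eventually_mono)
  qed
  define p where "p k t = (\<Sum>y\<in>Y. c k y t *\<^sub>R y)" for k t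
  have p_L2: "p k \<in> L2_space T" for k
    unfolding p_def
    by (intro L2_space_sum L2_space_scaleR_bounded[where B=1] L2_space_const borel_imp_time_measurable
         borel_measurable_continuous_onI c_cont) (use c01 in auto)
  have sp: "(\<lambda>t. s n t - p k t) \<in> L2_space T" for k by (intro L2_space_diff s_L2 p_L2)
  define B where "B = (\<Sum>y\<in>Y. norm y)"
  have "(\<lambda>k. L2_sq T (\<lambda>t. s n t - p k t)) \<longlonglongrightarrow> (\<integral>t. 0 \<partial>time_measure T)"
  proof (rule integral_dominated_convergence[where w="\<lambda>t. B\<^sup>2"])
    have "AE t in time_measure T. \<forall>y\<in>Y. t \<notin> N y"
      using Y N_null by (simp add: AE_ball_countable countable_finite)
    then show "AE t in time_measure T. (\<lambda>k. (norm (s n t - p k t))\<^sup>2) \<longlonglongrightarrow> 0"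
      using AE_time_in
    proof eventually_elim
      case (elim t)
      have "(\<lambda>k. p k t) \<longlonglongrightarrow> s n t"
        unfolding p_def s_eq[OF elim(2)] using elim(1)
        by (intro tendsto_sum tendsto_scaleR c_lim tendsto_const) auto
      then show ?case by (auto intro!: tendsto_eq_intros)
    qed
    show "AE t in time_measure T. norm ((norm (s n t - p k t))\<^sup>2) \<le> B\<^sup>2" for k
      using AE_time_in
    proof eventually_elim
      case (elim t)
      have "s n t - p k t = (\<Sum>y\<in>Y. (indicat_real (A y) t - c k y t) *\<^sub>R y)"
        unfolding p_def s_eq[OF elim] by (simp add: sum_subtractf scaleR_diff_left)
      also have "norm \<dots> \<le> (\<Sum>y\<in>Y. norm ((indicat_real (A y) t - c k y t) *\<^sub>R y))"
        by (rule norm_sum)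
      also have "\<dots> \<le> B"
        unfolding B_def
      proof (intro sum_mono)
        fix y
        have "\<bar>indicat_real (A y) t - c k y t\<bar> \<le> 1"
          using c01[of k y t] by (auto simp: indicator_def)
        then show "norm ((indicat_real (A y) t - c k y t) *\<^sub>R y) \<le> norm y"
          by (simp add: mult_left_le_one_le)
      qed
      finally show ?case by (simp add: power_mono)
    qed
  qed (use L2_spaceD(2)[OF sp] in auto)
  then have "\<forall>\<^sub>F k in sequentially. L2_sq T (\<lambda>t. s n t - p k t) < e / 4"
    using e by (intro order_tendstoD) auto
  then obtain k where k: "L2_sq T (\<lambda>t. s n t - p k t) < e / 4"
    by (auto simp: eventually_sequentially)
  show ?thesis
  proof (rule that[OF Y])
    show "L2_sq T (\<lambda>t. u t - (\<Sum>y\<in>Y. c k y t *\<^sub>R y)) < e"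
      using L2_sq_diff_le[OF u s_L2[of n] p_L2[of k]] n k by (simp add: p_def)
  qed (use c_cont c01 in auto)
qed

section \<open>Approximate identities of finite rank\<close>

text \<open>The operators are \<open>g \<mapsto> \<Sum>\<^sub>i c n i (t) \<integral> \<kappa> n i (s) g (s) ds\<close>. Jensen's inequality and
  \<open>A n * D n \<le> C\<close> bound them on \<open>L\<^sup>2\<close> uniformly in \<open>n\<close>; \<open>local\<close> and \<open>mass\<close> give
  pointwise convergence for continuous \<open>g\<close>. The sum \<open>\<Sum>\<^sub>i c n i (t)\<close> may be smaller than \<open>1\<close>
  near the end points of \<open>(0,T)\<close>.\<close>

locale approx_kernel =
  fixes T :: real and m :: "nat \<Rightarrow> nat" and c \<kappa> :: "nat \<Rightarrow> nat \<Rightarrow> real \<Rightarrow> real"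
    and A D \<delta> :: "nat \<Rightarrow> real" and C :: real
  assumes T_pos: "0 < T"
    and c_meas: "\<And>n i. c n i \<in> borel_measurable (time_measure T)"
    and k_meas: "\<And>n i. \<kappa> n i \<in> borel_measurable (time_measure T)"
    and c_nonneg: "\<And>n i t. 0 \<le> c n i t"
    and k_nonneg: "\<And>n i t. 0 \<le> \<kappa> n i t"
    and c_sum: "\<And>n t. (\<Sum>i<m n. c n i t) \<le> 1"
    and k_int: "\<And>n i. i < m n \<Longrightarrow> (\<integral>s. \<kappa> n i s \<partial>time_measure T) \<le> 1"
    and c_int: "\<And>n i. i < m n \<Longrightarrow> (\<integral>t. c n i t \<partial>time_measure T) \<le> A n"
    and k_sum: "\<And>n s. (\<Sum>i<m n. \<kappa> n i s) \<le> D n"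
    and A_nonneg: "\<And>n. 0 \<le> A n"
    and AD: "\<And>n. A n * D n \<le> C"
    and local: "\<And>n i t s. i < m n \<Longrightarrow> t \<in> {0<..<T} \<Longrightarrow> c n i t \<noteq> 0 \<Longrightarrow> \<kappa> n i s \<noteq> 0 \<Longrightarrow> \<bar>s - t\<bar> \<le> \<delta> n"
    and \<delta>: "\<delta> \<longlonglongrightarrow> 0"
    and mass: "\<And>t. t \<in> {0<..<T} \<Longrightarrow>
      \<forall>\<^sub>F n in sequentially. (\<Sum>i<m n. c n i t * (\<integral>s. \<kappa> n i s \<partial>time_measure T)) = 1"
begin

lemma c_le_1: assumes "i < m n" shows "c n i t \<le> 1"
  using member_le_sum[of i "{..<m n}" "\<lambda>i. c n i t"] assms c_nonneg c_sum[of n t]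
  by fastforce

lemma k_le: assumes "i < m n" shows "\<kappa> n i t \<le> D n"
  using member_le_sum[of i "{..<m n}" "\<lambda>i. \<kappa> n i t"] assms k_nonneg k_sum[of n t]
  by fastforce

lemma k_abs_le: "i < m n \<Longrightarrow> \<bar>\<kappa> n i t\<bar> \<le> D n"
  using k_le k_nonneg by simp

lemma c_integrable: "i < m n \<Longrightarrow> integrable (time_measure T) (c n i)"
  by (rule time.integrable_const_bound[where B=1]) (use c_le_1 c_nonneg c_meas in auto)

lemma k_integrable: "i < m n \<Longrightarrow> integrable (time_measure T) (\<kappa> n i)"
  by (rule time.integrable_const_bound[where B="D n"]) (use k_le k_nonneg k_meas in auto)

lemma k_times_integrable:
  assumes "i < m n" "integrable (time_measure T) g"
  shows "integrable (time_measure T) (\<lambda>s. \<kappa> n i s * (g s :: real))"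
proof (rule Bochner_Integration.integrable_bound)
  show "integrable (time_measure T) (\<lambda>s. D n * g s)" using assms(2) by simp
  show "AE s in time_measure T. norm (\<kappa> n i s * g s) \<le> norm (D n * g s)"
    using order_trans[OF k_abs_le[OF assms(1)] abs_ge_self] by (auto simp: abs_mult intro!: mult_right_mono)
qed (use k_meas assms(2) in measurable)

lemma L2_approx:
  fixes I :: "nat \<Rightarrow> 'b::real_normed_vector"
  shows "(\<lambda>t. \<Sum>i<m n. c n i t *\<^sub>R I i) \<in> L2_space T"
proof (rule L2_space_sum)
  fix i assume i: "i \<in> {..<m n}"
  show "(\<lambda>t. c n i t *\<^sub>R I i) \<in> L2_space T"
  proof (rule L2_space_bounded)
    show "bochner_measurable (time_measure T) (\<lambda>t. c n i t *\<^sub>R I i)"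
      by (intro time.bochner_measurable_scaleR c_meas time.bochner_measurable_const)
    show "norm (c n i t *\<^sub>R I i) \<le> norm (I i)" for t
      using c_le_1[of i n t] c_nonneg[of n i t] i by (simp add: mult_left_le_one_le)
  qed
qed

text \<open>Convexity is used twice: Jensen in \<open>s\<close> with weight
  \<open>\<kappa> n i\<close>, then Cauchy-Schwarz in \<open>i\<close> after splitting each
  coefficient into two square roots. Integrating the coefficients in \<open>t\<close> costs
  \<open>A n\<close>, summing the weights over \<open>i\<close> costs \<open>D n\<close>.\<close>

lemma L2_sq_approx_le:
  fixes I :: "nat \<Rightarrow> 'b::real_normed_vector"
  assumes f: "f \<in> L2_space T"
    and I: "\<And>i. i < m n \<Longrightarrow> has_bochner_int (time_measure T) (\<lambda>s. \<kappa> n i s *\<^sub>R f s) (I i)"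
  shows "L2_sq T (\<lambda>t. \<Sum>i<m n. c n i t *\<^sub>R I i) \<le> C * L2_sq T f"
proof -
  have sq: "integrable (time_measure T) (\<lambda>s. (norm (f s))\<^sup>2)" by (rule L2_spaceD[OF f])
  have I2: "(norm (I i))\<^sup>2 \<le> (\<integral>s. \<kappa> n i s * (norm (f s))\<^sup>2 \<partial>time_measure T)" if i: "i < m n" for i
  proof -
    have int: "integrable (time_measure T) (\<lambda>s. \<kappa> n i s * norm (f s))"
      by (intro k_times_integrable i L2_integrable_norm f)
    then have "norm (I i) \<le> (\<integral>s. \<kappa> n i s * norm (f s) \<partial>time_measure T)"
      using time.has_bochner_int_norm_le[OF I[OF i]] by (simp add: k_nonneg)
    then have "(norm (I i))\<^sup>2 \<le> (\<integral>s. \<kappa> n i s * norm (f s) \<partial>time_measure T)\<^sup>2"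
      by (intro power_mono) auto
    also have "\<dots> \<le> (\<integral>s. \<kappa> n i s * (norm (f s))\<^sup>2 \<partial>time_measure T)"
      by (intro power2_weighted_integral_le k_integrable k_nonneg k_int int i k_times_integrable sq)
    finally show ?thesis .
  qed
  have pw: "(norm (\<Sum>i<m n. c n i t *\<^sub>R I i))\<^sup>2 \<le> (\<Sum>i<m n. c n i t * (norm (I i))\<^sup>2)" for t
  proof -
    let ?c = "\<lambda>i. sqrt (c n i t)"
    have sq_c: "?c i * ?c i = c n i t" for i using c_nonneg by simp
    have "norm (\<Sum>i<m n. c n i t *\<^sub>R I i) \<le> (\<Sum>i<m n. ?c i * (?c i * norm (I i)))"
      by (rule order_trans[OF norm_sum]) (simp add: c_nonneg mult.assoc[symmetric])
    then have "(norm (\<Sum>i<m n. c n i t *\<^sub>R I i))\<^sup>2 \<le> (\<Sum>i<m n. ?c i * (?c i * norm (I i)))\<^sup>2"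
      by (intro power_mono) auto
    also have "\<dots> \<le> (\<Sum>i<m n. (?c i)\<^sup>2) * (\<Sum>i<m n. (?c i * norm (I i))\<^sup>2)"
      by (rule Cauchy_Schwarz_ineq_sum)
    also have "\<dots> = (\<Sum>i<m n. c n i t) * (\<Sum>i<m n. c n i t * (norm (I i))\<^sup>2)"
      by (simp add: c_nonneg power_mult_distrib)
    also have "\<dots> \<le> 1 * (\<Sum>i<m n. c n i t * (norm (I i))\<^sup>2)"
      by (intro mult_right_mono c_sum sum_nonneg mult_nonneg_nonneg c_nonneg) auto
    finally show ?thesis by simp
  qed
  have ci: "integrable (time_measure T) (\<lambda>t. c n i t * x)" if "i < m n" for i x
    using c_integrable[OF that] by simp
  have "L2_sq T (\<lambda>t. \<Sum>i<m n. c n i t *\<^sub>R I i) \<le> (\<integral>t. (\<Sum>i<m n. c n i t * (norm (I i))\<^sup>2) \<partial>time_measure T)"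
    by (intro integral_mono pw L2_spaceD(2)[OF L2_approx] Bochner_Integration.integrable_sum ci) auto
  also have "\<dots> = (\<Sum>i<m n. (\<integral>t. c n i t \<partial>time_measure T) * (norm (I i))\<^sup>2)"
    using ci by (subst Bochner_Integration.integral_sum) (auto simp: c_integrable)
  also have "\<dots> \<le> (\<Sum>i<m n. A n * (\<integral>s. \<kappa> n i s * (norm (f s))\<^sup>2 \<partial>time_measure T))"
    by (intro sum_mono mult_mono c_int I2 A_nonneg) auto
  also have "\<dots> = A n * (\<integral>s. (\<Sum>i<m n. \<kappa> n i s * (norm (f s))\<^sup>2) \<partial>time_measure T)"
    by (subst Bochner_Integration.integral_sum) (auto intro: k_times_integrable sq simp: sum_distrib_left)
  also have "\<dots> \<le> A n * (\<integral>s. D n * (norm (f s))\<^sup>2 \<partial>time_measure T)"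
  proof (intro mult_left_mono A_nonneg integral_mono Bochner_Integration.integrable_sum k_times_integrable sq)
    show "(\<Sum>i<m n. \<kappa> n i s * (norm (f s))\<^sup>2) \<le> D n * (norm (f s))\<^sup>2" for s
      using mult_right_mono[OF k_sum[of n s], of "(norm (f s))\<^sup>2"] by (simp add: sum_distrib_right)
  qed (use sq in auto)
  also have "\<dots> = (A n * D n) * L2_sq T f" by simp
  also have "\<dots> \<le> C * L2_sq T f" by (intro mult_right_mono AD L2_sq_nonneg)
  finally show ?thesis .
qed

lemma scalar_integrable:
  assumes "continuous_on UNIV g" "\<And>s. 0 \<le> g s" "\<And>s. g s \<le> (1::real)"
  shows "integrable (time_measure T) g"
  by (rule time.integrable_const_bound[where B=1])
     (use assms in \<open>auto intro: borel_imp_time_measurable borel_measurable_continuous_onI\<close>)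

text \<open>Uniform bounds for the dominated convergence in \<open>approx_tendsto\<close>.\<close>

lemma scalar_bounds:
  assumes g: "continuous_on UNIV g" "\<And>s. 0 \<le> g s" "\<And>s. g s \<le> (1::real)"
  shows "0 \<le> (\<Sum>i<m n. c n i t * (\<integral>s. \<kappa> n i s * g s \<partial>time_measure T))"
    and "(\<Sum>i<m n. c n i t * (\<integral>s. \<kappa> n i s * g s \<partial>time_measure T)) \<le> 1"
proof -
  have nonneg: "0 \<le> (\<integral>s. \<kappa> n i s * g s \<partial>time_measure T)" for i
    by (intro integral_nonneg_AE AE_I2 mult_nonneg_nonneg k_nonneg g)
  show "0 \<le> (\<Sum>i<m n. c n i t * (\<integral>s. \<kappa> n i s * g s \<partial>time_measure T))"
    by (intro sum_nonneg mult_nonneg_nonneg c_nonneg nonneg)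
  have le: "(\<integral>s. \<kappa> n i s * g s \<partial>time_measure T) \<le> 1" if i: "i < m n" for i
  proof -
    have "(\<integral>s. \<kappa> n i s * g s \<partial>time_measure T) \<le> (\<integral>s. \<kappa> n i s \<partial>time_measure T)"
      by (intro integral_mono k_times_integrable k_integrable i scalar_integrable g mult_right_le_one_le k_nonneg)
    then show ?thesis using k_int[OF i] by simp
  qed
  have "(\<Sum>i<m n. c n i t * (\<integral>s. \<kappa> n i s * g s \<partial>time_measure T)) \<le> (\<Sum>i<m n. c n i t * 1)"
    by (intro sum_mono mult_left_mono le c_nonneg) auto
  then show "(\<Sum>i<m n. c n i t * (\<integral>s. \<kappa> n i s * g s \<partial>time_measure T)) \<le> 1"
    using c_sum[of n t] by simp
qed

lemma scalar_pointwise: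
  assumes g: "continuous_on UNIV g" "\<And>s. 0 \<le> g s" "\<And>s. g s \<le> (1::real)"
    and t: "t \<in> {0<..<T}"
  shows "(\<lambda>n. \<Sum>i<m n. c n i t * (\<integral>s. \<kappa> n i s * g s \<partial>time_measure T)) \<longlonglongrightarrow> g t"
proof (rule LIMSEQ_I)
  fix e :: real assume e: "0 < e"
  have "isCont g t" using g(1) by (simp add: continuous_on_eq_continuous_at)
  then obtain d where d: "d > 0" "\<And>s. \<bar>s - t\<bar> < d \<Longrightarrow> \<bar>g s - g t\<bar> < e / 2"
    using e unfolding continuous_at_eps_delta dist_real_def by (meson half_gt_zero)
  have "\<forall>\<^sub>F n in sequentially. \<delta> n < d" using \<delta> d(1) by (rule order_tendstoD)
  then have "\<forall>\<^sub>F n in sequentially. norm ((\<Sum>i<m n. c n i t * (\<integral>s. \<kappa> n i s * g s \<partial>time_measure T)) - g t) < e"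
    using mass[OF t]
  proof eventually_elim
    case (elim n)
    have int: "\<bar>(\<integral>s. \<kappa> n i s * g s \<partial>time_measure T) - g t * (\<integral>s. \<kappa> n i s \<partial>time_measure T)\<bar> \<le> e / 2"
      if i: "i < m n" "c n i t \<noteq> 0" for i
    proof -
      have "(\<integral>s. \<kappa> n i s * g s \<partial>time_measure T) - g t * (\<integral>s. \<kappa> n i s \<partial>time_measure T)
        = (\<integral>s. \<kappa> n i s * (g s - g t) \<partial>time_measure T)"
        using k_times_integrable[OF i(1) scalar_integrable[OF g]] k_integrable[OF i(1)]
        by (simp add: right_diff_distrib mult.commute)
      also have "\<bar>\<dots>\<bar> \<le> (\<integral>s. \<kappa> n i s * (e / 2) \<partial>time_measure T)"
        unfolding real_norm_def[symmetric]
      proof (rule Bochner_Integration.integral_norm_bound_integral)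
        show "integrable (time_measure T) (\<lambda>s. \<kappa> n i s * (g s - g t))"
          by (intro k_times_integrable i Bochner_Integration.integrable_diff scalar_integrable[OF g]) auto
        show "integrable (time_measure T) (\<lambda>s. \<kappa> n i s * (e / 2))"
          using k_integrable[OF i(1)] by simp
        fix s
        show "norm (\<kappa> n i s * (g s - g t)) \<le> \<kappa> n i s * (e / 2)"
        proof (cases "\<kappa> n i s = 0")
          case False
          then have "\<bar>s - t\<bar> < d" using local[OF i(1) t i(2) False] elim(1) by simp
          then show ?thesis
            using mult_left_mono[OF less_imp_le[OF d(2)[of s]] k_nonneg[of n i s]] k_nonneg[of n i s]
            by (simp add: abs_mult)
        qed simp
      qed
      also have "\<dots> = (\<integral>s. \<kappa> n i s \<partial>time_measure T) * (e / 2)" by simp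
      also have "\<dots> \<le> 1 * (e / 2)" using e by (intro mult_right_mono k_int i) auto
      finally show ?thesis by simp
    qed
    \<comment> \<open>Since the total mass is 1, \<open>g t\<close> can be written with the same
      coefficients as the approximation; only differences \<open>g s - g t\<close> with
      \<open>s\<close> near \<open>t\<close> remain.\<close>
    have "(\<Sum>i<m n. c n i t * (\<integral>s. \<kappa> n i s * g s \<partial>time_measure T)) - g t
      = (\<Sum>i<m n. c n i t * (\<integral>s. \<kappa> n i s * g s \<partial>time_measure T)) - g t * (\<Sum>i<m n. c n i t * (\<integral>s. \<kappa> n i s \<partial>time_measure T))"
      using elim(2) by simp
    also have "\<dots> = (\<Sum>i<m n. c n i t * ((\<integral>s. \<kappa> n i s * g s \<partial>time_measure T) - g t * (\<integral>s. \<kappa> n i s \<partial>time_measure T)))"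
      by (simp add: sum_distrib_left sum_subtractf right_diff_distrib algebra_simps)
    also have "norm \<dots> \<le> (\<Sum>i<m n. c n i t * (e / 2))"
    proof (rule order_trans[OF norm_sum], rule sum_mono)
      fix i assume i: "i \<in> {..<m n}"
      then show "norm (c n i t * ((\<integral>s. \<kappa> n i s * g s \<partial>time_measure T) - g t * (\<integral>s. \<kappa> n i s \<partial>time_measure T))) \<le> c n i t * (e / 2)"
        using int[of i] c_nonneg[of n i t] by (cases "c n i t = 0") (auto simp: abs_mult intro: mult_left_mono)
    qed
    also have "\<dots> \<le> 1 * (e / 2)"
      unfolding sum_distrib_right[symmetric] using e by (intro mult_right_mono c_sum) auto
    also have "\<dots> < e" using e by simp
    finally show ?case .
  qed
  then show "\<exists>no. \<forall>n\<ge>no. norm ((\<Sum>i<m n. c n i t * (\<integral>s. \<kappa> n i s * g s \<partial>time_measure T)) - g t) < e"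
    by (simp add: eventually_sequentially)
qed

text \<open>Uniform boundedness combined with convergence on a dense class. The integrals enter as
  given values \<open>I n i\<close>, not through an integral operator, so they can be supplied by
  the distributional identity even for values in V'.\<close>

theorem approx_tendsto:
  fixes I :: "nat \<Rightarrow> nat \<Rightarrow> 'b::real_normed_vector"
  assumes f: "f \<in> L2_space T"
    and I: "\<And>n i. i < m n \<Longrightarrow> has_bochner_int (time_measure T) (\<lambda>s. \<kappa> n i s *\<^sub>R f s) (I n i)"
  shows "(\<lambda>n. L2_sq T (\<lambda>t. (\<Sum>i<m n. c n i t *\<^sub>R I n i) - f t)) \<longlonglongrightarrow> 0"
proof (rule LIMSEQ_I)
  fix e :: real assume e: "0 < e"
  have C: "0 \<le> C"
  proof -
    have "0 \<le> D 0" using k_sum[of 0 0] sum_nonneg[of "{..<m 0}" "\<lambda>i. \<kappa> 0 i 0"] k_nonneg by fastforce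
    then show ?thesis using A_nonneg[of 0] AD[of 0] by (meson mult_nonneg_nonneg order_trans)
  qed
  \<comment> \<open>The final estimate carries the factor \<open>2 * C + 4\<close> in front of the
    distance from \<open>f\<close> to the continuous approximation; this choice makes that part
    \<open>e / 2\<close>, and \<open>4 * (e / 8)\<close> is the other half.\<close>
  define e' where "e' = e / (2 * (2 * C + 4))"
  have e': "0 < e'" using e C by (simp add: e'_def)
  obtain Y :: "'b set" and g :: "'b \<Rightarrow> real \<Rightarrow> real"
    where Y: "finite Y" and g: "\<And>y. continuous_on UNIV (g y)" "\<And>y t. 0 \<le> g y t" "\<And>y t. g y t \<le> 1"
    and close: "L2_sq T (\<lambda>t. f t - (\<Sum>y\<in>Y. g y t *\<^sub>R y)) < e'"
    by (rule L2_dense_continuous[OF f e'], rule that)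
  define p where "p t = (\<Sum>y\<in>Y. g y t *\<^sub>R y)" for t
  have p: "p \<in> L2_space T"
    unfolding p_def
    by (intro L2_space_sum L2_space_scaleR_bounded[where B=1] L2_space_const borel_imp_time_measurable
         borel_measurable_continuous_onI g) (use g in auto)
  define J where "J n i = (\<Sum>y\<in>Y. (\<integral>s. \<kappa> n i s * g y s \<partial>time_measure T) *\<^sub>R y)" for n i
  have J: "has_bochner_int (time_measure T) (\<lambda>s. \<kappa> n i s *\<^sub>R p s) (J n i)" if "i < m n" for n i
    using that unfolding J_def p_def scaleR_sum_right scaleR_scaleR
    by (intro time.has_bochner_int_sum Y time.has_bochner_int_scaleR_const k_times_integrable scalar_integrable g)
  define P where "P n t = (\<Sum>i<m n. c n i t *\<^sub>R I n i)" for n t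
  define R where "R n t = (\<Sum>i<m n. c n i t *\<^sub>R J n i)" for n t
  have P: "P n \<in> L2_space T" and R: "R n \<in> L2_space T" for n
    unfolding P_def R_def by (rule L2_approx)+
  \<comment> \<open>Exchanging the sums exposes the scalar operator applied to each coefficient
    \<open>g y\<close>.\<close>
  have R_eq: "R n t = (\<Sum>y\<in>Y. (\<Sum>i<m n. c n i t * (\<integral>s. \<kappa> n i s * g y s \<partial>time_measure T)) *\<^sub>R y)" for n t
    unfolding R_def J_def scaleR_sum_right scaleR_sum_left scaleR_scaleR by (rule sum.swap)
  have PR: "L2_sq T (\<lambda>t. P n t - R n t) \<le> C * L2_sq T (\<lambda>t. f t - p t)" for n
  proof -
    have eq: "P n t - R n t = (\<Sum>i<m n. c n i t *\<^sub>R (I n i - J n i))" for t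
      by (simp add: P_def R_def sum_subtractf scaleR_diff_right)
    have "has_bochner_int (time_measure T) (\<lambda>s. \<kappa> n i s *\<^sub>R (f s - p s)) (I n i - J n i)" if "i < m n" for i
      using time.has_bochner_int_diff[OF I[OF that] J[OF that]] by (simp add: scaleR_diff_right)
    then show ?thesis
      unfolding eq by (intro L2_sq_approx_le L2_space_diff f p)
  qed
  define B where "B = (\<Sum>y\<in>Y. norm y)"
  have Rp: "(\<lambda>t. R n t - p t) \<in> L2_space T" for n by (intro L2_space_diff R p)
  have "(\<lambda>n. L2_sq T (\<lambda>t. R n t - p t)) \<longlonglongrightarrow> (\<integral>t. 0 \<partial>time_measure T)"
  proof (rule integral_dominated_convergence[where w="\<lambda>t. B\<^sup>2"])
    show "AE t in time_measure T. (\<lambda>n. (norm (R n t - p t))\<^sup>2) \<longlonglongrightarrow> 0"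
      using AE_time_in
    proof eventually_elim
      case (elim t)
      have "(\<lambda>n. R n t) \<longlonglongrightarrow> p t"
        unfolding R_eq p_def
        by (intro tendsto_sum tendsto_scaleR tendsto_const scalar_pointwise g elim)
      then show ?case by (auto intro!: tendsto_eq_intros)
    qed
    have "norm (R n t - p t) \<le> B" for n t
    proof -
      have "R n t - p t = (\<Sum>y\<in>Y. ((\<Sum>i<m n. c n i t * (\<integral>s. \<kappa> n i s * g y s \<partial>time_measure T)) - g y t) *\<^sub>R y)"
        unfolding R_eq p_def by (simp add: sum_subtractf scaleR_diff_left)
      also have "norm \<dots> \<le> B"
        unfolding B_def
      proof (rule order_trans[OF norm_sum], rule sum_mono)
        fix y
        have "\<bar>(\<Sum>i<m n. c n i t * (\<integral>s. \<kappa> n i s * g y s \<partial>time_measure T)) - g y t\<bar> \<le> 1"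
          using scalar_bounds[OF g, of n t y] g(2,3)[of y t] by auto
        then show "norm (((\<Sum>i<m n. c n i t * (\<integral>s. \<kappa> n i s * g y s \<partial>time_measure T)) - g y t) *\<^sub>R y) \<le> norm y"
          by (simp add: mult_left_le_one_le)
      qed
      finally show ?thesis .
    qed
    then show "AE t in time_measure T. norm ((norm (R n t - p t))\<^sup>2) \<le> B\<^sup>2" for n
      by (simp add: power_mono)
  qed (use L2_spaceD(2)[OF Rp] in auto)
  then have "\<forall>\<^sub>F n in sequentially. L2_sq T (\<lambda>t. R n t - p t) < e / 8"
    using e by (intro order_tendstoD) auto
  then have "\<forall>\<^sub>F n in sequentially. norm (L2_sq T (\<lambda>t. P n t - f t) - 0) < e"
  proof eventually_elim
    case (elim n)
    have fp: "L2_sq T (\<lambda>t. p t - f t) = L2_sq T (\<lambda>t. f t - p t)"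
      by (simp add: norm_minus_commute)
    have "L2_sq T (\<lambda>t. P n t - f t) \<le> 2 * L2_sq T (\<lambda>t. P n t - R n t) + 2 * L2_sq T (\<lambda>t. R n t - f t)"
      by (rule L2_sq_diff_le[OF P R f])
    also have "\<dots> \<le> 2 * (C * L2_sq T (\<lambda>t. f t - p t)) + 2 * (2 * L2_sq T (\<lambda>t. R n t - p t) + 2 * L2_sq T (\<lambda>t. f t - p t))"
      using PR[of n] L2_sq_diff_le[OF R[of n] p f] fp by (intro add_mono) auto
    also have "\<dots> = (2 * C + 4) * L2_sq T (\<lambda>t. f t - p t) + 4 * L2_sq T (\<lambda>t. R n t - p t)"
      by (simp add: algebra_simps)
    also have "\<dots> < (2 * C + 4) * e' + 4 * (e / 8)"
      using close elim C by (intro add_strict_mono mult_strict_left_mono) (auto simp: p_def)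
    also have "\<dots> = e" using C by (simp add: e'_def field_simps)
    finally show ?case using L2_sq_nonneg[of T "\<lambda>t. P n t - f t"] by simp
  qed
  then show "\<exists>no. \<forall>n\<ge>no. norm (L2_sq T (\<lambda>t. (\<Sum>i<m n. c n i t *\<^sub>R I n i) - f t) - 0) < e"
    by (simp add: eventually_sequentially P_def)
qed

end

section \<open>A smooth bump function\<close>

text \<open>The smoothness clause of \<open>test_function\<close>, isolated from the support
  condition.\<close>

definition smooth_real :: "(real \<Rightarrow> real) \<Rightarrow> bool" where
  "smooth_real f \<longleftrightarrow> (\<forall>k x. ((deriv ^^ k) f) differentiable (at x))"

text \<open>A family closed under differentiation consists of smooth functions; no explicit formula
  for higher derivatives has to be found.\<close>

lemma smooth_real_coinduct:
  assumes "P f" and step: "\<And>g. P g \<Longrightarrow> \<exists>g'. (\<forall>x. (g has_real_derivative g' x) (at x)) \<and> P g'"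
  shows "smooth_real f"
proof -
  have "P ((deriv ^^ k) f)" for k
  proof (induction k)
    case (Suc k)
    then obtain g' where g': "\<And>x. ((deriv ^^ k) f has_real_derivative g' x) (at x)" "P g'"
      using step by blast
    then have "deriv ((deriv ^^ k) f) = g'" by (intro ext DERIV_imp_deriv)
    then show ?case using g' by simp
  qed (use assms in simp)
  then show ?thesis
    unfolding smooth_real_def by (meson real_differentiable_def step)
qed

lemma smooth_real_DERIV:
  assumes "smooth_real f"
  shows "(f has_real_derivative deriv f x) (at x)" "smooth_real (deriv f)"
proof -
  show "(f has_real_derivative deriv f x) (at x)"
    using assms[unfolded smooth_real_def, rule_format, of 0] by (simp add: DERIV_deriv_iff_real_differentiable)
  show "smooth_real (deriv f)"
    using assms unfolding smooth_real_def by (metis funpow_Suc_right o_apply)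
qed

lemma smooth_real_antideriv:
  assumes "\<And>x. (F has_real_derivative f x) (at x)" "smooth_real f"
  shows "smooth_real F"
  unfolding smooth_real_def
proof (intro allI)
  fix k x
  have "deriv F = f" using assms(1) by (intro ext DERIV_imp_deriv)
  then show "(deriv ^^ k) F differentiable (at x)"
    using assms unfolding smooth_real_def
    by (cases k) (auto simp: real_differentiable_def funpow_swap1[symmetric] funpow_Suc_right simp del: funpow.simps)
qed

lemma smooth_real_combination:
  assumes "smooth_real f" "smooth_real g"
  shows "smooth_real (\<lambda>x. p * f (a * x + b) + q * g (c * x + d))"
\<comment> \<open>The factors \<open>p\<close> and \<open>q\<close> belong to the invariant, because
  each differentiation multiplies them by \<open>a\<close> and \<open>c\<close>.\<close>
proof (rule smooth_real_coinduct[where P="\<lambda>h. \<exists>f g p q. smooth_real f \<and> smooth_real g \<and> h = (\<lambda>x. p * f (a * x + b) + q * g (c * x + d))"])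
  fix h assume "\<exists>f g p q. smooth_real f \<and> smooth_real g \<and> h = (\<lambda>x. p * f (a * x + b) + q * g (c * x + d))"
  then obtain f g p q where fg: "smooth_real f" "smooth_real g" and h: "h = (\<lambda>x. p * f (a * x + b) + q * g (c * x + d))"
    by blast
  let ?h' = "\<lambda>x. (p * a) * deriv f (a * x + b) + (q * c) * deriv g (c * x + d)"
  have "(h has_real_derivative ?h' x) (at x)" for x
    unfolding h by (auto intro!: derivative_eq_intros DERIV_chain2[OF smooth_real_DERIV(1)[OF fg(1)]] DERIV_chain2[OF smooth_real_DERIV(1)[OF fg(2)]])
  then show "\<exists>h'. (\<forall>x. (h has_real_derivative h' x) (at x)) \<and>
      (\<exists>f g p q. smooth_real f \<and> smooth_real g \<and> h' = (\<lambda>x. p * f (a * x + b) + q * g (c * x + d)))"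
    using smooth_real_DERIV(2)[OF fg(1)] smooth_real_DERIV(2)[OF fg(2)]
    by (intro exI[of _ ?h'] conjI exI[of _ "deriv f"] exI[of _ "deriv g"] exI[of _ "p * a"] exI[of _ "q * c"]) auto
qed (use assms in blast)

text \<open>The functions \<open>p(x) Q\<^sup>-\<^sup>m exp(-1/Q)\<close> on \<open>(0,1)\<close> with \<open>p\<close> a polynomial and
  \<open>Q = x (1 - x)\<close> form a family that is closed under differentiation; hence all of them
  are smooth.\<close>

definition poly_bump :: "real poly \<Rightarrow> nat \<Rightarrow> real \<Rightarrow> real" where
  "poly_bump p m x = (if 0 < x \<and> x < 1
     then poly p x * inverse (x * (1 - x)) ^ m * exp (- inverse (x * (1 - x))) else 0)"

lemma poly_bump_outside: "\<not> (0 < x \<and> x < 1) \<Longrightarrow> poly_bump p m x = 0"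
  by (auto simp: poly_bump_def)

text \<open>A single term of the exponential series is at most its sum.\<close>

lemma power_exp_minus_le:
  fixes y :: real
  assumes "0 \<le> y"
  shows "y ^ k * exp (- y) \<le> fact k"
proof -
  have "y ^ k /\<^sub>R fact k \<le> exp y"
    using sum_le_suminf[OF summable_exp_generic[of y], of "{k}"] assms
    by (simp add: exp_def)
  then have "y ^ k \<le> fact k * exp y" by (simp add: field_simps)
  then have "y ^ k * exp (- y) \<le> fact k * exp y * exp (- y)" by (intro mult_right_mono) auto
  then show ?thesis by (simp add: mult.assoc flip: exp_add)
qed

text \<open>Quadratic decay at every point \<open>y\<close> outside (0,1), which forces derivative 0
  there. With \<open>Q = x * (1 - x)\<close>, two additional powers of \<open>inverse Q\<close> are
  absorbed by the exponential, leaving \<open>Q^2\<close>, and \<open>Q\<close> is at most the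
  distance from \<open>x\<close> to the complement of (0,1).\<close>

lemma poly_bump_bound:
  obtains B where "0 \<le> B" "\<And>x y. \<not> (0 < y \<and> y < 1) \<Longrightarrow> \<bar>poly_bump p m x\<bar> \<le> B * (x - y)\<^sup>2"
proof -
  have "compact (poly p ` {0..1})"
    by (intro compact_continuous_image continuous_intros) auto
  then obtain K where K: "\<And>x. x \<in> {0..1} \<Longrightarrow> \<bar>poly p x\<bar> \<le> K"
    using compact_imp_bounded bounded_iff by (metis image_eqI real_norm_def)
  have K0: "0 \<le> K" using K[of 0] by (auto intro: order_trans[OF abs_ge_zero])
  show ?thesis
  proof (rule that[of "K * fact (m + 2)"])
    fix x y :: real assume y: "\<not> (0 < y \<and> y < 1)"
    show "\<bar>poly_bump p m x\<bar> \<le> K * fact (m + 2) * (x - y)\<^sup>2"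
    proof (cases "0 < x \<and> x < 1")
      case True
      define Q where "Q = x * (1 - x)"
      have Q: "0 < Q" using True by (simp add: Q_def)
      have "Q \<le> \<bar>x - y\<bar>"
      proof (cases "y \<le> 0")
        case True
        have "Q \<le> x * 1" unfolding Q_def using \<open>0 < x \<and> x < 1\<close> by (intro mult_left_mono) auto
        then show ?thesis using True by simp
      next
        case False
        have "Q \<le> 1 * (1 - x)" unfolding Q_def using \<open>0 < x \<and> x < 1\<close> by (intro mult_right_mono) auto
        then show ?thesis using False y by simp
      qed
      then have Qy: "Q\<^sup>2 \<le> (x - y)\<^sup>2" using Q by (metis abs_of_pos power2_abs power_mono less_imp_le)
      have "inverse Q ^ m * exp (- inverse Q) = (inverse Q ^ (m + 2) * exp (- inverse Q)) * Q\<^sup>2"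
        using Q by (simp add: power_add power2_eq_square field_simps)
      also have "\<dots> \<le> fact (m + 2) * Q\<^sup>2"
        using Q by (intro mult_right_mono power_exp_minus_le) auto
      also have "\<dots> \<le> fact (m + 2) * (x - y)\<^sup>2" by (intro mult_left_mono Qy) auto
      finally have le: "inverse Q ^ m * exp (- inverse Q) \<le> fact (m + 2) * (x - y)\<^sup>2" .
      have "\<bar>poly p x\<bar> * (inverse Q ^ m * exp (- inverse Q)) \<le> K * (fact (m + 2) * (x - y)\<^sup>2)"
        by (rule mult_mono[OF K le K0]) (use True Q in auto)
      then show ?thesis
        using True Q by (simp add: poly_bump_def Q_def[symmetric] abs_mult mult.assoc)
    next
      case False
      then show ?thesis using K0 poly_bump_outside[OF False] by simp
    qed
  qed (use K0 in simp)
qed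

text \<open>Inside (0,1) the three terms of the product rule are brought to the common denominator
  \<open>q^(m + 2)\<close>; elsewhere the difference quotient is squeezed by the quadratic
  bound.\<close>

lemma poly_bump_DERIV:
  defines "q \<equiv> [:0, 1, -1:]"
  shows "(poly_bump p m has_real_derivative
    poly_bump (pderiv p * q\<^sup>2 - smult (real m) (p * pderiv q * q) + p * pderiv q) (m + 2) x) (at x)"
proof (cases "0 < x \<and> x < 1")
  case True
  have q: "poly q y = y * (1 - y)" "poly (pderiv q) y = 1 - 2 * y" for y
    by (simp_all add: q_def pderiv_pCons algebra_simps)
  define Q where "Q = x * (1 - x)"
  have Q: "Q \<noteq> 0" using True by (simp add: Q_def)
  let ?f = "\<lambda>y. poly p y * inverse (y * (1 - y)) ^ m * exp (- inverse (y * (1 - y)))"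
  have inv: "((\<lambda>y. inverse (y * (1 - y))) has_real_derivative (- ((1 - 2 * x) * inverse Q ^ 2))) (at x)"
  proof -
    have "((\<lambda>y. y * (1 - y)) has_real_derivative 1 - 2 * x) (at x)"
      by (auto intro!: derivative_eq_intros)
    from DERIV_inverse_fun[OF this] show ?thesis
      using Q by (simp add: Q_def power2_eq_square mult_ac)
  qed
  \<comment> \<open>For \<open>m = 0\<close> the exponent \<open>m - 1\<close> is truncated, but
    then both sides vanish with the factor \<open>real m\<close>.\<close>
  have pow: "real m * inverse Q ^ (m - 1) * inverse Q ^ 2 = real m * inverse Q ^ (m + 1)"
    by (cases m) (simp_all add: power2_eq_square)
  have "(?f has_real_derivative
     (poly (pderiv p) x * inverse Q ^ m + poly p x * (real m * inverse Q ^ (m - 1) * - ((1 - 2 * x) * inverse Q ^ 2))) * exp (- inverse Q)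
       + poly p x * inverse Q ^ m * (exp (- inverse Q) * ((1 - 2 * x) * inverse Q ^ 2))) (at x)"
    unfolding Q_def
    by (rule derivative_eq_intros DERIV_power[OF inv] DERIV_fun_exp DERIV_minus inv poly_DERIV refl | simp add: Q_def)+
  also have "poly p x * (real m * inverse Q ^ (m - 1) * - ((1 - 2 * x) * inverse Q ^ 2))
    = - (poly p x * (1 - 2 * x) * (real m * inverse Q ^ (m - 1) * inverse Q ^ 2))"
    by (simp add: algebra_simps)
  also have "(poly (pderiv p) x * inverse Q ^ m + - (poly p x * (1 - 2 * x) * (real m * inverse Q ^ (m - 1) * inverse Q ^ 2))) * exp (- inverse Q)
       + poly p x * inverse Q ^ m * (exp (- inverse Q) * ((1 - 2 * x) * inverse Q ^ 2))
    = (poly (pderiv p) x * Q\<^sup>2 - real m * (poly p x * (1 - 2 * x) * Q) + poly p x * (1 - 2 * x)) * inverse Q ^ (m + 2) * exp (- inverse Q)"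
    unfolding pow using Q by (simp add: power_add power2_eq_square field_simps)
  also have "\<dots> = poly_bump (pderiv p * q\<^sup>2 - smult (real m) (p * pderiv q * q) + p * pderiv q) (m + 2) x"
    using True by (simp add: poly_bump_def q Q_def)
  finally have d: "(?f has_real_derivative poly_bump (pderiv p * q\<^sup>2 - smult (real m) (p * pderiv q * q) + p * pderiv q) (m + 2) x) (at x)" .
  show ?thesis
  proof (rule has_field_derivative_transform_within_open[OF d])
    show "open {0<..<1::real}" "x \<in> {0<..<1}" using True by auto
    show "?f y = poly_bump p m y" if "y \<in> {0<..<1}" for y using that by (simp add: poly_bump_def)
  qed
next
  case False
  obtain B where B: "0 \<le> B" "\<And>z y. \<not> (0 < y \<and> y < 1) \<Longrightarrow> \<bar>poly_bump p m z\<bar> \<le> B * (z - y)\<^sup>2"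
    by (rule poly_bump_bound[of p m], rule that)
  have zero: "poly_bump p m x = 0" by (rule poly_bump_outside[OF False])
  have "((\<lambda>z. (poly_bump p m z - poly_bump p m x) / (z - x)) \<longlongrightarrow> 0) (at x)"
  proof (rule Lim_null_comparison)
    show "\<forall>\<^sub>F z in at x. norm ((poly_bump p m z - poly_bump p m x) / (z - x)) \<le> B * \<bar>z - x\<bar>"
    proof (rule always_eventually, rule allI)
      fix z
      have "\<bar>poly_bump p m z\<bar> / \<bar>z - x\<bar> \<le> B * (z - x)\<^sup>2 / \<bar>z - x\<bar>"
        using B(2)[OF False, of z] by (intro divide_right_mono) auto
      also have "\<dots> = B * \<bar>z - x\<bar>" by (cases "z = x") (auto simp: power2_eq_square field_simps abs_if)
      finally show "norm ((poly_bump p m z - poly_bump p m x) / (z - x)) \<le> B * \<bar>z - x\<bar>"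
        using zero by simp
    qed
    have "((\<lambda>z. B * \<bar>z - x\<bar>) \<longlongrightarrow> B * \<bar>x - x\<bar>) (at x)"
      by (intro tendsto_intros)
    then show "((\<lambda>z. B * \<bar>z - x\<bar>) \<longlongrightarrow> 0) (at x)" by simp
  qed
  then show ?thesis
    by (simp only: has_field_derivative_iff poly_bump_outside[OF False])
qed

lemma smooth_real_poly_bump: "smooth_real (poly_bump p m)"
proof (rule smooth_real_coinduct[where P="\<lambda>f. \<exists>p m. f = poly_bump p m"])
  fix g assume "\<exists>p m. g = poly_bump p m"
  then obtain p m where "g = poly_bump p m" by blast
  then show "\<exists>g'. (\<forall>x. (g has_real_derivative g' x) (at x)) \<and> (\<exists>p m. g' = poly_bump p m)"
    using poly_bump_DERIV[of p m] by blast
qed blast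

text \<open>For \<open>x < 0\<close> the set \<open>{0..x}\<close> is empty and the integral is 0.
  As \<open>f\<close> vanishes to the left of \<open>a > 0\<close>, this is the correct
  antiderivative there too, so the formula holds on the whole line.\<close>

lemma antideriv_from_zero:
  fixes f :: "real \<Rightarrow> real"
  assumes cont: "continuous_on UNIV f" and zero: "\<And>x. x < a \<Longrightarrow> f x = 0" and a: "0 < a"
  defines "F \<equiv> \<lambda>x. integral {0..x} f"
  shows "(F has_real_derivative f x) (at x)" "x \<le> a \<Longrightarrow> F x = 0"
proof -
  have F0: "F x = 0" if "x \<le> a" for x
  proof -
    have "(f has_integral 0) {0..x}"
      by (rule has_integral_spike_finite[of "{a}" _ _ "\<lambda>_. 0"]) (use that zero in auto)
    then show ?thesis by (simp add: F_def integral_unique)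
  qed
  then show "x \<le> a \<Longrightarrow> F x = 0" .
  show "(F has_real_derivative f x) (at x)"
  proof (cases "x < a")
    case True
    have "((\<lambda>_. 0) has_real_derivative f x) (at x)" using zero[OF True] by simp
    then show ?thesis
      by (rule has_field_derivative_transform_within_open[where S="{..<a}"]) (use True F0 in auto)
  next
    case False
    have "(F has_real_derivative f x) (at x within {0..x + 1})"
      unfolding F_def
      by (rule integral_has_real_derivative) (use cont False a in \<open>auto intro: continuous_on_subset\<close>)
    moreover have "at x within {0..x + 1} = at x"
      by (rule at_within_interior) (use False a in auto)
    ultimately show ?thesis by simp
  qed
qed

lemma DERIV_nonneg_mono:
  fixes F f :: "real \<Rightarrow> real"
  assumes "\<And>x. (F has_real_derivative f x) (at x)" "\<And>x. 0 \<le> f x" "x \<le> y"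
  shows "F x \<le> F y"
  using assms by (meson DERIV_nonneg_imp_nondecreasing)

lemma DERIV_zero_const_on:
  fixes F f :: "real \<Rightarrow> real"
  assumes "\<And>x. (F has_real_derivative f x) (at x)" "\<And>z. x < z \<Longrightarrow> z < y \<Longrightarrow> f z = 0" "x \<le> y"
  shows "F x = F y"
proof (cases "x = y")
  case False
  then show ?thesis
    using MVT2[of x y F f] assms by force
qed simp

text \<open>\<open>\<psi>\<close> is a smooth step \<open>B\<close> rising from 0 to 1, minus its
  shift by 1; this explains its derivative, bounds and support. The margins of 1/4 keep the scaled
  supports inside the open interval, as test functions require.\<close>

lemma smooth_bump_exists:
  obtains \<beta> \<psi> :: "real \<Rightarrow> real" and K :: real where
    "continuous_on UNIV \<beta>" "\<And>x. 0 \<le> \<beta> x" "\<And>x. \<beta> x \<le> K" "\<And>x. \<beta> x \<noteq> 0 \<Longrightarrow> 1/4 \<le> x \<and> x \<le> 3/4"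
    "(\<beta> has_integral 1) {0..1}"
    "smooth_real \<psi>" "\<And>x. (\<psi> has_real_derivative \<beta> x - \<beta> (x - 1)) (at x)"
    "\<And>x. 0 \<le> \<psi> x" "\<And>x. \<psi> x \<le> 1" "\<And>x. \<psi> x \<noteq> 0 \<Longrightarrow> 1/4 \<le> x \<and> x \<le> 7/4"
    "(\<psi> has_integral 1) {0..2}"
proof -
  \<comment> \<open>The function \<open>exp (- inverse (y * (1 - y)))\<close>, with the affine
    argument mapping [1/4,3/4] onto [0,1].\<close>
  define \<beta>0 where "\<beta>0 x = poly_bump [:1:] 0 (2 * x - 1/2)" for x
  have sm0: "smooth_real \<beta>0"
    using smooth_real_combination[OF smooth_real_poly_bump[of "[:1:]" 0] smooth_real_poly_bump[of "[:1:]" 0], of 1 2 "-1/2" 0]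
    by (simp add: \<beta>0_def[abs_def])
  have cont0: "continuous_on UNIV \<beta>0"
    using smooth_real_DERIV(1)[OF sm0] by (meson DERIV_continuous_on has_field_derivative_at_within)
  have zero0: "\<beta>0 x = 0" if "x < 1/4 \<or> x > 3/4" for x using that by (auto simp: \<beta>0_def poly_bump_def)
  have nonneg0: "0 \<le> \<beta>0 x" for x by (simp add: \<beta>0_def poly_bump_def)
  have pos0: "0 < \<beta>0 x" if "1/4 < x" "x < 3/4" for x using that by (simp add: \<beta>0_def poly_bump_def)
  define B0 where "B0 x = integral {0..x} \<beta>0" for x
  have B0: "(B0 has_real_derivative \<beta>0 x) (at x)" "x \<le> 1/4 \<Longrightarrow> B0 x = 0" for x
    using antideriv_from_zero[OF cont0, of "1/4" x] zero0 by (auto simp: B0_def[abs_def])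
  define k where "k = B0 (3/4)"
  have "0 < k"
  proof -
    obtain z where "1/4 < z" "z < 3/4" "B0 (3/4) - B0 (1/4) = (3/4 - 1/4) * \<beta>0 z"
      using MVT2[of "1/4" "3/4" B0 \<beta>0] B0(1) by auto
    then show ?thesis using pos0[of z] B0(2)[of "1/4"] by (simp add: k_def)
  qed
  have B0k: "B0 x = k" if "3/4 \<le> x" for x
    unfolding k_def by (rule DERIV_zero_const_on[OF B0(1), symmetric]) (use that zero0 in auto)
  define \<beta> where "\<beta> x = \<beta>0 x / k" for x
  define B where "B x = B0 x / k" for x
  have cont: "continuous_on UNIV \<beta>" unfolding \<beta>_def using cont0 \<open>0 < k\<close> by (intro continuous_intros) auto
  have sm: "smooth_real \<beta>"
    using smooth_real_combination[OF sm0 sm0, of "1/k" 1 0 0] by (simp add: \<beta>_def[abs_def])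
  have nonneg: "0 \<le> \<beta> x" for x using nonneg0 \<open>0 < k\<close> by (simp add: \<beta>_def)
  have zero: "\<beta> x = 0" if "x < 1/4 \<or> x > 3/4" for x using zero0[OF that] by (simp add: \<beta>_def)
  have B: "(B has_real_derivative \<beta> x) (at x)" for x
    unfolding B_def[abs_def] \<beta>_def using B0(1) \<open>0 < k\<close> by (auto intro!: derivative_eq_intros)
  have B_0: "B x = 0" if "x \<le> 1/4" for x using B0(2)[OF that] by (simp add: B_def)
  have B_1: "B x = 1" if "3/4 \<le> x" for x using B0k[OF that] \<open>0 < k\<close> by (simp add: B_def)
  have B_mono: "B x \<le> B y" if "x \<le> y" for x y by (rule DERIV_nonneg_mono[OF B nonneg that])
  have B01: "0 \<le> B x" "B x \<le> 1" for x
    using B_mono[of "min x 0" x] B_0[of "min x 0"] B_mono[of x "max x 1"] B_1[of "max x 1"] by auto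
  have contB: "continuous_on UNIV B" using B by (meson DERIV_continuous_on has_field_derivative_at_within)
  define G where "G x = integral {0..x} B" for x
  have G: "(G has_real_derivative B x) (at x)" "x \<le> 1/4 \<Longrightarrow> G x = 0" for x
    using antideriv_from_zero[OF contB, of "1/4" x] B_0 by (auto simp: G_def[abs_def])
  define \<psi> where "\<psi> x = B x - B (x - 1)" for x
  have \<psi>': "(\<psi> has_real_derivative \<beta> x - \<beta> (x - 1)) (at x)" for x
    unfolding \<psi>_def[abs_def] by (auto intro!: derivative_eq_intros B DERIV_chain2[OF B])
  have sm\<psi>: "smooth_real \<psi>"
  proof (rule smooth_real_antideriv[OF \<psi>'])
    show "smooth_real (\<lambda>x. \<beta> x - \<beta> (x - 1))"
      using smooth_real_combination[OF sm sm, of 1 1 0 "-1" 1 "-1"] by simp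
  qed
  have int\<beta>: "(\<beta> has_integral 1) {0..1}"
  proof -
    have "(\<beta> has_integral (B 1 - B 0)) {0..1}"
      by (rule fundamental_theorem_of_calculus)
         (use B in \<open>auto simp: has_real_derivative_iff_has_vector_derivative[symmetric] intro: has_field_derivative_at_within\<close>)
    then show ?thesis using B_0[of 0] B_1[of 1] by simp
  qed
  \<comment> \<open>With \<open>G\<close> an antiderivative of \<open>B\<close>, the integral is
    \<open>G 2 - G 1\<close>, because \<open>G\<close> vanishes at 0 and -1; it equals 1 as
    \<open>B\<close> is 1 on (1,2).\<close>
  have int\<psi>: "(\<psi> has_integral 1) {0..2}"
  proof -
    have "((\<lambda>x. G x - G (x - 1)) has_real_derivative \<psi> x) (at x)" for x
      unfolding \<psi>_def by (auto intro!: derivative_eq_intros G(1) DERIV_chain2[OF G(1)])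
    then have "(\<psi> has_integral ((G 2 - G (2 - 1)) - (G 0 - G (0 - 1)))) {0..2}"
      by (intro fundamental_theorem_of_calculus)
         (auto simp: has_real_derivative_iff_has_vector_derivative[symmetric] intro: has_field_derivative_at_within)
    moreover obtain z where "1 < z" "z < 2" "G 2 - G 1 = (2 - 1) * B z"
      using MVT2[of 1 2 G B] G(1) by auto
    ultimately show ?thesis using B_1[of z] G(2)[of 0] G(2)[of "-1"] by simp
  qed
  have "compact (\<beta> ` {0..1})"
    by (intro compact_continuous_image continuous_on_subset[OF cont]) auto
  then obtain K where K: "\<And>x. x \<in> {0..1} \<Longrightarrow> \<bar>\<beta> x\<bar> \<le> K"
    using compact_imp_bounded bounded_iff by (metis image_eqI real_norm_def)
  show ?thesis
  proof (rule that[of \<beta> K \<psi>])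
    show "\<beta> x \<le> K" for x
      using K[of x] K[of 0] nonneg[of 0] zero[of x] by (cases "x \<in> {0..1}") auto
    show "1/4 \<le> x \<and> x \<le> 3/4" if "\<beta> x \<noteq> 0" for x using zero[of x] that by force
    show "0 \<le> \<psi> x" for x using B_mono[of "x - 1" x] by (simp add: \<psi>_def)
    show "\<psi> x \<le> 1" for x using B01(2)[of x] B01(1)[of "x - 1"] by (simp add: \<psi>_def)
    show "1/4 \<le> x \<and> x \<le> 7/4" if "\<psi> x \<noteq> 0" for x
      using that B_0[of x] B_0[of "x - 1"] B_1[of x] B_1[of "x - 1"] by (force simp: \<psi>_def)
  qed (use cont nonneg int\<beta> sm\<psi> \<psi>' int\<psi> in auto)
qed

section \<open>Test functions and distributional derivatives\<close>

lemma bounded_linear_dual_embed: "bounded_linear (dual_embed j)"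
proof -
  have "dual_embed j = (\<lambda>x. blinfun_inner_right (blinfun_apply j x) o\<^sub>L j)"
    by (rule ext) (simp add: dual_embed_def)
  moreover have "bounded_linear (\<lambda>x. blinfun_inner_right (blinfun_apply j x) o\<^sub>L j)"
    by (intro bounded_linear_intros bounded_linear_compose[OF bounded_linear_blinfun_inner_right])
  ultimately show ?thesis by simp
qed

lemma test_function_DERIV:
  assumes "test_function T \<phi>"
  shows "(\<phi> has_real_derivative deriv \<phi> x) (at x)" "isCont (deriv \<phi>) x"
proof -
  have "((deriv ^^ k) \<phi>) differentiable (at x)" for k
    using assms by (simp add: test_function_def)
  from this[of 0] this[of 1]
  show "(\<phi> has_real_derivative deriv \<phi> x) (at x)" "isCont (deriv \<phi>) x"
    by (simp_all add: DERIV_deriv_iff_real_differentiable differentiable_imp_continuous_within)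
qed

text \<open>The complement of the closed support is open and contains every point outside (0,T), so
  \<open>\<phi>\<close> vanishes in a neighbourhood of such a point.\<close>

lemma test_function_zero:
  assumes "test_function T \<phi>" "x \<notin> {0<..<T}"
  shows "\<phi> x = 0" "deriv \<phi> x = 0"
proof -
  let ?S = "closure {x. \<phi> x \<noteq> 0}"
  have x: "x \<in> - ?S" using assms by (auto simp: test_function_def)
  have z: "\<phi> y = 0" if "y \<in> - ?S" for y using that closure_subset[of "{x. \<phi> x \<noteq> 0}"] by auto
  show "\<phi> x = 0" by (rule z[OF x])
  have "(\<phi> has_real_derivative 0) (at x)"
  proof (rule has_field_derivative_transform_within_open[OF _ _ x])
    show "((\<lambda>_. 0) has_real_derivative 0) (at x)" by simp
    show "0 = \<phi> y" if "y \<in> - ?S" for y using z[OF that] by simp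
  qed auto
  then show "deriv \<phi> x = 0" by (rule DERIV_imp_deriv)
qed

lemma test_function_continuous:
  assumes "test_function T \<phi>"
  shows "continuous_on UNIV \<phi>" "continuous_on UNIV (deriv \<phi>)"
  using DERIV_isCont[OF test_function_DERIV(1)[OF assms]] test_function_DERIV(2)[OF assms]
  by (auto simp: continuous_on_eq_continuous_at)

lemma test_function_measurable:
  assumes "test_function T \<phi>"
  shows "\<phi> \<in> borel_measurable (time_measure T)" "deriv \<phi> \<in> borel_measurable (time_measure T)"
  using test_function_continuous[OF assms] by (auto intro: borel_imp_time_measurable borel_measurable_continuous_onI)

lemma continuous_zero_outside_bounded:
  fixes f :: "real \<Rightarrow> real"
  assumes "continuous_on UNIV f" "\<And>x. x \<notin> {0<..<T} \<Longrightarrow> f x = 0"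
  obtains B where "\<And>x. \<bar>f x\<bar> \<le> B"
proof -
  have "compact (f ` {0..T})"
    by (intro compact_continuous_image continuous_on_subset[OF assms(1)]) auto
  then obtain K where K: "\<And>x. x \<in> {0..T} \<Longrightarrow> \<bar>f x\<bar> \<le> K"
    using compact_imp_bounded bounded_iff by (metis image_eqI real_norm_def)
  have "\<bar>f x\<bar> \<le> max K 0" for x
    using K[of x] assms(2)[of x] by (cases "x \<in> {0<..<T}") auto
  then show ?thesis by (rule that)
qed

lemma test_function_bounded:
  assumes "test_function T \<phi>"
  obtains B where "\<And>x. \<bar>\<phi> x\<bar> \<le> B" "\<And>x. \<bar>deriv \<phi> x\<bar> \<le> B"
proof -
  obtain B1 where "\<And>x. \<bar>\<phi> x\<bar> \<le> B1"
    by (rule continuous_zero_outside_bounded[OF test_function_continuous(1)[OF assms] test_function_zero(1)[OF assms]]) auto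
  moreover obtain B2 where "\<And>x. \<bar>deriv \<phi> x\<bar> \<le> B2"
    by (rule continuous_zero_outside_bounded[OF test_function_continuous(2)[OF assms] test_function_zero(2)[OF assms]]) auto
  ultimately show ?thesis
    by (intro that[of "max B1 B2"]) (simp_all add: le_max_iff_disj)
qed

text \<open>Bridge from the Lebesgue integral over (0,T) to the gauge integral over [0,T], for which
  the fundamental theorem of calculus is stated.\<close>

lemma time_integral_eq:
  fixes f :: "real \<Rightarrow> real"
  assumes "integrable (time_measure T) f" "(f has_integral I) {0..T}"
  shows "(\<integral>t. f t \<partial>time_measure T) = I"
proof -
  have "(f has_integral (\<integral>t. f t \<partial>time_measure T)) {0<..<T}"
    by (rule has_integral_integral_lebesgue_on[OF assms(1)]) simp
  then show ?thesis
    using assms(2) has_integral_Icc_iff_Ioo has_integral_unique by blast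
qed

lemma bounded_time_integrable:
  fixes f :: "real \<Rightarrow> real"
  assumes "f \<in> borel_measurable (time_measure T)" "\<And>t. \<bar>f t\<bar> \<le> B"
  shows "integrable (time_measure T) f"
  by (rule time.integrable_const_bound[where B=B]) (use assms in auto)

text \<open>Both integrals exist for arbitrary square integrable \<open>u\<close> and
  \<open>w\<close>; what remains of the distributional identity is an equation between their
  values.\<close>

lemma has_distr_deriv_bound:
  fixes u :: "real \<Rightarrow> 'v::real_normed_vector" and j :: "'v \<Rightarrow>\<^sub>L 'h::real_inner"
  assumes "test_function T \<phi>" "u \<in> L2_space T" "w \<in> L2_space T"
  obtains I J where "has_bochner_int (time_measure T) (\<lambda>t. deriv \<phi> t *\<^sub>R dual_embed j (u t)) I"
    "has_bochner_int (time_measure T) (\<lambda>t. \<phi> t *\<^sub>R (w t :: 'v \<Rightarrow>\<^sub>L real)) J"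
proof -
  obtain B where B: "\<And>x. \<bar>\<phi> x\<bar> \<le> B" "\<And>x. \<bar>deriv \<phi> x\<bar> \<le> B"
    by (rule test_function_bounded[OF assms(1)], rule that)
  have 1: "(\<lambda>t. deriv \<phi> t *\<^sub>R dual_embed j (u t)) \<in> L2_space T"
    by (rule L2_space_scaleR_bounded[OF test_function_measurable(2)[OF assms(1)] B(2)
          L2_space_bounded_linear[OF bounded_linear_dual_embed assms(2)]])
  have 2: "(\<lambda>t. \<phi> t *\<^sub>R w t) \<in> L2_space T"
    by (rule L2_space_scaleR_bounded[OF test_function_measurable(1)[OF assms(1)] B(1) assms(3)])
  show ?thesis
    using time.ex_has_bochner_int[OF L2_spaceD(1)[OF 1] L2_integrable_norm[OF 1]]
      time.ex_has_bochner_int[OF L2_spaceD(1)[OF 2] L2_integrable_norm[OF 2]] that by meson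
qed

lemma has_distr_deriv_diff:
  fixes j :: "'v::real_normed_vector \<Rightarrow>\<^sub>L 'h::real_inner"
  assumes "has_distr_deriv T j u1 w1" "has_distr_deriv T j u2 w2"
  shows "has_distr_deriv T j (\<lambda>t. u1 t - u2 t) (\<lambda>t. w1 t - w2 t)"
  unfolding has_distr_deriv_def
proof (intro allI impI)
  fix \<phi> assume "test_function T \<phi>"
  with assms obtain I J where
    I: "has_bochner_int (time_measure T) (\<lambda>t. deriv \<phi> t *\<^sub>R dual_embed j (u1 t)) I"
       "has_bochner_int (time_measure T) (\<lambda>t. \<phi> t *\<^sub>R w1 t) (- I)" and
    J: "has_bochner_int (time_measure T) (\<lambda>t. deriv \<phi> t *\<^sub>R dual_embed j (u2 t)) J"
       "has_bochner_int (time_measure T) (\<lambda>t. \<phi> t *\<^sub>R w2 t) (- J)"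
    unfolding has_distr_deriv_def by meson
  have lin: "dual_embed j (x - y) = dual_embed j x - dual_embed j y" for x y
    using bounded_linear_dual_embed[of j] by (simp add: bounded_linear.linear linear_diff)
  show "\<exists>I. has_bochner_int (time_measure T) (\<lambda>t. deriv \<phi> t *\<^sub>R dual_embed j (u1 t - u2 t)) I \<and>
      has_bochner_int (time_measure T) (\<lambda>t. \<phi> t *\<^sub>R (w1 t - w2 t)) (- I)"
    using time.has_bochner_int_diff[OF I(1) J(1)] time.has_bochner_int_diff[OF I(2) J(2)]
    by (intro exI[of _ "I - J"]) (simp add: lin scaleR_diff_right)
qed

section \<open>Piecewise affine interpolation of local averages\<close>

text \<open>At most two integer shifts of a function supported in [0,2) are nonzero at a given
  point, namely those with index floor of \<open>x\<close> and its predecessor.\<close>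

lemma sum_shifts_le:
  fixes f :: "real \<Rightarrow> real"
  assumes "\<And>y. 0 \<le> f y" "\<And>y. f y \<le> K" "\<And>y. f y \<noteq> 0 \<Longrightarrow> 0 \<le> y \<and> y < 2"
  shows "(\<Sum>i<m. f (x - real i)) \<le> 2 * K"
proof -
  define S where "S = {i. i < m \<and> f (x - real i) \<noteq> 0}"
  have "S \<subseteq> {nat (\<lfloor>x\<rfloor> - 1), nat \<lfloor>x\<rfloor>}"
  proof
    fix i assume "i \<in> S"
    then have "0 \<le> x - real i \<and> x - real i < 2" by (intro assms(3)) (simp add: S_def)
    then have "int i = \<lfloor>x\<rfloor> \<or> int i = \<lfloor>x\<rfloor> - 1" by linarith
    then show "i \<in> {nat (\<lfloor>x\<rfloor> - 1), nat \<lfloor>x\<rfloor>}" by auto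
  qed
  then have "card S \<le> card {nat (\<lfloor>x\<rfloor> - 1), nat \<lfloor>x\<rfloor>}" by (intro card_mono) auto
  also have "\<dots> \<le> 2" by (simp add: card_insert_if)
  finally have "card S \<le> 2" .
  have K: "0 \<le> K" using assms(1,2)[of 0] by simp
  have "(\<Sum>i<m. f (x - real i)) = (\<Sum>i\<in>S. f (x - real i))"
    by (rule sum.mono_neutral_right) (auto simp: S_def)
  also have "\<dots> \<le> of_nat (card S) * K" by (intro sum_bounded_above assms)
  also have "\<dots> \<le> 2 * K" using \<open>card S \<le> 2\<close> K by (intro mult_right_mono) auto
  finally show ?thesis .
qed

text \<open>The assumptions are what \<open>smooth_bump_exists\<close> delivers; the construction
  itself stays hidden.\<close>

locale mesh =
  fixes \<beta> \<psi> :: "real \<Rightarrow> real" and \<beta>max T :: real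
  assumes \<beta>_cont: "continuous_on UNIV \<beta>" and \<beta>_nonneg: "\<And>x. 0 \<le> \<beta> x" and \<beta>_le: "\<And>x. \<beta> x \<le> \<beta>max"
    and \<beta>_supp: "\<And>x. \<beta> x \<noteq> 0 \<Longrightarrow> 1/4 \<le> x \<and> x \<le> 3/4"
    and \<beta>_int: "(\<beta> has_integral 1) {0..1}"
    and \<psi>_smooth: "smooth_real \<psi>" and \<psi>_deriv: "\<And>x. (\<psi> has_real_derivative \<beta> x - \<beta> (x - 1)) (at x)"
    and \<psi>_nonneg: "\<And>x. 0 \<le> \<psi> x" and \<psi>_le: "\<And>x. \<psi> x \<le> 1"
    and \<psi>_supp: "\<And>x. \<psi> x \<noteq> 0 \<Longrightarrow> 1/4 \<le> x \<and> x \<le> 7/4"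
    and \<psi>_int: "(\<psi> has_integral 1) {0..2}"
    and T: "0 < T"
begin

section \<open>Mesh, weights and basis functions\<close>

definition h :: "nat \<Rightarrow> real" where "h n = T / real (n + 1)"
definition \<rho> :: "nat \<Rightarrow> nat \<Rightarrow> real \<Rightarrow> real" where "\<rho> n i s = \<beta> (s / h n - real i) / h n"
definition \<Psi> :: "nat \<Rightarrow> nat \<Rightarrow> real \<Rightarrow> real" where "\<Psi> n i s = \<psi> (s / h n - real i)"
definition ramp :: "nat \<Rightarrow> nat \<Rightarrow> real \<Rightarrow> real" where "ramp n i t = max 0 (min 1 (t / h n - real i))"
text \<open>The hat with node \<open>i * h n\<close>, written as a difference of consecutive ramps
  so that sums telescope. There are \<open>n + 1\<close> cells and nodes but only \<open>n\<close>
  slopes: the last hat stays at 1 on the last cell.\<close>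

definition hat :: "nat \<Rightarrow> nat \<Rightarrow> real \<Rightarrow> real" where
  "hat n i t = (if i = 0 then 1 else ramp n (i - 1) t) - (if i < n then ramp n i t else 0)"
definition cell :: "nat \<Rightarrow> nat \<Rightarrow> real \<Rightarrow> real" where
  "cell n i t = indicator {real i * h n..<(real i + 1) * h n} t"
definition interp :: "nat \<Rightarrow> (nat \<Rightarrow> 'b::real_vector) \<Rightarrow> real \<Rightarrow> 'b" where
  "interp n a t = (\<Sum>i<n+1. hat n i t *\<^sub>R a i)"
text \<open>The a.e. derivative of \<open>interp\<close>. It is polymorphic because it is applied to
  the nodes embedded in V'.\<close>

definition slope :: "nat \<Rightarrow> (nat \<Rightarrow> 'b::real_vector) \<Rightarrow> real \<Rightarrow> 'b" where
  "slope n a t = (\<Sum>i<n. cell n i t *\<^sub>R ((1 / h n) *\<^sub>R (a (Suc i) - a i)))"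

lemma h_pos: "0 < h n" using T by (simp add: h_def)

lemma h_tendsto: "(\<lambda>n. c * h n) \<longlonglongrightarrow> 0"
proof -
  have "(\<lambda>n. c * (T * inverse (real (Suc n)))) \<longlonglongrightarrow> c * (T * 0)"
    by (intro tendsto_intros LIMSEQ_inverse_real_of_nat)
  then show ?thesis by (simp add: h_def divide_inverse)
qed

lemma T_eq: "(real n + 1) * h n = T" using T by (simp add: h_def add.commute)

lemma shift_measurable:
  assumes "continuous_on UNIV f"
  shows "(\<lambda>s. f (s / h n - real i)) \<in> borel_measurable (time_measure T)"
proof -
  have "continuous_on UNIV (\<lambda>s. s / h n - real i)" by (intro continuous_intros) (use h_pos[of n] in auto)
  then have "continuous_on UNIV (\<lambda>s. f (s / h n - real i))"
    by (rule continuous_on_compose2[OF assms]) auto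
  then show ?thesis by (intro borel_imp_time_measurable borel_measurable_continuous_onI)
qed

text \<open>Affine substitution, with \<open>k\<close> the length of the support: 1 for
  \<open>\<beta>\<close> and 2 for \<open>\<psi>\<close>. The condition on \<open>i + k\<close>
  keeps the scaled support in [0,T], so no mass is lost.\<close>

lemma shift_integral:
  assumes f: "continuous_on UNIV f" "\<And>x. \<bar>f x\<bar> \<le> B" "\<And>x. f x \<noteq> 0 \<Longrightarrow> 0 \<le> x \<and> x \<le> real k"
    and int: "(f has_integral 1) {0..real k}" and ik: "i + k \<le> n + 1"
  shows "integrable (time_measure T) (\<lambda>s. f (s / h n - real i))"
    and "(\<integral>s. f (s / h n - real i) \<partial>time_measure T) = h n"
proof -
  show int': "integrable (time_measure T) (\<lambda>s. f (s / h n - real i))"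
    by (rule bounded_time_integrable[OF shift_measurable[OF f(1)] f(2)])
  have "((\<lambda>x. f ((1 / h n) *\<^sub>R x + (- real i))) has_integral (1 / \<bar>1 / h n\<bar> ^ DIM(real)) *\<^sub>R 1)
     ((\<lambda>x. (1 / (1 / h n)) *\<^sub>R x + - ((1 / (1 / h n)) *\<^sub>R (- real i))) ` cbox 0 (real k))"
    by (rule has_integral_affinity) (use int h_pos[of n] in auto)
  moreover have "(\<lambda>x. (1 / (1 / h n)) *\<^sub>R x + - ((1 / (1 / h n)) *\<^sub>R (- real i))) ` cbox 0 (real k) = {real i * h n..(real i + real k) * h n}"
    using h_pos[of n] image_affinity_atLeastAtMost[of "h n" "h n * real i" 0 "real k"]
    by (simp add: algebra_simps)
  ultimately have int_cell: "((\<lambda>s. f (s / h n - real i)) has_integral h n) {real i * h n..(real i + real k) * h n}"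
    using h_pos[of n] by simp
  have sub: "{real i * h n..(real i + real k) * h n} \<subseteq> {0..T}"
  proof -
    have "real i + real k \<le> real n + 1" using ik by linarith
    then have "(real i + real k) * h n \<le> (real n + 1) * h n"
      using h_pos[of n] by (intro mult_right_mono) auto
    then have "(real i + real k) * h n \<le> T" using T_eq by simp
    moreover have "0 \<le> real i * h n" using h_pos[of n] by simp
    ultimately show ?thesis by auto
  qed
  have outside: "f (s / h n - real i) = 0" if "s \<notin> {real i * h n..(real i + real k) * h n}" for s
  proof (rule ccontr)
    assume "f (s / h n - real i) \<noteq> 0"
    then have "0 \<le> s / h n - real i" "s / h n - real i \<le> real k" using f(3) by blast+
    then show False using that h_pos[of n] by (auto simp: field_simps)
  qed
  have "((\<lambda>s. f (s / h n - real i)) has_integral h n) {0..T}"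
    by (rule has_integral_on_superset[OF int_cell outside sub])
  then show "(\<integral>s. f (s / h n - real i) \<partial>time_measure T) = h n"
    by (rule time_integral_eq[OF int'])
qed

lemma \<psi>_cont: "continuous_on UNIV \<psi>"
  using DERIV_isCont[OF \<psi>_deriv] by (simp add: continuous_on_eq_continuous_at)

lemma \<rho>_integral:
  assumes "i \<le> n"
  shows "integrable (time_measure T) (\<rho> n i)" "(\<integral>s. \<rho> n i s \<partial>time_measure T) = 1"
proof -
  have B: "\<bar>\<beta> x\<bar> \<le> \<beta>max" for x using \<beta>_nonneg \<beta>_le by simp
  have S: "\<beta> x \<noteq> 0 \<Longrightarrow> 0 \<le> x \<and> x \<le> real 1" for x using \<beta>_supp[of x] by auto
  note * = shift_integral[where f=\<beta> and k=1 and i=i and n=n, OF \<beta>_cont B S]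
  show "integrable (time_measure T) (\<rho> n i)" "(\<integral>s. \<rho> n i s \<partial>time_measure T) = 1"
    using * assms \<beta>_int h_pos[of n] by (simp_all add: \<rho>_def[abs_def])
qed

lemma \<Psi>_integral:
  assumes "i < n"
  shows "(\<integral>s. \<Psi> n i s / h n \<partial>time_measure T) = 1"
proof -
  have B: "\<bar>\<psi> x\<bar> \<le> 1" for x using \<psi>_nonneg \<psi>_le by simp
  have S: "\<psi> x \<noteq> 0 \<Longrightarrow> 0 \<le> x \<and> x \<le> real 2" for x using \<psi>_supp[of x] by auto
  note * = shift_integral[where f=\<psi> and k=2 and i=i and n=n, OF \<psi>_cont B S]
  show ?thesis
    using * assms \<psi>_int h_pos[of n] by (simp add: \<Psi>_def[abs_def])
qed

lemma \<rho>_nonneg: "0 \<le> \<rho> n i s" using \<beta>_nonneg h_pos[of n] by (simp add: \<rho>_def)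
lemma \<Psi>_nonneg: "0 \<le> \<Psi> n i s" using \<psi>_nonneg by (simp add: \<Psi>_def)

lemma \<rho>_measurable: "\<rho> n i \<in> borel_measurable (time_measure T)"
  unfolding \<rho>_def[abs_def] by (intro borel_measurable_divide shift_measurable \<beta>_cont) simp

lemma \<Psi>_measurable: "\<Psi> n i \<in> borel_measurable (time_measure T)"
  unfolding \<Psi>_def[abs_def] by (rule shift_measurable[OF \<psi>_cont])

text \<open>This identity turns testing with \<open>\<Psi> n i\<close> into a difference of two
  neighbouring averages; the chain rule factor \<open>1 / h n\<close> is the normalisation of
  \<open>\<rho>\<close>.\<close>

lemma \<Psi>_DERIV: "(\<Psi> n i has_real_derivative \<rho> n i s - \<rho> n (Suc i) s) (at s)"
proof -
  have "((\<lambda>s. \<psi> (s / h n - real i)) has_real_derivative (\<beta> (s / h n - real i) - \<beta> (s / h n - real i - 1)) * (1 / h n)) (at s)"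
    using h_pos[of n] by (intro DERIV_chain2[OF \<psi>_deriv]) (auto intro!: derivative_eq_intros)
  then show ?thesis
    by (simp add: \<Psi>_def[abs_def] \<rho>_def diff_divide_distrib algebra_simps)
qed

lemma test_function_\<Psi>:
  assumes "i < n"
  shows "test_function T (\<Psi> n i)"
proof -
  have "smooth_real (\<Psi> n i)"
    using smooth_real_combination[OF \<psi>_smooth \<psi>_smooth, of 1 "1 / h n" "- real i" 0 0 0]
    by (simp add: \<Psi>_def[abs_def])
  moreover define S where "S = {(real i + 1/4) * h n..(real i + 7/4) * h n}"
  have "{x. \<Psi> n i x \<noteq> 0} \<subseteq> S"
    using \<psi>_supp h_pos[of n] by (auto simp: S_def \<Psi>_def field_simps dest!: \<psi>_supp)
  then have cl: "closure {x. \<Psi> n i x \<noteq> 0} \<subseteq> S"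
    by (rule closure_minimal) (simp add: S_def)
  have S: "S \<subseteq> {0<..<T}"
  proof -
    \<comment> \<open>From \<open>i + 1 <= n\<close>; the margin of 1/4 makes the inequality strict,
      so the closed support lies in the open interval.\<close>
    have "(real i + 7/4) * h n < (real n + 1) * h n"
      using assms h_pos[of n] by (intro mult_strict_right_mono) auto
    moreover have "0 < (real i + 1/4) * h n" using h_pos[of n] by simp
    ultimately show ?thesis using T_eq[of n] by (auto simp: S_def)
  qed
  have "compact (S \<inter> closure {x. \<Psi> n i x \<noteq> 0})" by (intro compact_Int_closed) (auto simp: S_def)
  then have "compact (closure {x. \<Psi> n i x \<noteq> 0})" using cl by (simp add: Int_absorb1)
  ultimately show ?thesis
    using cl S unfolding test_function_def smooth_real_def by blast
qed

lemma ramp_cont: "continuous_on UNIV (ramp n i)"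
  unfolding ramp_def using h_pos[of n] by (intro continuous_intros) auto

lemma ramp_bounds: "0 \<le> ramp n i t" "ramp n i t \<le> 1" by (auto simp: ramp_def)

lemma hat_cont: "continuous_on UNIV (hat n i)"
  unfolding hat_def by (cases "i = 0"; cases "i < n") (auto intro!: continuous_intros ramp_cont)

lemma hat_nonneg: "0 \<le> hat n i t"
  using ramp_bounds[of n 0 t] ramp_bounds[of n "i - 1" t] by (auto simp: hat_def ramp_def)

text \<open>Telescoping: each partial sum is 1 minus the next ramp, and the conditional in
  \<open>hat\<close> drops that ramp at the last index.\<close>

lemma hat_sum: "(\<Sum>i<n+1. hat n i t) = 1"
proof -
  have "(\<Sum>i<Suc k. hat n i t) = 1 - (if k < n then ramp n k t else 0)" if "k \<le> n" for k
    using that by (induction k) (auto simp: hat_def)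
  from this[of n] show ?thesis by simp
qed

lemma hat_le_1: "i \<le> n \<Longrightarrow> hat n i t \<le> 1"
  using ramp_bounds by (auto simp: hat_def) (smt (verit) ramp_bounds)+

lemma cell_bounds: "0 \<le> cell n i t" "cell n i t \<le> 1" by (auto simp: cell_def indicator_def)

lemma cell_measurable: "cell n i \<in> borel_measurable (time_measure T)"
  unfolding cell_def[abs_def] by (intro borel_imp_time_measurable) simp

lemma hat_measurable: "hat n i \<in> borel_measurable (time_measure T)"
  by (intro borel_imp_time_measurable borel_measurable_continuous_onI hat_cont)

text \<open>Restricting \<open>t\<close> to (0,T) matters for the first and the last hat, which
  remain 1 beyond their nodes.\<close>

lemma hat_supp:
  assumes "i \<le> n" "t \<in> {0<..<T}" "hat n i t \<noteq> 0"
  shows "(real i - 1) * h n \<le> t \<and> t \<le> (real i + 1) * h n"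
proof -
  have t: "0 < t / h n" "t / h n < real n + 1"
    using assms(2) h_pos[of n] T_eq[of n] by (simp_all add: pos_divide_less_eq)
  have "real i - 1 \<le> t / h n \<and> t / h n \<le> real i + 1"
  proof (cases "i = 0")
    case True
    then show ?thesis using assms(1,3) t by (auto simp: hat_def ramp_def split: if_splits)
  next
    case False
    then have "real (i - 1) = real i - 1" by simp
    then show ?thesis using False assms(1,3) t by (auto simp: hat_def ramp_def max_def min_def split: if_splits)
  qed
  then show ?thesis using h_pos[of n] by (simp add: field_simps)
qed

lemma integral_le_length:
  assumes "f \<in> borel_measurable (time_measure T)" "\<And>t. 0 \<le> f t" "\<And>t. f t \<le> (1::real)"
    and "\<And>t. t \<in> {0<..<T} \<Longrightarrow> f t \<noteq> 0 \<Longrightarrow> a \<le> t \<and> t \<le> b" and "a \<le> b"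
  shows "(\<integral>t. f t \<partial>time_measure T) \<le> b - a"
proof -
  have I: "indicat_real {a..b} \<in> borel_measurable (time_measure T)"
    by (intro borel_imp_time_measurable) simp
  have "(\<integral>t. f t \<partial>time_measure T) \<le> (\<integral>t. indicat_real {a..b} t \<partial>time_measure T)"
  proof (rule integral_mono)
    show "integrable (time_measure T) f" using assms by (intro bounded_time_integrable[where B=1]) auto
    show "integrable (time_measure T) (indicat_real {a..b})"
      using I by (intro bounded_time_integrable[where B=1]) (auto simp: indicator_def)
    show "f t \<le> indicat_real {a..b} t" if "t \<in> space (time_measure T)" for t
      using assms(3)[of t] assms(4)[of t] that by (cases "f t = 0") (auto simp: indicator_def)
  qed
  also have "\<dots> = measure lebesgue ({a..b} \<inter> {0<..<T})"
    by (subst measure_restrict_space[symmetric]) auto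
  also have "\<dots> \<le> measure lebesgue {a..b}"
    by (intro measure_mono_fmeasurable) auto
  also have "\<dots> = b - a" using assms(5) by simp
  finally show ?thesis .
qed

text \<open>A hat lives on two cells, hence \<open>A n = 2 * h n\<close>; at most two weights
  overlap and each is at most \<open>\<beta>max / h n\<close>, hence \<open>D n\<close>. The powers
  of \<open>h n\<close> cancel in the product, which is what makes the bound uniform.\<close>

lemma approx_kernel_hat:
  "approx_kernel T (\<lambda>n. n + 1) hat \<rho> (\<lambda>n. 2 * h n) (\<lambda>n. 2 * \<beta>max / h n) (\<lambda>n. 2 * h n) (4 * \<beta>max)"
proof
  fix n i t s
  show "(\<integral>s. \<rho> n i s \<partial>time_measure T) \<le> 1" if "i < n + 1" using \<rho>_integral[of i n] that by simp
  show "(\<integral>t. hat n i t \<partial>time_measure T) \<le> 2 * h n" if "i < n + 1"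
  proof -
    have "(\<integral>t. min 1 (hat n i t) \<partial>time_measure T) \<le> (real i + 1) * h n - (real i - 1) * h n"
      using that h_pos[of n] hat_supp[of i n] hat_measurable[of n i] hat_nonneg[of n i]
      by (intro integral_le_length) (auto simp: algebra_simps)
    moreover have "min 1 (hat n i t) = hat n i t" for t using hat_le_1[of i n t] that by simp
    ultimately show ?thesis by (simp add: algebra_simps)
  qed
  show "(\<Sum>i<n + 1. \<rho> n i s) \<le> 2 * \<beta>max / h n"
  proof -
    have "(\<Sum>i<n + 1. \<beta> (s / h n - real i)) \<le> 2 * \<beta>max"
    proof (rule sum_shifts_le)
      show "0 \<le> y \<and> y < 2" if "\<beta> y \<noteq> 0" for y using \<beta>_supp[OF that] by auto
    qed (use \<beta>_nonneg \<beta>_le in auto)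
    then show ?thesis
      using h_pos[of n] by (simp add: \<rho>_def divide_right_mono flip: sum_divide_distrib del: sum.lessThan_Suc)
  qed
  show "\<bar>s - t\<bar> \<le> 2 * h n" if "i < n + 1" "t \<in> {0<..<T}" "hat n i t \<noteq> 0" "\<rho> n i s \<noteq> 0"
  proof -
    have "\<beta> (s / h n - real i) \<noteq> 0" using that(4) by (auto simp: \<rho>_def)
    from \<beta>_supp[OF this] have "real i \<le> s / h n \<and> s / h n \<le> real i + 1" by linarith
    then have "real i * h n \<le> s" "s \<le> (real i + 1) * h n" using h_pos[of n] by (auto simp: field_simps)
    then show ?thesis using hat_supp[of i n t] that by (auto simp: algebra_simps abs_le_iff)
  qed
  show "\<forall>\<^sub>F n in sequentially. (\<Sum>i<n + 1. hat n i t * (\<integral>s. \<rho> n i s \<partial>time_measure T)) = 1"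
  proof (rule always_eventually, rule allI)
    fix n
    have "(\<Sum>i<n + 1. hat n i t * (\<integral>s. \<rho> n i s \<partial>time_measure T)) = (\<Sum>i<n + 1. hat n i t)"
      by (rule sum.cong) (use \<rho>_integral(2)[of _ n] in auto)
    then show "(\<Sum>i<n + 1. hat n i t * (\<integral>s. \<rho> n i s \<partial>time_measure T)) = 1" using hat_sum by simp
  qed
  show "(\<Sum>i<n + 1. hat n i t) \<le> 1" by (simp only: hat_sum order_refl)
  show "0 \<le> 2 * h n" "2 * h n * (2 * \<beta>max / h n) \<le> 4 * \<beta>max" using h_pos[of n] by simp_all
qed (rule T hat_measurable \<rho>_measurable hat_nonneg \<rho>_nonneg h_tendsto)+

text \<open>The kernel that represents the slopes; again the powers of \<open>h n\<close> cancel.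
  The cells with \<open>i < n\<close> omit the last one, so for given \<open>t\<close> the mass is 1
  only once \<open>h n < T - t\<close>.\<close>

lemma approx_kernel_cell:
  "approx_kernel T (\<lambda>n. n) cell (\<lambda>n i s. \<Psi> n i s / h n) (\<lambda>n. 2 * h n) (\<lambda>n. 2 / h n) (\<lambda>n. 2 * h n) 4"
proof
  fix n i t s
  have cell_supp: "cell n i t \<noteq> 0 \<Longrightarrow> real i * h n \<le> t \<and> t < (real i + 1) * h n" for n i t
    by (auto simp: cell_def indicator_def)
  have cell_eq: "cell n i t = (if real i \<le> t / h n \<and> t / h n < real i + 1 then 1 else 0)" for n i t
    using h_pos[of n] by (auto simp: cell_def indicator_def field_simps)
  have cell_sum: "(\<Sum>i<n. cell n i t) = (if 0 \<le> t / h n \<and> t / h n < real n then 1 else 0)" for n t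
  proof -
    \<comment> \<open>The only cell containing \<open>t\<close> has the floor of
      \<open>t / h n\<close> as index; the sign condition excludes negative \<open>t\<close>, where
      \<open>nat\<close> truncates the floor to 0.\<close>
    have "cell n i t = (if i = nat \<lfloor>t / h n\<rfloor> \<and> 0 \<le> t / h n then 1 else 0)" for i
      unfolding cell_eq by (auto; linarith)
    moreover have "nat \<lfloor>t / h n\<rfloor> < n \<longleftrightarrow> t / h n < real n" if "0 \<le> t / h n"
      using that by (simp add: nat_less_iff floor_less_iff)
    ultimately show ?thesis by (cases "0 \<le> t / h n") auto
  qed
  show "(\<integral>s. \<Psi> n i s / h n \<partial>time_measure T) \<le> 1" if "i < n" using \<Psi>_integral[OF that] by simp
  show "(\<integral>t. cell n i t \<partial>time_measure T) \<le> 2 * h n"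
  proof -
    have "(\<integral>t. cell n i t \<partial>time_measure T) \<le> (real i + 1) * h n - real i * h n"
      using h_pos[of n] cell_measurable[of n i] cell_bounds cell_supp[of n i]
      by (intro integral_le_length) (auto simp: less_imp_le)
    then show ?thesis using h_pos[of n] by (simp add: algebra_simps)
  qed
  show "(\<Sum>i<n. \<Psi> n i s / h n) \<le> 2 / h n"
  proof -
    have "(\<Sum>i<n. \<psi> (s / h n - real i)) \<le> 2 * 1"
    proof (rule sum_shifts_le)
      show "0 \<le> y \<and> y < 2" if "\<psi> y \<noteq> 0" for y using \<psi>_supp[OF that] by auto
    qed (use \<psi>_nonneg \<psi>_le in auto)
    then show ?thesis
      using h_pos[of n] by (simp add: \<Psi>_def divide_right_mono flip: sum_divide_distrib)
  qed
  show "(\<Sum>i<n. cell n i t) \<le> 1" unfolding cell_sum by simp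
  show "\<bar>s - t\<bar> \<le> 2 * h n" if "cell n i t \<noteq> 0" "\<Psi> n i s / h n \<noteq> 0"
  proof -
    have "\<psi> (s / h n - real i) \<noteq> 0" using that(2) by (auto simp: \<Psi>_def)
    from \<psi>_supp[OF this] have "real i \<le> s / h n \<and> s / h n \<le> real i + 2" by linarith
    then have "real i * h n \<le> s" "s \<le> (real i + 2) * h n" using h_pos[of n] by (auto simp: field_simps)
    then show ?thesis using cell_supp[OF that(1)] by (auto simp: algebra_simps abs_le_iff)
  qed
  show "\<forall>\<^sub>F n in sequentially. (\<Sum>i<n. cell n i t * (\<integral>s. \<Psi> n i s / h n \<partial>time_measure T)) = 1" if t: "t \<in> {0<..<T}"
  proof -
    have "\<forall>\<^sub>F n in sequentially. 1 * h n < T - t"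
      using h_tendsto[of 1] by (rule order_tendstoD) (use t in simp)
    then show ?thesis
    proof eventually_elim
      case (elim n)
      have "(\<Sum>i<n. cell n i t * (\<integral>s. \<Psi> n i s / h n \<partial>time_measure T)) = (\<Sum>i<n. cell n i t)"
        by (rule sum.cong[OF refl]) (simp only: \<Psi>_integral lessThan_iff mult_1_right)
      moreover have "t < real n * h n" using elim T_eq[of n] by (simp add: algebra_simps)
      then have "0 \<le> t / h n \<and> t / h n < real n" using t h_pos[of n] by (auto simp: field_simps)
      ultimately show ?case using cell_sum by simp
    qed
  qed
  show "0 \<le> 2 * h n" "2 * h n * (2 / h n) \<le> 4" "0 \<le> \<Psi> n i s / h n"
    using h_pos[of n] \<Psi>_nonneg[of n i s] by simp_all
  show "(\<lambda>s. \<Psi> n i s / h n) \<in> borel_measurable (time_measure T)"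
    by (intro borel_measurable_divide \<Psi>_measurable) simp
qed (rule T cell_measurable cell_bounds h_tendsto)+

end

section \<open>Values, slopes and perturbation of interpolants\<close>

context mesh
begin

text \<open>Abel summation: the hats become ramps multiplying the increments, the form in which one
  can differentiate. The induction over partial sums carries the unfinished ramp of the last node as
  a correction, which disappears at the end.\<close>

lemma interp_eq: "interp n a t = a 0 + (\<Sum>i<n. ramp n i t *\<^sub>R (a (Suc i) - a i))"
proof -
  have "(\<Sum>i<Suc k. hat n i t *\<^sub>R a i) =
      a 0 + (\<Sum>i<k. ramp n i t *\<^sub>R (a (Suc i) - a i)) - (if k < n then ramp n k t else 0) *\<^sub>R a k" if "k \<le> n" for k
    using that
  proof (induction k)
    case 0
    then show ?case by (simp add: hat_def algebra_simps)
  next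
    case (Suc k)
    then have "k < n" "k \<le> n" by auto
    have "(\<Sum>i<Suc (Suc k). hat n i t *\<^sub>R a i) = (\<Sum>i<Suc k. hat n i t *\<^sub>R a i) + hat n (Suc k) t *\<^sub>R a (Suc k)"
      by simp
    also note Suc.IH[OF \<open>k \<le> n\<close>]
    finally show ?case
      using \<open>k < n\<close> by (simp add: hat_def algebra_simps)
  qed
  from this[of n] show ?thesis by (simp add: interp_def)
qed

lemma interp_in_convex:
  assumes "convex C" "\<And>i. i \<le> n \<Longrightarrow> a i \<in> C"
  shows "interp n a t \<in> C"
  unfolding interp_def
  by (rule convex_sum) (use assms hat_sum hat_nonneg in auto)

lemma interp_L2: "interp n a \<in> L2_space T"
  unfolding interp_def[abs_def] by (rule approx_kernel.L2_approx[OF approx_kernel_hat])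

lemma slope_L2: "slope n a \<in> L2_space T"
  unfolding slope_def[abs_def] by (rule approx_kernel.L2_approx[OF approx_kernel_cell])

lemma interp_diff: "interp n a t - interp n a' t = interp n (\<lambda>i. a i - a' i) t"
  by (simp add: interp_def sum_subtractf scaleR_diff_right del: sum.lessThan_Suc)

lemma slope_diff: "slope n a t - slope n a' t = slope n (\<lambda>i. a i - a' i) t"
  by (simp add: slope_def algebra_simps flip: sum_subtractf)

lemma norm_interp_le:
  fixes a :: "nat \<Rightarrow> 'b::real_normed_vector"
  shows "norm (interp n a t) \<le> (\<Sum>i<n+1. norm (a i))"
  unfolding interp_def
proof (rule order_trans[OF norm_sum], rule sum_mono)
  fix i assume "i \<in> {..<n+1}"
  then show "norm (hat n i t *\<^sub>R a i) \<le> norm (a i)"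
    using hat_nonneg[of n i t] hat_le_1[of i n t] by (simp add: mult_left_le_one_le)
qed

lemma norm_slope_le:
  fixes a :: "nat \<Rightarrow> 'b::real_normed_vector"
  shows "norm (slope n a t) \<le> (\<Sum>i<n. norm ((1 / h n) *\<^sub>R (a (Suc i) - a i)))"
  unfolding slope_def
proof (rule order_trans[OF norm_sum], rule sum_mono)
  fix i
  have "norm (cell n i t *\<^sub>R x) \<le> norm x" for x :: 'b
    using cell_bounds[of n i t] by (simp add: mult_left_le_one_le)
  then show "norm (cell n i t *\<^sub>R ((1 / h n) *\<^sub>R (a (Suc i) - a i))) \<le> norm ((1 / h n) *\<^sub>R (a (Suc i) - a i))" .
qed

text \<open>On a fixed mesh the error is bounded uniformly in \<open>t\<close> by the finite sum of
  the node errors.\<close>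

lemma interp_perturb:
  fixes a :: "nat \<Rightarrow> 'b::real_normed_vector"
  assumes "\<And>i. i \<le> n \<Longrightarrow> (\<lambda>m. a' m i) \<longlonglongrightarrow> a i"
  shows "(\<lambda>m. L2_sq T (\<lambda>t. interp n (a' m) t - interp n a t)) \<longlonglongrightarrow> 0"
proof -
  define e where "e m = (\<Sum>i<n+1. norm (a' m i - a i))" for m
  have "e \<longlonglongrightarrow> (\<Sum>i<n+1. norm (a i - a i))"
    unfolding e_def by (intro tendsto_sum tendsto_norm tendsto_diff tendsto_const assms) auto
  then have "(\<lambda>m. (e m)\<^sup>2 * T) \<longlonglongrightarrow> 0\<^sup>2 * T" by (intro tendsto_intros) simp
  moreover have "L2_sq T (\<lambda>t. interp n (a' m) t - interp n a t) \<le> (e m)\<^sup>2 * T" for m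
  proof -
    have "0 \<le> e m" unfolding e_def by (intro sum_nonneg norm_ge_zero)
    moreover have "norm (interp n (\<lambda>i. a' m i - a i) t) \<le> e m" for t
      unfolding e_def by (rule norm_interp_le)
    ultimately show ?thesis
      unfolding interp_diff using T by (intro L2_sq_le_const interp_L2) auto
  qed
  ultimately show ?thesis
    using tendsto_sandwich[of "\<lambda>_. 0" _ sequentially "\<lambda>m. (e m)\<^sup>2 * T" 0] L2_sq_nonneg by simp
qed

text \<open>The factor \<open>1 / h n\<close> is harmless, since the mesh \<open>n\<close> is fixed
  while \<open>m\<close> grows.\<close>

lemma slope_perturb:
  fixes a :: "nat \<Rightarrow> 'b::real_normed_vector"
  assumes "\<And>i. i \<le> n \<Longrightarrow> (\<lambda>m. a' m i) \<longlonglongrightarrow> a i"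
  shows "(\<lambda>m. L2_sq T (\<lambda>t. slope n (a' m) t - slope n a t)) \<longlonglongrightarrow> 0"
proof -
  define e where "e m = (\<Sum>i<n. norm ((1 / h n) *\<^sub>R ((a' m (Suc i) - a (Suc i)) - (a' m i - a i))))" for m
  have "e \<longlonglongrightarrow> (\<Sum>i<n. norm ((1 / h n) *\<^sub>R ((a (Suc i) - a (Suc i)) - (a i - a i))))"
    unfolding e_def by (intro tendsto_sum tendsto_norm tendsto_diff tendsto_const tendsto_scaleR assms) auto
  then have "(\<lambda>m. (e m)\<^sup>2 * T) \<longlonglongrightarrow> 0\<^sup>2 * T" by (intro tendsto_intros) simp
  moreover have "L2_sq T (\<lambda>t. slope n (a' m) t - slope n a t) \<le> (e m)\<^sup>2 * T" for m
  proof -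
    have "0 \<le> e m" unfolding e_def by (intro sum_nonneg norm_ge_zero)
    moreover have "norm (slope n (\<lambda>i. a' m i - a i) t) \<le> e m" for t
      unfolding e_def by (rule norm_slope_le)
    ultimately show ?thesis
      unfolding slope_diff using T by (intro L2_sq_le_const slope_L2) auto
  qed
  ultimately show ?thesis
    using tendsto_sandwich[of "\<lambda>_. 0" _ sequentially "\<lambda>m. (e m)\<^sup>2 * T" 0] L2_sq_nonneg by simp
qed

section \<open>Integration by parts and uniqueness of the derivative\<close>

lemma test_function_times_integrable:
  assumes \<phi>: "test_function T \<phi>" and g: "g \<in> borel_measurable (time_measure T)" "\<And>t. \<bar>g t\<bar> \<le> 1"
  shows "integrable (time_measure T) (\<lambda>t. \<phi> t * g t)" "integrable (time_measure T) (\<lambda>t. deriv \<phi> t * g t)"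
proof -
  obtain B where B: "\<And>x. \<bar>\<phi> x\<bar> \<le> B" "\<And>x. \<bar>deriv \<phi> x\<bar> \<le> B"
    by (rule test_function_bounded[OF \<phi>], rule that)
  have "\<bar>\<phi> t * g t\<bar> \<le> B * 1" "\<bar>deriv \<phi> t * g t\<bar> \<le> B * 1" for t
    unfolding abs_mult by (intro mult_mono B g(2) order_trans[OF abs_ge_zero B(1)[of t]]; simp)+
  then show "integrable (time_measure T) (\<lambda>t. \<phi> t * g t)" "integrable (time_measure T) (\<lambda>t. deriv \<phi> t * g t)"
    using test_function_measurable[OF \<phi>] g(1)
    by (auto intro!: bounded_time_integrable[where B="B * 1"] borel_measurable_times)
qed

lemma test_function_integral_deriv:
  assumes \<phi>: "test_function T \<phi>"
  shows "(\<integral>t. deriv \<phi> t \<partial>time_measure T) = 0"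
proof (rule time_integral_eq)
  show "integrable (time_measure T) (deriv \<phi>)"
    using test_function_times_integrable(2)[OF \<phi>, of "\<lambda>_. 1"] by simp
  have "(deriv \<phi> has_integral (\<phi> T - \<phi> 0)) {0..T}"
    using T by (intro fundamental_theorem_of_calculus)
      (auto simp flip: has_real_derivative_iff_has_vector_derivative intro: has_field_derivative_at_within test_function_DERIV[OF \<phi>])
  then show "(deriv \<phi> has_integral 0) {0..T}"
    using test_function_zero(1)[OF \<phi>, of 0] test_function_zero(1)[OF \<phi>, of T] by simp
qed

text \<open>The product of \<open>\<phi>\<close> and the ramp vanishes at both ends of [0,T], so its
  derivative has integral 0; the two kinks of the ramp form a finite exceptional set for the
  fundamental theorem.\<close>

lemma ramp_by_parts:
  assumes \<phi>: "test_function T \<phi>"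
  shows "(\<integral>t. deriv \<phi> t * ramp n i t \<partial>time_measure T) = - (\<integral>t. \<phi> t * cell n i t \<partial>time_measure T) / h n"
proof -
  have r: "ramp n i \<in> borel_measurable (time_measure T)"
    by (intro borel_imp_time_measurable borel_measurable_continuous_onI ramp_cont)
  have i1: "integrable (time_measure T) (\<lambda>t. deriv \<phi> t * ramp n i t)"
    using ramp_bounds by (intro test_function_times_integrable \<phi> r) simp
  have i2: "integrable (time_measure T) (\<lambda>t. \<phi> t * cell n i t)"
    using cell_bounds by (intro test_function_times_integrable \<phi> cell_measurable) simp
  let ?S = "{real i * h n, (real i + 1) * h n}"
  have cont: "continuous_on {0..T} (\<lambda>t. \<phi> t * ramp n i t)"
    by (intro continuous_on_mult continuous_on_subset[OF ramp_cont] continuous_on_subset[OF test_function_continuous(1)[OF \<phi>]]) auto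
  have ramp_deriv: "(ramp n i has_real_derivative cell n i t / h n) (at t)" if "t \<notin> ?S" for t
  proof -
    consider "t < real i * h n" | "real i * h n < t" "t < (real i + 1) * h n" | "(real i + 1) * h n < t"
      using \<open>t \<notin> ?S\<close> by fastforce
    then show ?thesis
    proof cases
      case 1
      have "((\<lambda>_. 0) has_real_derivative cell n i t / h n) (at t)" using 1 by (simp add: cell_def)
      then show ?thesis
        by (rule has_field_derivative_transform_within_open[where S="{..<real i * h n}"])
           (use 1 h_pos[of n] in \<open>auto simp: ramp_def field_simps max_def min_def\<close>)
    next
      case 2
      have "((\<lambda>t. t / h n - real i) has_real_derivative cell n i t / h n) (at t)"
        using 2 h_pos[of n] by (auto intro!: derivative_eq_intros simp: cell_def)
      then show ?thesis
        by (rule has_field_derivative_transform_within_open[where S="{real i * h n<..<(real i + 1) * h n}"])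
           (use 2 h_pos[of n] in \<open>auto simp: ramp_def field_simps max_def min_def\<close>)
    next
      case 3
      have "((\<lambda>_. 1) has_real_derivative cell n i t / h n) (at t)" using 3 by (simp add: cell_def)
      then show ?thesis
        by (rule has_field_derivative_transform_within_open[where S="{(real i + 1) * h n<..}"])
           (use 3 h_pos[of n] in \<open>auto simp: ramp_def field_simps max_def min_def\<close>)
    qed
  qed
  have "((\<lambda>t. deriv \<phi> t * ramp n i t + \<phi> t * cell n i t / h n) has_integral
      (\<phi> T * ramp n i T - \<phi> 0 * ramp n i 0)) {0..T}"
  proof (rule fundamental_theorem_of_calculus_interior_strong[where S="?S"])
    show "((\<lambda>t. \<phi> t * ramp n i t) has_vector_derivative deriv \<phi> t * ramp n i t + \<phi> t * cell n i t / h n) (at t)"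
      if "t \<in> {0<..<T} - ?S" for t
      unfolding has_real_derivative_iff_has_vector_derivative[symmetric]
      using DERIV_mult[OF test_function_DERIV(1)[OF \<phi>, of t] ramp_deriv[of t]] that by (simp add: mult.commute)
  qed (use T cont in auto)
  then have "((\<lambda>t. deriv \<phi> t * ramp n i t + \<phi> t * cell n i t / h n) has_integral 0) {0..T}"
    using test_function_zero(1)[OF \<phi>, of 0] test_function_zero(1)[OF \<phi>, of T] by simp
  then have "(\<integral>t. deriv \<phi> t * ramp n i t + \<phi> t * cell n i t / h n \<partial>time_measure T) = 0"
    by (intro time_integral_eq Bochner_Integration.integrable_add integrable_divide i1 i2)
  then show ?thesis using i1 i2 by simp
qed

text \<open>In the form \<open>interp_eq\<close> the constant term is annihilated, because the
  derivative of a test function has integral 0, and each ramp is integrated by parts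
  separately.\<close>

lemma has_distr_deriv_interp: "has_distr_deriv T j (interp n a) (slope n (\<lambda>i. dual_embed j (a i)))"
  unfolding has_distr_deriv_def
proof (intro allI impI)
  fix \<phi> assume \<phi>: "test_function T \<phi>"
  let ?J = "dual_embed j"
  define I where "I = (\<Sum>i<n. (\<integral>t. deriv \<phi> t * ramp n i t \<partial>time_measure T) *\<^sub>R (?J (a (Suc i)) - ?J (a i)))"
  interpret J: bounded_linear ?J by (rule bounded_linear_dual_embed)
  have r: "ramp n i \<in> borel_measurable (time_measure T)" for i
    by (intro borel_imp_time_measurable borel_measurable_continuous_onI ramp_cont)
  have i0: "integrable (time_measure T) (deriv \<phi>)"
    using test_function_times_integrable(2)[OF \<phi>, of "\<lambda>_. 1"] by simp
  have i1: "integrable (time_measure T) (\<lambda>t. deriv \<phi> t * ramp n i t)" for i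
    using ramp_bounds by (intro test_function_times_integrable \<phi> r) simp
  have i2: "integrable (time_measure T) (\<lambda>t. \<phi> t * cell n i t)" for i
    using cell_bounds by (intro test_function_times_integrable \<phi> cell_measurable) simp
  have "has_bochner_int (time_measure T) (\<lambda>t. deriv \<phi> t *\<^sub>R ?J (a 0) +
      (\<Sum>i<n. (deriv \<phi> t * ramp n i t) *\<^sub>R (?J (a (Suc i)) - ?J (a i)))) ((\<integral>t. deriv \<phi> t \<partial>time_measure T) *\<^sub>R ?J (a 0) + I)"
    unfolding I_def
    by (intro time.has_bochner_int_add time.has_bochner_int_sum time.has_bochner_int_scaleR_const i0 i1) simp
  moreover have "deriv \<phi> t *\<^sub>R ?J (interp n a t) = deriv \<phi> t *\<^sub>R ?J (a 0) +
      (\<Sum>i<n. (deriv \<phi> t * ramp n i t) *\<^sub>R (?J (a (Suc i)) - ?J (a i)))" for t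
    by (simp add: interp_eq J.add J.sum J.scaleR J.diff scaleR_add_right scaleR_sum_right)
  ultimately have 1: "has_bochner_int (time_measure T) (\<lambda>t. deriv \<phi> t *\<^sub>R ?J (interp n a t)) I"
    by (simp add: test_function_integral_deriv[OF \<phi>])
  have "has_bochner_int (time_measure T) (\<lambda>t. \<Sum>i<n. (\<phi> t * cell n i t) *\<^sub>R ((1 / h n) *\<^sub>R (?J (a (Suc i)) - ?J (a i))))
     (\<Sum>i<n. (\<integral>t. \<phi> t * cell n i t \<partial>time_measure T) *\<^sub>R ((1 / h n) *\<^sub>R (?J (a (Suc i)) - ?J (a i))))"
    by (intro time.has_bochner_int_sum time.has_bochner_int_scaleR_const i2) simp
  moreover have "(\<Sum>i<n. (\<integral>t. \<phi> t * cell n i t \<partial>time_measure T) *\<^sub>R ((1 / h n) *\<^sub>R (?J (a (Suc i)) - ?J (a i)))) = - I"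
    unfolding I_def ramp_by_parts[OF \<phi>] by (simp add: sum_negf)
  ultimately have "has_bochner_int (time_measure T) (\<lambda>t. \<phi> t *\<^sub>R slope n (\<lambda>i. ?J (a i)) t) (- I)"
    by (simp add: slope_def scaleR_sum_right)
  with 1 show "\<exists>I. has_bochner_int (time_measure T) (\<lambda>t. deriv \<phi> t *\<^sub>R ?J (interp n a t)) I \<and>
      has_bochner_int (time_measure T) (\<lambda>t. \<phi> t *\<^sub>R slope n (\<lambda>i. ?J (a i)) t) (- I)"
    by blast
qed

lemma distr_deriv_unique:
  assumes "w1 \<in> L2_space T" "w2 \<in> L2_space T" "has_distr_deriv T j u w1" "has_distr_deriv T j u w2"
  shows "L2_sq T (\<lambda>t. w1 t - w2 t) = 0"
proof -
  interpret cell: approx_kernel T "\<lambda>n. n" cell "\<lambda>n i s. \<Psi> n i s / h n" "\<lambda>n. 2 * h n" "\<lambda>n. 2 / h n" "\<lambda>n. 2 * h n" 4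
    by (rule approx_kernel_cell)
  have "has_bochner_int (time_measure T) (\<lambda>s. (\<Psi> n i s / h n) *\<^sub>R (w1 s - w2 s)) 0" if i: "i < n" for n i
  proof -
    obtain I where I: "has_bochner_int (time_measure T) (\<lambda>t. deriv (\<Psi> n i) t *\<^sub>R dual_embed j (u t)) I"
      "has_bochner_int (time_measure T) (\<lambda>t. \<Psi> n i t *\<^sub>R w1 t) (- I)"
      using assms(3) test_function_\<Psi>[OF i] unfolding has_distr_deriv_def by blast
    obtain J where J: "has_bochner_int (time_measure T) (\<lambda>t. deriv (\<Psi> n i) t *\<^sub>R dual_embed j (u t)) J"
      "has_bochner_int (time_measure T) (\<lambda>t. \<Psi> n i t *\<^sub>R w2 t) (- J)"
      using assms(4) test_function_\<Psi>[OF i] unfolding has_distr_deriv_def by blast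
    have "I = J" by (rule time.has_bochner_int_unique[OF I(1) J(1)])
    then have "has_bochner_int (time_measure T) (\<lambda>t. (1 / h n) *\<^sub>R (\<Psi> n i t *\<^sub>R w1 t - \<Psi> n i t *\<^sub>R w2 t)) ((1 / h n) *\<^sub>R (- I - - J))"
      by (intro time.has_bochner_int_bounded_linear[OF bounded_linear_scaleR_right] time.has_bochner_int_diff I(2) J(2))
    then show ?thesis using \<open>I = J\<close> by (simp add: scaleR_diff_right)
  qed
  \<comment> \<open>All integrals supplied are 0, so the approximants of \<open>w1 - w2\<close>
    vanish and the convergence is that of a constant sequence to 0.\<close>
  from cell.approx_tendsto[OF L2_space_diff[OF assms(1,2)] this]
  have "(\<lambda>n::nat. L2_sq T (\<lambda>t. w1 t - w2 t)) \<longlonglongrightarrow> 0" by (simp add: norm_minus_commute)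
  then show ?thesis by (simp add: LIMSEQ_const_iff)
qed

section \<open>Weighted means of \<open>u\<close> and convergence of their interpolants\<close>

definition avg :: "(real \<Rightarrow> 'b::{banach, second_countable_topology}) \<Rightarrow> nat \<Rightarrow> nat \<Rightarrow> 'b" where
  "avg u n i = (\<integral>s. \<rho> n i s *\<^sub>R u s \<partial>time_measure T)"

lemma \<rho>_bound: "\<bar>\<rho> n i s\<bar> \<le> \<beta>max / h n"
  using \<beta>_nonneg \<beta>_le h_pos[of n] by (simp add: \<rho>_def divide_right_mono)

lemma \<rho>_times_integrable:
  fixes u :: "real \<Rightarrow> 'b::{banach, second_countable_topology}"
  assumes "u \<in> L2_space T"
  shows "integrable (time_measure T) (\<lambda>s. \<rho> n i s *\<^sub>R u s)"
proof -
  have L2: "(\<lambda>s. \<rho> n i s *\<^sub>R u s) \<in> L2_space T"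
    by (rule L2_space_scaleR_bounded[OF \<rho>_measurable \<rho>_bound assms])
  show ?thesis
    using L2_integrable_norm[OF L2]
    by (subst (asm) integrable_norm_iff[OF time.bochner_measurable_imp_borel[OF L2_spaceD(1)[OF L2]]])
qed

lemma has_bochner_int_avg:
  assumes "u \<in> L2_space T"
  shows "has_bochner_int (time_measure T) (\<lambda>s. \<rho> n i s *\<^sub>R u s) (avg u n i)"
  unfolding time.has_bochner_int_iff_lebesgue avg_def
  by (rule has_bochner_integral_integrable[OF \<rho>_times_integrable[OF assms]])

lemma interp_avg_tendsto:
  assumes "u \<in> L2_space T"
  shows "(\<lambda>n. L2_sq T (\<lambda>t. interp n (avg u n) t - u t)) \<longlonglongrightarrow> 0"
  unfolding interp_def
  by (rule approx_kernel.approx_tendsto[OF approx_kernel_hat assms has_bochner_int_avg[OF assms]])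

lemma slope_avg_tendsto:
  assumes u: "u \<in> L2_space T" and w: "w \<in> L2_space T" and uw: "has_distr_deriv T j u w"
  shows "(\<lambda>n. L2_sq T (\<lambda>t. slope n (\<lambda>i. dual_embed j (avg u n i)) t - w t)) \<longlonglongrightarrow> 0"
  unfolding slope_def
proof (rule approx_kernel.approx_tendsto[OF approx_kernel_cell w])
  fix n i :: nat assume i: "i < n"
  let ?J = "dual_embed j"
  obtain I where I: "has_bochner_int (time_measure T) (\<lambda>t. deriv (\<Psi> n i) t *\<^sub>R ?J (u t)) I"
    "has_bochner_int (time_measure T) (\<lambda>t. \<Psi> n i t *\<^sub>R w t) (- I)"
    using uw test_function_\<Psi>[OF i] unfolding has_distr_deriv_def by blast
  \<comment> \<open>Second evaluation of the integral \<open>I\<close>: the derivative of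
    \<open>\<Psi> n i\<close> is the difference of the weights with indices \<open>i\<close> and
    \<open>Suc i\<close>. The minus sign in the distributional identity then turns this into the
    forward increment of the averages.\<close>
  have "has_bochner_int (time_measure T) (\<lambda>t. ?J (\<rho> n i t *\<^sub>R u t) - ?J (\<rho> n (Suc i) t *\<^sub>R u t)) (?J (avg u n i) - ?J (avg u n (Suc i)))"
    by (intro time.has_bochner_int_diff time.has_bochner_int_bounded_linear[OF bounded_linear_dual_embed] has_bochner_int_avg u)
  moreover have "?J (\<rho> n i t *\<^sub>R u t) - ?J (\<rho> n (Suc i) t *\<^sub>R u t) = deriv (\<Psi> n i) t *\<^sub>R ?J (u t)" for t
    using bounded_linear_dual_embed[of j] DERIV_imp_deriv[OF \<Psi>_DERIV[of n i t]]
    by (simp add: bounded_linear.linear linear_scale scaleR_diff_left)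
  ultimately have "I = ?J (avg u n i) - ?J (avg u n (Suc i))"
    using time.has_bochner_int_unique[OF I(1)] by simp
  then show "has_bochner_int (time_measure T) (\<lambda>s. (\<Psi> n i s / h n) *\<^sub>R w s) ((1 / h n) *\<^sub>R (?J (avg u n (Suc i)) - ?J (avg u n i)))"
    using time.has_bochner_int_bounded_linear[OF bounded_linear_scaleR_right[of "1 / h n"] I(2)] by simp
qed

end

section \<open>Averages over closed convex sets\<close>

text \<open>The integral of a simple function with values in \<open>C\<close> is a finite convex
  combination of points of \<open>C\<close>. Simple approximants of \<open>u\<close> are moved into
  \<open>C\<close> without spoiling their convergence, and closedness handles the limit.\<close>

lemma integral_in_closed_convex:
  fixes u :: "'a \<Rightarrow> 'b::{banach, second_countable_topology}"
  assumes N: "emeasure N (space N) = 1" and C: "closed C" "convex C"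
    and u: "integrable N u" and uC: "AE x in N. u x \<in> C"
  shows "(\<integral>x. u x \<partial>N) \<in> C"
proof -
  interpret finite_measure N by standard (simp add: N)
  have "C \<noteq> {}"
  proof
    assume "C = {}"
    then have "AE x in N. False" using uC by simp
    then show False using N by (subst (asm) AE_iff_measurable[of "space N"]) auto
  qed
  have um: "u \<in> borel_measurable N" using u by simp
  obtain s where s: "\<And>m. simple_function N (s m)" "\<And>x. x \<in> space N \<Longrightarrow> (\<lambda>m. s m x) \<longlonglongrightarrow> u x"
    "\<And>m x. x \<in> space N \<Longrightarrow> dist (s m x) 0 \<le> 2 * dist (u x) 0"
    using borel_measurable_implies_sequence_metric[OF um, of 0] by blast
  have ex: "\<exists>z. z \<in> C \<and> dist y z < infdist y C + 1 / real (Suc m)" for y and m :: nat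
  proof -
    have "infdist y C < infdist y C + 1 / real (Suc m)" by simp
    then have "(INF a\<in>C. dist y a) < infdist y C + 1 / real (Suc m)"
      using \<open>C \<noteq> {}\<close> by (simp add: infdist_def)
    then show ?thesis using \<open>C \<noteq> {}\<close> by (subst (asm) cINF_less_iff) auto
  qed
  \<comment> \<open>An almost nearest point of \<open>C\<close>: in a Banach space the distance to
    \<open>C\<close> may not be attained, so a vanishing error is allowed.\<close>
  define p where "p m y = (SOME z. z \<in> C \<and> dist y z < infdist y C + 1 / real (Suc m))" for m y
  have p: "p m y \<in> C" "dist y (p m y) < infdist y C + 1 / real (Suc m)" for m y
    using someI_ex[OF ex[of y m]] by (simp_all add: p_def)
  define v where "v m x = p m (s m x)" for m x
  \<comment> \<open>A simple function followed by any map is again simple, so \<open>p m\<close> may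
    come from an arbitrary choice.\<close>
  have v: "simple_function N (v m)" for m
    unfolding v_def by (rule simple_function_compose1[OF s(1)])
  have dist_v: "dist (v m x) (u x) \<le> 2 * dist (s m x) (u x) + 1 / real (Suc m)" if "u x \<in> C" for m x
  proof -
    have "dist (v m x) (u x) \<le> dist (s m x) (p m (s m x)) + dist (s m x) (u x)"
      unfolding v_def by (rule dist_triangle3)
    then show ?thesis
      using p(2)[of "s m x" m] infdist_le[OF that, of "s m x"] by simp
  qed
  have "(\<lambda>m. \<integral>x. v m x \<partial>N) \<longlonglongrightarrow> (\<integral>x. u x \<partial>N)"
  proof (rule integral_dominated_convergence[where w="\<lambda>x. 7 * norm (u x) + 1"])
    show "AE x in N. (\<lambda>m. v m x) \<longlonglongrightarrow> u x"
      using uC AE_space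
    proof eventually_elim
      case (elim x)
      have "(\<lambda>m. 2 * dist (s m x) (u x) + inverse (real (Suc m))) \<longlonglongrightarrow> 2 * dist (u x) (u x) + 0"
        by (intro tendsto_intros s(2) elim LIMSEQ_inverse_real_of_nat)
      then have "(\<lambda>m. 2 * dist (s m x) (u x) + 1 / real (Suc m)) \<longlonglongrightarrow> 0" by (simp add: inverse_eq_divide)
      then have "(\<lambda>m. dist (v m x) (u x)) \<longlonglongrightarrow> 0"
        by (rule Lim_null_comparison[rotated]) (use dist_v[OF elim(1)] in auto)
      then show ?case by (rule tendsto_dist_iff[THEN iffD2])
    qed
    \<comment> \<open>The approximant is within \<open>3 * norm (u x)\<close> of \<open>u x\<close>;
      this is doubled by moving it into \<open>C\<close>, with error at most 1, and the norm of
      \<open>u x\<close> itself is added.\<close>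
    show "AE x in N. norm (v m x) \<le> 7 * norm (u x) + 1" for m
      using uC AE_space
    proof eventually_elim
      case (elim x)
      have "dist (s m x) (u x) \<le> 3 * norm (u x)"
        using s(3)[OF elim(2), of m] norm_triangle_ineq4[of "s m x" "u x"] by (simp add: dist_norm)
      moreover have "norm (v m x) \<le> norm (u x) + dist (v m x) (u x)"
        using norm_triangle_sub[of "v m x" "u x"] by (simp add: dist_norm)
      moreover have "1 / real (Suc m) \<le> 1" by simp
      ultimately show ?case using dist_v[OF elim(1), of m] by linarith
    qed
    show "v m \<in> borel_measurable N" for m using v by (rule borel_measurable_simple_function)
  qed (use u in auto)
  moreover have "(\<integral>x. v m x \<partial>N) \<in> C" for m
  proof -
    have sb: "Bochner_Integration.simple_bochner_integrable N (v m)"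
      using v[of m] by (auto simp: Bochner_Integration.simple_bochner_integrable.simps)
    have sb1: "Bochner_Integration.simple_bochner_integrable N (\<lambda>_. 1::real)"
      by (auto simp: Bochner_Integration.simple_bochner_integrable.simps)
    \<comment> \<open>Integrating the constant 1 over the partition into level sets of
      \<open>v m\<close> shows that the weights of the convex combination sum to 1.\<close>
    have "(\<Sum>y\<in>v m ` space N. measure N {x \<in> space N. v m x = y} *\<^sub>R (1::real)) = (\<integral>x. 1 \<partial>N)"
      using Bochner_Integration.simple_bochner_integral_partition[OF sb1 v, of m "\<lambda>_. 1"]
        Bochner_Integration.simple_bochner_integrable_eq_integral[OF sb1] by simp
    then have 1: "(\<Sum>y\<in>v m ` space N. measure N {x \<in> space N. v m x = y}) = 1"
      using N by (simp add: measure_def)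
    have "(\<integral>x. v m x \<partial>N) = (\<Sum>y\<in>v m ` space N. measure N {x \<in> space N. v m x = y} *\<^sub>R y)"
      using Bochner_Integration.simple_bochner_integrable_eq_integral[OF sb]
      by (simp add: Bochner_Integration.simple_bochner_integral_def)
    also have "\<dots> \<in> C"
      using v[of m] 1 p(1) C(2) by (intro convex_sum) (auto simp: v_def simple_function_def)
    finally show ?thesis .
  qed
  ultimately show ?thesis by (rule closed_sequentially[OF C(1), rotated])
qed

text \<open>With weight \<open>k\<close> as density the measure has total mass 1, and points where
  \<open>k\<close> vanishes become negligible.\<close>

lemma weighted_average_in_closed_convex:
  fixes u :: "'a \<Rightarrow> 'b::{banach, second_countable_topology}"
  assumes C: "closed C" "convex C" and k: "integrable M k" "\<And>x. 0 \<le> k x" "(\<integral>x. k x \<partial>M) = (1::real)"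
    and u: "u \<in> borel_measurable M" "integrable M (\<lambda>x. k x *\<^sub>R u x)"
    and uC: "AE x in M. k x \<noteq> 0 \<longrightarrow> u x \<in> C"
  shows "(\<integral>x. k x *\<^sub>R u x \<partial>M) \<in> C"
proof -
  have km: "k \<in> borel_measurable M" using k(1) by simp
  have "(\<integral>x. u x \<partial>density M k) \<in> C"
  proof (rule integral_in_closed_convex[OF _ C])
    have "emeasure (density M k) (space (density M k)) = (\<integral>\<^sup>+x. ennreal (k x) \<partial>M)"
      using km by (subst emeasure_density) (auto intro!: nn_integral_cong)
    also have "\<dots> = 1" using nn_integral_eq_integral[OF k(1)] k(2,3) by simp
    finally show "emeasure (density M k) (space (density M k)) = 1" .
    show "integrable (density M k) u"
      using u km k(2) by (subst integrable_density) auto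
    show "AE x in density M k. u x \<in> C"
      using uC km by (subst AE_density) (auto elim!: eventually_mono)
  qed
  then show ?thesis
    using u(1) km k(2) by (subst (asm) integral_density) auto
qed

section \<open>Mosco convergence\<close>

text \<open>Does the work of a diagonal argument: the mesh depends on \<open>e\<close> and the
  admissible \<open>m\<close> on the mesh, so almost minimisers of \<open>d\<close> on
  \<open>F m\<close> are chosen instead. The hypothesis \<open>ev\<close> says that the infima tend
  to 0; nonemptiness covers the first indices.\<close>

lemma selection_tendsto_zero:
  fixes d :: "'x \<Rightarrow> real"
  assumes ne: "\<And>m. F m \<noteq> {}" and d: "\<And>x. 0 \<le> d x"
    and ev: "\<And>e. 0 < e \<Longrightarrow> \<forall>\<^sub>F m in sequentially. \<exists>x\<in>F m. d x < e"
  obtains x where "\<And>m. x m \<in> F m" "(\<lambda>m. d (x m)) \<longlonglongrightarrow> 0"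
proof -
  have bdd: "bdd_below (d ` F m)" for m by (rule bdd_belowI2[of _ 0]) (rule d)
  have ex: "\<exists>x. x \<in> F m \<and> d x < (INF y\<in>F m. d y) + 1 / real (Suc m)" for m
  proof -
    have "(INF y\<in>F m. d y) < (INF y\<in>F m. d y) + 1 / real (Suc m)" by simp
    then show ?thesis by (subst (asm) cINF_less_iff[OF ne bdd]) blast
  qed
  define x where "x m = (SOME x. x \<in> F m \<and> d x < (INF y\<in>F m. d y) + 1 / real (Suc m))" for m
  have x: "x m \<in> F m" "d (x m) < (INF y\<in>F m. d y) + 1 / real (Suc m)" for m
    using someI_ex[OF ex[of m]] by (simp_all add: x_def)
  have "(\<lambda>m. d (x m)) \<longlonglongrightarrow> 0"
  proof (rule LIMSEQ_I)
    fix e :: real assume e: "0 < e"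
    have "\<forall>\<^sub>F m in sequentially. inverse (real (Suc m)) < e / 2"
      using LIMSEQ_inverse_real_of_nat by (rule order_tendstoD) (use e in simp)
    moreover have "\<forall>\<^sub>F m in sequentially. \<exists>x\<in>F m. d x < e / 2" by (rule ev) (use e in simp)
    ultimately have "\<forall>\<^sub>F m in sequentially. norm (d (x m) - 0) < e"
    proof eventually_elim
      case (elim m)
      then obtain y where "y \<in> F m" "d y < e / 2" by blast
      then have "(INF y\<in>F m. d y) < e / 2" using cINF_lower[OF bdd, of y m] by simp
      then show ?case using x(2)[of m] elim(1) d[of "x m"] by (simp add: inverse_eq_divide)
    qed
    then show "\<exists>no. \<forall>m\<ge>no. norm (d (x m) - 0) < e" by (simp add: eventually_sequentially)
  qed
  with x(1) show ?thesis by (rule that)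
qed

text \<open>The functionals with which weak convergence is tested: averages over a set, and pairings
  with a test function or its derivative.\<close>

lemma L2_functional_integral:
  fixes f :: "'b::real_normed_vector \<Rightarrow>\<^sub>L real"
  assumes T: "0 < T" and g: "g \<in> borel_measurable (time_measure T)" "\<And>t. \<bar>g t\<bar> \<le> B"
  shows "L2_functional T (\<lambda>u. \<integral>t. g t * f (u t) \<partial>time_measure T)"
proof -
  have int: "integrable (time_measure T) (\<lambda>t. g t * f (u t))" if "u \<in> L2_space T" for u
  proof -
    have L2: "(\<lambda>t. g t *\<^sub>R f (u t)) \<in> L2_space T"
      by (rule L2_space_scaleR_bounded[OF g L2_space_bounded_linear[OF blinfun.bounded_linear_right that]])
    show ?thesis
      using L2_integrable_norm[OF L2]
      by (subst (asm) integrable_norm_iff[OF time.bochner_measurable_imp_borel[OF L2_spaceD(1)[OF L2]]]) simp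
  qed
  have B: "0 \<le> B" using g(2)[of 0] by (rule order_trans[OF abs_ge_zero])
  have bound: "\<bar>\<integral>t. g t * f (u t) \<partial>time_measure T\<bar> \<le> (B * norm f * sqrt T) * L2_norm T u" if u: "u \<in> L2_space T" for u
  proof -
    have n1: "integrable (time_measure T) (\<lambda>t. norm (u t))" by (rule L2_integrable_norm[OF u])
    have n2: "integrable (time_measure T) (\<lambda>t. (norm (u t))\<^sup>2)" by (rule L2_spaceD[OF u])
    \<comment> \<open>Cauchy-Schwarz on (0,T), obtained from Jensen's inequality with the constant
      weight \<open>1 / T\<close>.\<close>
    have "(\<integral>t. (1 / T) * norm (u t) \<partial>time_measure T)\<^sup>2 \<le> (\<integral>t. (1 / T) * (norm (u t))\<^sup>2 \<partial>time_measure T)"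
      by (rule power2_weighted_integral_le) (use T n1 n2 in \<open>auto simp: measure_time\<close>)
    then have "(\<integral>t. norm (u t) \<partial>time_measure T)\<^sup>2 \<le> T * L2_sq T u"
      using T by (simp add: power_divide power2_eq_square field_simps)
    then have "(\<integral>t. norm (u t) \<partial>time_measure T) \<le> sqrt T * L2_norm T u"
      unfolding L2_norm_def using real_le_rsqrt by (simp flip: real_sqrt_mult)
    then have "(B * norm f) * (\<integral>t. norm (u t) \<partial>time_measure T) \<le> (B * norm f) * (sqrt T * L2_norm T u)"
      using B by (intro mult_left_mono) auto
    moreover have "\<bar>\<integral>t. g t * f (u t) \<partial>time_measure T\<bar> \<le> (\<integral>t. (B * norm f) * norm (u t) \<partial>time_measure T)"
      unfolding real_norm_def[symmetric]
    proof (rule Bochner_Integration.integral_norm_bound_integral[OF int[OF u]])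
      show "integrable (time_measure T) (\<lambda>t. (B * norm f) * norm (u t))" using n1 by simp
      fix t
      have "norm (g t * f (u t)) \<le> B * (norm f * norm (u t))"
        unfolding norm_mult by (intro mult_mono norm_blinfun B) (use g(2) in auto)
      then show "norm (g t * f (u t)) \<le> (B * norm f) * norm (u t)" by (simp add: mult.assoc)
    qed
    ultimately show ?thesis
      by (simp add: mult.assoc)
  qed
  show ?thesis
    unfolding L2_functional_def
  proof (intro conjI ballI allI)
    show "(\<integral>t. g t * f (u t + v t) \<partial>time_measure T) = (\<integral>t. g t * f (u t) \<partial>time_measure T) + (\<integral>t. g t * f (v t) \<partial>time_measure T)"
      if "u \<in> L2_space T" "v \<in> L2_space T" for u v
      using int[OF that(1)] int[OF that(2)] by (simp add: blinfun.add_right distrib_left)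
    show "(\<integral>t. g t * f (c *\<^sub>R u t) \<partial>time_measure T) = c * (\<integral>t. g t * f (u t) \<partial>time_measure T)" for c u
      by (simp add: blinfun.scaleR_right mult.left_commute)
    show "\<exists>B. \<forall>u\<in>L2_space T. \<bar>\<integral>t. g t * f (u t) \<partial>time_measure T\<bar> \<le> B * L2_norm T u"
      using bound by blast
  qed
qed

section \<open>Passing to constant functions\<close>

lemma L2_norm_const: "0 < T \<Longrightarrow> L2_norm T (\<lambda>_. x) = sqrt T * norm x"
  by (simp add: L2_norm_def measure_time real_sqrt_mult)

text \<open>Restricted to constant functions, a bounded functional on L^2 is a bounded functional on
  the value space, to which the hypothesis applies.\<close>

lemma L2_weak_conv_const:
  fixes x :: "'b::real_normed_vector"
  assumes T: "0 < T" and weak: "\<And>f :: 'b \<Rightarrow>\<^sub>L real. (\<lambda>k. f (y k)) \<longlonglongrightarrow> f x"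
  shows "L2_weak_conv T (\<lambda>k _. y k) (\<lambda>_. x)"
  unfolding L2_weak_conv_def
proof (intro allI impI)
  fix \<Lambda> :: "(real \<Rightarrow> 'b) \<Rightarrow> real" assume L: "L2_functional T \<Lambda>"
  obtain B where B: "\<And>u. u \<in> L2_space T \<Longrightarrow> \<bar>\<Lambda> u\<bar> \<le> B * L2_norm T u"
    using L unfolding L2_functional_def by blast
  have "bounded_linear (\<lambda>v. \<Lambda> (\<lambda>_. v))"
  proof (rule bounded_linear_intro[where K="B * sqrt T"])
    show "\<Lambda> (\<lambda>_. v + w) = \<Lambda> (\<lambda>_. v) + \<Lambda> (\<lambda>_. w)" for v w
      by (rule L[unfolded L2_functional_def, THEN conjunct1, rule_format, OF L2_space_const L2_space_const])
    show "\<Lambda> (\<lambda>_. c *\<^sub>R v) = c *\<^sub>R \<Lambda> (\<lambda>_. v)" for c v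
      unfolding real_scaleR_def
      by (rule L[unfolded L2_functional_def, THEN conjunct2, THEN conjunct1, rule_format, OF L2_space_const])
    show "norm (\<Lambda> (\<lambda>_. v)) \<le> norm v * (B * sqrt T)" for v
      using B[OF L2_space_const[of v]] L2_norm_const[OF T, of v] by (simp add: mult_ac)
  qed
  then show "(\<lambda>k. \<Lambda> (\<lambda>_. y k)) \<longlonglongrightarrow> \<Lambda> (\<lambda>_. x)"
    using weak[of "Blinfun (\<lambda>v. \<Lambda> (\<lambda>_. v))"] by (simp add: bounded_linear_Blinfun_apply)
qed

lemma AE_time_nonempty:
  assumes T: "0 < T" and ae: "AE t in time_measure T. P t"
  obtains t where "P t"
proof (rule ccontr)
  assume "\<not> thesis"
  then have "AE t in time_measure T. False" using ae that by (auto elim: eventually_mono)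
  then have "emeasure (time_measure T) {0<..<T} = 0"
    by (subst (asm) AE_iff_measurable[of "{0<..<T}"]) auto
  then show False using measure_time[of T] T by (simp add: measure_def)
qed

text \<open>A function cannot exceed its mean almost everywhere. The property \<open>P\<close> is
  carried along so that the chosen time also satisfies the constraint.\<close>

lemma exists_le_mean:
  assumes T: "0 < T" and g: "integrable (time_measure T) g" and ae: "AE t in time_measure T. P t"
  obtains t where "P t" "g t \<le> (\<integral>t. g t \<partial>time_measure T) / T"
proof (rule ccontr)
  let ?c = "(\<integral>t. g t \<partial>time_measure T) / T"
  assume "\<not> thesis"
  then have gt: "AE t in time_measure T. ?c < g t"
    using ae that by (auto elim!: eventually_mono simp: not_le[symmetric])
  have "(\<integral>t. g t - ?c \<partial>time_measure T) = 0"
    using g T by (simp add: measure_time)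
  moreover have "integrable (time_measure T) (\<lambda>t. g t - ?c)" using g by simp
  moreover have "AE t in time_measure T. 0 \<le> g t - ?c" using gt by eventually_elim simp
  ultimately have "AE t in time_measure T. g t - ?c = 0"
    using integral_nonneg_eq_0_iff_AE[of "time_measure T" "\<lambda>t. g t - ?c"] by blast
  with gt have "AE t in time_measure T. False" by eventually_elim simp
  then show False by (rule AE_time_nonempty[OF T])
qed

lemma L2_values_in_const: "x \<in> C \<Longrightarrow> (\<lambda>_. x) \<in> L2_values_in T C"
  by (simp add: L2_values_in_def L2_space_const)

lemma distr_derivD:
  assumes "u \<in> W_space T j"
  shows "distr_deriv T j u \<in> L2_space T" "has_distr_deriv T j u (distr_deriv T j u)" "u \<in> L2_space T"
proof -
  have "\<exists>w. w \<in> L2_space T \<and> has_distr_deriv T j u w" using assms by (auto simp: W_space_def)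
  from someI_ex[OF this]
  show "distr_deriv T j u \<in> L2_space T" "has_distr_deriv T j u (distr_deriv T j u)"
    unfolding distr_deriv_def by auto
  show "u \<in> L2_space T" using assms by (simp add: W_space_def)
qed

lemma W_spaceI: "u \<in> L2_space T \<Longrightarrow> w \<in> L2_space T \<Longrightarrow> has_distr_deriv T j u w \<Longrightarrow> u \<in> W_space T j"
  by (auto simp: W_space_def)

lemma L2_norm_nonneg: "0 \<le> L2_norm T u"
  by (simp add: L2_norm_def L2_sq_nonneg)

lemma L2_norm_le_W_norm: "L2_norm T u \<le> W_norm T j u"
  unfolding L2_norm_def W_norm_def by (simp add: L2_sq_nonneg)

lemma strong_recovery_imp_pointwise:
  assumes T: "0 < T" and un: "\<And>n. un n \<in> L2_values_in T (Kn n)"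
    and lim: "(\<lambda>n. L2_norm T (\<lambda>t. un n t - x)) \<longlonglongrightarrow> 0"
  obtains y where "\<And>n. y n \<in> Kn n" "y \<longlonglongrightarrow> x"
proof -
  have ex: "\<exists>y. y \<in> Kn n \<and> norm (y - x) \<le> L2_norm T (\<lambda>t. un n t - x) / sqrt T" for n
  proof -
    have L2: "(\<lambda>t. un n t - x) \<in> L2_space T"
      using un[of n] by (intro L2_space_diff L2_space_const) (simp add: L2_values_in_def)
    obtain t where t: "un n t \<in> Kn n" "(norm (un n t - x))\<^sup>2 \<le> L2_sq T (\<lambda>t. un n t - x) / T"
      using exists_le_mean[OF T L2_spaceD(2)[OF L2], of "\<lambda>t. un n t \<in> Kn n"] un[of n]
      by (auto simp: L2_values_in_def)
    from real_le_rsqrt[OF t(2)] t(1) show ?thesis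
      by (auto simp: L2_norm_def real_sqrt_divide)
  qed
  define y where "y n = (SOME y. y \<in> Kn n \<and> norm (y - x) \<le> L2_norm T (\<lambda>t. un n t - x) / sqrt T)" for n
  have y: "y n \<in> Kn n" "norm (y n - x) \<le> L2_norm T (\<lambda>t. un n t - x) / sqrt T" for n
    using someI_ex[OF ex[of n]] by (simp_all add: y_def)
  have "(\<lambda>n. L2_norm T (\<lambda>t. un n t - x) / sqrt T) \<longlonglongrightarrow> 0 / sqrt T"
    using T by (intro tendsto_intros lim) auto
  then have "(\<lambda>n. y n - x) \<longlonglongrightarrow> 0"
    by (intro Lim_null_comparison[OF always_eventually[OF allI[OF y(2)]]]) simp
  then have "y \<longlonglongrightarrow> x" by (simp add: LIM_zero_iff)
  with y(1) show ?thesis by (rule that)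
qed

lemma mosco_L2_imp_mosco:
  assumes T: "0 < T" and M: "mosco_conv_L2 T Kn K"
  shows "mosco_conv Kn K"
  unfolding mosco_conv_def
proof (intro conjI ballI allI impI)
  fix x assume "x \<in> K"
  then obtain un where un: "\<And>n. un n \<in> L2_values_in T (Kn n)" "(\<lambda>n. L2_norm T (\<lambda>t. un n t - x)) \<longlonglongrightarrow> 0"
    using M[unfolded mosco_conv_L2_def, THEN conjunct1, rule_format, OF L2_values_in_const[of x K T]] by blast
  obtain y where "\<And>n. y n \<in> Kn n" "y \<longlonglongrightarrow> x"
    by (rule strong_recovery_imp_pointwise[OF T un], rule that)
  then show "\<exists>un. (\<forall>n. un n \<in> Kn n) \<and> un \<longlonglongrightarrow> x" by blast
next
  fix nk :: "nat \<Rightarrow> nat" and y x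
  assume nk: "filterlim nk at_top sequentially" and y: "\<forall>k. y k \<in> Kn (nk k)"
    and weak: "\<forall>f :: 'a \<Rightarrow>\<^sub>L real. (\<lambda>k. f (y k)) \<longlonglongrightarrow> f x"
  have "(\<lambda>_. x) \<in> L2_values_in T K"
    using M[unfolded mosco_conv_L2_def, THEN conjunct2, rule_format, OF L2_space_const nk, of "\<lambda>k _. y k" x]
      y weak L2_weak_conv_const[OF T, of y x] by (auto intro: L2_values_in_const)
  then have "AE t in time_measure T. x \<in> K" by (simp add: L2_values_in_def)
  then show "x \<in> K" using AE_time_nonempty[OF T] by blast
qed

lemma mosco_recovery_finite:
  assumes M: "\<And>x. x \<in> K \<Longrightarrow> \<exists>un. (\<forall>n. un n \<in> Kn n) \<and> un \<longlonglongrightarrow> x" and a: "\<And>i. a i \<in> K"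
  obtains a' where "\<And>m i. a' m i \<in> Kn m" "\<And>i. (\<lambda>m. a' m i) \<longlonglongrightarrow> a i"
proof -
  have "\<forall>i. \<exists>un. (\<forall>n. un n \<in> Kn n) \<and> un \<longlonglongrightarrow> a i" using M a by blast
  from choice[OF this] obtain f where "\<forall>i. (\<forall>n. f i n \<in> Kn n) \<and> f i \<longlonglongrightarrow> a i" ..
  then show ?thesis by (intro that[of "\<lambda>m i. f i m"]) auto
qed

section \<open>Condition on constants in W, and recovery sequences\<close>

context mesh
begin

text \<open>\<open>distr_deriv\<close> is an arbitrary choice; by uniqueness almost everywhere,
  \<open>W_norm\<close> can be computed from any derivative at hand.\<close>

lemma L2_sq_distr_deriv:
  assumes "w \<in> L2_space T" "has_distr_deriv T j u w" "u \<in> L2_space T"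
  shows "L2_sq T (distr_deriv T j u) = L2_sq T w"
proof -
  note d = distr_derivD[OF W_spaceI[OF assms(3,1,2)]]
  have "AE t in time_measure T. distr_deriv T j u t - w t = 0"
    by (rule L2_sq_AE_zero[OF L2_space_diff[OF d(1) assms(1)] distr_deriv_unique[OF d(1) assms(1) d(2) assms(2)]])
  then have "AE t in time_measure T. (norm (distr_deriv T j u t))\<^sup>2 = (norm (w t))\<^sup>2"
    by eventually_elim simp
  then show ?thesis
    using L2_spaceD(2)[OF d(1)] L2_spaceD(2)[OF assms(1)] by (intro integral_cong_AE) auto
qed

text \<open>A constant is the interpolant on the mesh with one cell, which has no slopes.\<close>

lemma const_distr_deriv: "has_distr_deriv T j (\<lambda>_. x) (\<lambda>_. 0)"
proof -
  have "interp 0 (\<lambda>_. x) = (\<lambda>_. x)" by (rule ext) (simp add: interp_eq)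
  moreover have "slope 0 (\<lambda>_. dual_embed j x) = (\<lambda>_. 0)" by (rule ext) (simp add: slope_def)
  ultimately show ?thesis using has_distr_deriv_interp[of j 0 "\<lambda>_. x"] by simp
qed

lemma const_W_space: "(\<lambda>_. x) \<in> W_space T j"
  by (rule W_spaceI[OF L2_space_const L2_space_const const_distr_deriv])

lemma mosco_W_imp_mosco:
  fixes j :: "'v::{banach, second_countable_topology} \<Rightarrow>\<^sub>L 'h::real_inner"
  assumes M: "mosco_conv_W T j Kn K"
  shows "mosco_conv Kn K"
  unfolding mosco_conv_def
proof (intro conjI ballI allI impI)
  fix x assume "x \<in> K"
  then obtain un where un: "\<And>n. un n \<in> W_space T j \<inter> L2_values_in T (Kn n)" "(\<lambda>n. W_norm T j (\<lambda>t. un n t - x)) \<longlonglongrightarrow> 0"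
    using M[unfolded mosco_conv_W_def, THEN conjunct1, rule_format, of "\<lambda>_. x"] const_W_space L2_values_in_const[of x K T] by blast
  have lim: "(\<lambda>n. L2_norm T (\<lambda>t. un n t - x)) \<longlonglongrightarrow> 0"
    by (rule tendsto_sandwich[OF _ _ tendsto_const un(2)])
       (simp_all add: L2_norm_le_W_norm L2_norm_nonneg)
  have un': "un n \<in> L2_values_in T (Kn n)" for n using un(1)[of n] by blast
  obtain y where "\<And>n. y n \<in> Kn n" "y \<longlonglongrightarrow> x"
    by (rule strong_recovery_imp_pointwise[OF T un' lim], rule that)
  then show "\<exists>un. (\<forall>n. un n \<in> Kn n) \<and> un \<longlonglongrightarrow> x" by blast
next
  fix nk :: "nat \<Rightarrow> nat" and y x
  assume nk: "filterlim nk at_top sequentially" and y: "\<forall>k. y k \<in> Kn (nk k)"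
    and weak: "\<forall>f :: 'v \<Rightarrow>\<^sub>L real. (\<lambda>k. f (y k)) \<longlonglongrightarrow> f x"
  \<comment> \<open>The derivative selected for a constant is only almost everywhere 0, but
    functionals bounded by the seminorm vanish on it.\<close>
  have deriv: "L2_weak_conv T (\<lambda>k. distr_deriv T j (\<lambda>_. y k)) (\<lambda>_. 0)"
    unfolding L2_weak_conv_def
  proof (intro allI impI)
    fix \<Lambda> :: "(real \<Rightarrow> 'v \<Rightarrow>\<^sub>L real) \<Rightarrow> real" assume L: "L2_functional T \<Lambda>"
    obtain B where B: "\<And>u. u \<in> L2_space T \<Longrightarrow> \<bar>\<Lambda> u\<bar> \<le> B * L2_norm T u"
      using L unfolding L2_functional_def by blast
    have z: "\<Lambda> w = 0" if "w \<in> L2_space T" "L2_sq T w = 0" for w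
      using B[OF that(1)] that(2) by (simp add: L2_norm_def)
    have "\<Lambda> (distr_deriv T j (\<lambda>_. y k)) = 0" for k
      by (rule z[OF distr_derivD(1)[OF const_W_space]])
         (simp add: L2_sq_distr_deriv[OF L2_space_const const_distr_deriv L2_space_const])
    moreover have "\<Lambda> (\<lambda>_. 0) = 0" by (rule z[OF L2_space_const]) simp
    ultimately show "(\<lambda>k. \<Lambda> (distr_deriv T j (\<lambda>_. y k))) \<longlonglongrightarrow> \<Lambda> (\<lambda>_. 0)" by simp
  qed
  have "(\<lambda>_. x) \<in> L2_values_in T K"
    using M[unfolded mosco_conv_W_def, THEN conjunct2, rule_format, OF L2_space_const L2_space_const nk, of "\<lambda>k _. y k" x 0]
      y weak L2_weak_conv_const[OF T, of y x] deriv const_W_space by (auto intro: L2_values_in_const)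
  then have "AE t in time_measure T. x \<in> K" by (simp add: L2_values_in_def)
  then show "x \<in> K" using AE_time_nonempty[OF T] by blast
qed

lemma avg_in:
  fixes u :: "real \<Rightarrow> 'v::{banach, second_countable_topology}"
  assumes "closed K" "convex K" "u \<in> L2_values_in T K" "i \<le> n"
  shows "avg u n i \<in> K"
  unfolding avg_def
proof (rule weighted_average_in_closed_convex[OF assms(1,2)])
  have u: "u \<in> L2_space T" and ae: "AE t in time_measure T. u t \<in> K"
    using assms(3) by (auto simp: L2_values_in_def)
  show "u \<in> borel_measurable (time_measure T)" by (rule time.bochner_measurable_imp_borel[OF L2_spaceD(1)[OF u]])
  show "integrable (time_measure T) (\<lambda>s. \<rho> n i s *\<^sub>R u s)" by (rule \<rho>_times_integrable[OF u])
  show "AE s in time_measure T. \<rho> n i s \<noteq> 0 \<longrightarrow> u s \<in> K" using ae by eventually_elim simp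
qed (use \<rho>_integral[OF assms(4)] \<rho>_nonneg in auto)

lemma recovery_nodes:
  fixes u :: "real \<Rightarrow> 'v::{banach, second_countable_topology}"
  assumes K: "closed K" "convex K" and u: "u \<in> L2_values_in T K"
    and M: "\<And>x. x \<in> K \<Longrightarrow> \<exists>un. (\<forall>n. un n \<in> Kn n) \<and> un \<longlonglongrightarrow> x"
  obtains a where "\<And>m i. a m i \<in> Kn m" "\<And>i. i \<le> n \<Longrightarrow> (\<lambda>m. a m i) \<longlonglongrightarrow> avg u n i"
proof -
  \<comment> \<open>Membership of \<open>avg u n i\<close> in \<open>K\<close> holds for
    \<open>i <= n\<close> only, since later weights lie outside (0,T); \<open>min i n\<close>
    extends the nodes to all indices.\<close>
  obtain a where a: "\<And>m i. a m i \<in> Kn m" "\<And>i. (\<lambda>m. a m i) \<longlonglongrightarrow> avg u n (min i n)"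
  proof (rule mosco_recovery_finite[where K=K and Kn=Kn and a="\<lambda>i. avg u n (min i n)"])
    show "\<exists>un. (\<forall>n. un n \<in> Kn n) \<and> un \<longlonglongrightarrow> x" if "x \<in> K" for x by (rule M[OF that])
    show "avg u n (min i n) \<in> K" for i by (rule avg_in[OF K u]) simp
  qed (rule that)
  show ?thesis
  proof (rule that[OF a(1)])
    show "(\<lambda>m. a m i) \<longlonglongrightarrow> avg u n i" if "i \<le> n" for i using a(2)[of i] that by (simp add: min_absorb1)
  qed
qed

lemma interp_values_in:
  assumes "convex C" "\<And>i. a i \<in> C"
  shows "interp n a \<in> L2_values_in T C"
  by (simp add: L2_values_in_def interp_L2 interp_in_convex assms)

lemma mosco_imp_L2_recovery:
  fixes u :: "real \<Rightarrow> 'v::{banach, second_countable_topology}"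
  assumes K: "closed K" "convex K" "\<And>n. convex (Kn n)" and u: "u \<in> L2_values_in T K"
    and M: "\<And>x. x \<in> K \<Longrightarrow> \<exists>un. (\<forall>n. un n \<in> Kn n) \<and> un \<longlonglongrightarrow> x"
  obtains un where "\<And>n. un n \<in> L2_values_in T (Kn n)" "(\<lambda>n. L2_norm T (\<lambda>t. un n t - u t)) \<longlonglongrightarrow> 0"
proof -
  have uL: "u \<in> L2_space T" and ae: "AE t in time_measure T. u t \<in> K"
    using u by (auto simp: L2_values_in_def)
  obtain un where un: "\<And>m. un m \<in> L2_values_in T (Kn m)" "(\<lambda>m. L2_sq T (\<lambda>t. un m t - u t)) \<longlonglongrightarrow> 0"
  proof (rule selection_tendsto_zero[where F="\<lambda>m. L2_values_in T (Kn m)" and d="\<lambda>v. L2_sq T (\<lambda>t. v t - u t)"])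
    \<comment> \<open>\<open>u\<close> attains some value in \<open>K\<close>; a recovery sequence
      of it provides a constant function with values in each \<open>Kn m\<close>.\<close>
    obtain t where "u t \<in> K" using AE_time_nonempty[OF T ae] by blast
    then show "L2_values_in T (Kn m) \<noteq> {}" for m using M L2_values_in_const by blast
    show "0 \<le> L2_sq T (\<lambda>t. v t - u t)" for v by (rule L2_sq_nonneg)
    fix e :: real assume e: "0 < e"
    have "\<forall>\<^sub>F n in sequentially. L2_sq T (\<lambda>t. interp n (avg u n) t - u t) < e / 4"
      using interp_avg_tendsto[OF uL] by (rule order_tendstoD) (use e in simp)
    \<comment> \<open>The mesh is fixed before \<open>m\<close> grows. Two errors below
      \<open>e / 4\<close>, each doubled by \<open>L2_sq_diff_le\<close>, stay below
      \<open>e\<close>.\<close>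
    then obtain n where n: "L2_sq T (\<lambda>t. interp n (avg u n) t - u t) < e / 4"
      by (auto simp: eventually_sequentially)
    obtain a where a: "\<And>m i. a m i \<in> Kn m" "\<And>i. i \<le> n \<Longrightarrow> (\<lambda>m. a m i) \<longlonglongrightarrow> avg u n i"
      by (rule recovery_nodes[OF K(1,2) u M, of n], assumption, rule that)
    have "\<forall>\<^sub>F m in sequentially. L2_sq T (\<lambda>t. interp n (a m) t - interp n (avg u n) t) < e / 4"
      using interp_perturb[OF a(2)] by (rule order_tendstoD) (use e in auto)
    then show "\<forall>\<^sub>F m in sequentially. \<exists>v\<in>L2_values_in T (Kn m). L2_sq T (\<lambda>t. v t - u t) < e"
    proof eventually_elim
      case (elim m)
      have "L2_sq T (\<lambda>t. interp n (a m) t - u t) < e"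
        using L2_sq_diff_le[OF interp_L2[of n "a m"] interp_L2[of n "avg u n"] uL] elim n by simp
      moreover have "interp n (a m) \<in> L2_values_in T (Kn m)"
        by (rule interp_values_in[OF K(3)]) (rule a(1))
      ultimately show ?case by blast
    qed
  qed (rule that)
  have "(\<lambda>n. L2_norm T (\<lambda>t. un n t - u t)) \<longlonglongrightarrow> 0"
    using tendsto_real_sqrt[OF un(2)] by (simp add: L2_norm_def)
  with un(1) show ?thesis by (rule that)
qed

lemma mosco_imp_W_recovery:
  fixes u :: "real \<Rightarrow> 'v::{banach, second_countable_topology}" and j :: "'v \<Rightarrow>\<^sub>L 'h::real_inner"
  assumes K: "closed K" "convex K" "\<And>n. convex (Kn n)" and u: "u \<in> L2_values_in T K" "u \<in> W_space T j"
    and M: "\<And>x. x \<in> K \<Longrightarrow> \<exists>un. (\<forall>n. un n \<in> Kn n) \<and> un \<longlonglongrightarrow> x"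
  obtains un where "\<And>n. un n \<in> W_space T j \<inter> L2_values_in T (Kn n)" "(\<lambda>n. W_norm T j (\<lambda>t. un n t - u t)) \<longlonglongrightarrow> 0"
proof -
  have uL: "u \<in> L2_space T" and ae: "AE t in time_measure T. u t \<in> K"
    using u by (auto simp: L2_values_in_def)
  define w where "w = distr_deriv T j u"
  have w: "w \<in> L2_space T" "has_distr_deriv T j u w"
    unfolding w_def by (rule distr_derivD[OF u(2)])+
  \<comment> \<open>The squared W-norm of the difference, so that the L^2 estimates can be
    added.\<close>
  define d where "d v = L2_sq T (\<lambda>t. v t - u t) + L2_sq T (distr_deriv T j (\<lambda>t. v t - u t))" for v
  have W_norm_d: "W_norm T j (\<lambda>t. v t - u t) = sqrt (d v)" for v
    by (simp add: W_norm_def d_def)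
  obtain un where un: "\<And>m. un m \<in> W_space T j \<inter> L2_values_in T (Kn m)" "(\<lambda>m. d (un m)) \<longlonglongrightarrow> 0"
  proof (rule selection_tendsto_zero[where F="\<lambda>m. W_space T j \<inter> L2_values_in T (Kn m)" and d=d])
    obtain t where "u t \<in> K" using AE_time_nonempty[OF T ae] by blast
    then show "W_space T j \<inter> L2_values_in T (Kn m) \<noteq> {}" for m
      using M L2_values_in_const const_W_space by blast
    show "0 \<le> d v" for v unfolding d_def by (intro add_nonneg_nonneg L2_sq_nonneg)
    fix e :: real assume e: "0 < e"
    let ?J = "dual_embed j"
    have "\<forall>\<^sub>F n in sequentially. L2_sq T (\<lambda>t. interp n (avg u n) t - u t) < e / 8"
      using interp_avg_tendsto[OF uL] by (rule order_tendstoD) (use e in simp)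
    moreover have "\<forall>\<^sub>F n in sequentially. L2_sq T (\<lambda>t. slope n (\<lambda>i. ?J (avg u n i)) t - w t) < e / 8"
      using slope_avg_tendsto[OF uL w] by (rule order_tendstoD) (use e in simp)
    ultimately have "\<forall>\<^sub>F n in sequentially. L2_sq T (\<lambda>t. interp n (avg u n) t - u t) < e / 8 \<and>
      L2_sq T (\<lambda>t. slope n (\<lambda>i. ?J (avg u n i)) t - w t) < e / 8"
      by (rule eventually_conj)
    \<comment> \<open>One mesh serves values and derivatives. The four errors, each doubled by
      \<open>L2_sq_diff_le\<close>, explain the bound \<open>e / 8\<close>.\<close>
    then obtain n where n: "L2_sq T (\<lambda>t. interp n (avg u n) t - u t) < e / 8"
      "L2_sq T (\<lambda>t. slope n (\<lambda>i. ?J (avg u n i)) t - w t) < e / 8"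
      by (auto simp: eventually_sequentially)
    obtain a where a: "\<And>m i. a m i \<in> Kn m" "\<And>i. i \<le> n \<Longrightarrow> (\<lambda>m. a m i) \<longlonglongrightarrow> avg u n i"
      by (rule recovery_nodes[OF K(1,2) u(1) M, of n], assumption, rule that)
    have Ja: "(\<lambda>m. ?J (a m i)) \<longlonglongrightarrow> ?J (avg u n i)" if "i \<le> n" for i
      by (rule bounded_linear.tendsto[OF bounded_linear_dual_embed a(2)[OF that]])
    have "\<forall>\<^sub>F m in sequentially. L2_sq T (\<lambda>t. interp n (a m) t - interp n (avg u n) t) < e / 8"
      using interp_perturb[OF a(2)] by (rule order_tendstoD) (use e in auto)
    moreover have "\<forall>\<^sub>F m in sequentially. L2_sq T (\<lambda>t. slope n (\<lambda>i. ?J (a m i)) t - slope n (\<lambda>i. ?J (avg u n i)) t) < e / 8"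
      using slope_perturb[OF Ja] by (rule order_tendstoD) (use e in auto)
    ultimately show "\<forall>\<^sub>F m in sequentially. \<exists>v\<in>W_space T j \<inter> L2_values_in T (Kn m). d v < e"
    proof eventually_elim
      case (elim m)
      let ?v = "interp n (a m)" and ?s = "slope n (\<lambda>i. ?J (a m i))"
      have W: "?v \<in> W_space T j" by (rule W_spaceI[OF interp_L2 slope_L2 has_distr_deriv_interp])
      \<comment> \<open>The representative hidden in \<open>d\<close> is exchanged for the explicit
        derivative of the difference.\<close>
      have "L2_sq T (distr_deriv T j (\<lambda>t. ?v t - u t)) = L2_sq T (\<lambda>t. ?s t - w t)"
        by (rule L2_sq_distr_deriv[OF L2_space_diff[OF slope_L2 w(1)]
              has_distr_deriv_diff[OF has_distr_deriv_interp w(2)] L2_space_diff[OF interp_L2 uL]])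
      then have "d ?v < e"
        using L2_sq_diff_le[OF interp_L2[of n "a m"] interp_L2[of n "avg u n"] uL]
          L2_sq_diff_le[OF slope_L2[of n "\<lambda>i. ?J (a m i)"] slope_L2[of n "\<lambda>i. ?J (avg u n i)"] w(1)]
          elim n by (simp add: d_def)
      moreover have "?v \<in> L2_values_in T (Kn m)"
        by (rule interp_values_in[OF K(3)]) (rule a(1))
      ultimately show ?case using W by blast
    qed
  qed (rule that)
  have "(\<lambda>n. W_norm T j (\<lambda>t. un n t - u t)) \<longlonglongrightarrow> 0"
    unfolding W_norm_d using tendsto_real_sqrt[OF un(2)] by simp
  with un(1) show ?thesis by (rule that)
qed

end

section \<open>Weak limits: the constraint and the derivative\<close>

lemma mosco_imp_L2_closed:
  fixes K :: "'v::{banach, second_countable_topology} set"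
  assumes T: "0 < T" and K: "closed K" "\<And>n. closed (Kn n)" "\<And>n. convex (Kn n)"
    and M: "mosco_conv Kn K" and nk: "filterlim nk at_top sequentially"
    and uk: "\<And>k. uk k \<in> L2_values_in T (Kn (nk k))" and u: "u \<in> L2_space T" and weak: "L2_weak_conv T uk u"
  shows "u \<in> L2_values_in T K"
proof -
  have um: "u \<in> borel_measurable (time_measure T)"
    by (rule time.bochner_measurable_imp_borel[OF L2_spaceD(1)[OF u]])
  \<comment> \<open>It is the closed ball that has to miss \<open>K\<close>: an average of values in
    the open ball is only shown to lie in the closed one.\<close>
  have ball: "AE t in time_measure T. u t \<notin> ball x r" if disj: "cball x r \<inter> K = {}" for x r
  proof (rule ccontr)
    assume notAE: "\<not> (AE t in time_measure T. u t \<notin> ball x r)"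
    define A where "A = u -` ball x r \<inter> {0<..<T}"
    have A: "A \<in> sets (time_measure T)"
      using measurable_sets[OF um, of "ball x r"] by (simp add: A_def)
    define \<mu> where "\<mu> = measure (time_measure T) A"
    have "0 < \<mu>"
    proof (rule ccontr)
      assume "\<not> 0 < \<mu>"
      then have "emeasure (time_measure T) A = 0"
        using measure_nonneg[of "time_measure T" A] by (simp add: \<mu>_def time.emeasure_eq_measure not_less)
      then have "AE t in time_measure T. t \<notin> A" using A by (intro AE_not_in null_setsI)
      then have "AE t in time_measure T. u t \<notin> ball x r"
        using AE_time_in by eventually_elim (auto simp: A_def)
      then show False using notAE by simp
    qed
    \<comment> \<open>Bounded and of integral 1: integrating against \<open>g\<close> averages over
      \<open>A\<close>, and composing with a functional on V gives a functional covered by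
      \<open>L2_functional_integral\<close>.\<close>
    define g where "g t = indicat_real A t / \<mu>" for t
    have g: "g \<in> borel_measurable (time_measure T)" "\<And>t. 0 \<le> g t" "\<And>t. \<bar>g t\<bar> \<le> 1 / \<mu>"
      using A \<open>0 < \<mu>\<close> by (auto simp: g_def[abs_def] indicator_def)
    have gi: "integrable (time_measure T) g" by (rule bounded_time_integrable[OF g(1,3)])
    have "A \<inter> {0<..<T} = A" by (auto simp: A_def)
    then have g1: "(\<integral>t. g t \<partial>time_measure T) = 1"
      using \<open>0 < \<mu>\<close> A by (simp add: g_def[abs_def] \<mu>_def)
    have int: "integrable (time_measure T) (\<lambda>t. g t *\<^sub>R v t)" if "v \<in> L2_space T" for v :: "real \<Rightarrow> 'v"
    proof -
      have L2: "(\<lambda>t. g t *\<^sub>R v t) \<in> L2_space T" by (rule L2_space_scaleR_bounded[OF g(1,3) that])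
      show ?thesis
        using L2_integrable_norm[OF L2]
        by (subst (asm) integrable_norm_iff[OF time.bochner_measurable_imp_borel[OF L2_spaceD(1)[OF L2]]])
    qed
    define a where "a v = (\<integral>t. g t *\<^sub>R v t \<partial>time_measure T)" for v :: "real \<Rightarrow> 'v"
    have aC: "a v \<in> C" if "closed C" "convex C" "v \<in> L2_space T" "AE t in time_measure T. g t \<noteq> 0 \<longrightarrow> v t \<in> C" for C v
      unfolding a_def
      by (rule weighted_average_in_closed_convex[OF that(1,2) gi g(2) g1
            time.bochner_measurable_imp_borel[OF L2_spaceD(1)[OF that(3)]] int[OF that(3)] that(4)])
    have uk_L2: "uk k \<in> L2_space T" and uk_ae: "AE t in time_measure T. uk k t \<in> Kn (nk k)" for k
      using uk[of k] by (auto simp: L2_values_in_def)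
    have "a (uk k) \<in> Kn (nk k)" for k
      by (rule aC[OF K(2,3) uk_L2]) (use uk_ae[of k] in \<open>auto elim: eventually_mono\<close>)
    moreover have "(\<lambda>k. f (a (uk k))) \<longlonglongrightarrow> f (a u)" for f :: "'v \<Rightarrow>\<^sub>L real"
    proof -
      have fa: "f (a v) = (\<integral>t. g t * f (v t) \<partial>time_measure T)" if "v \<in> L2_space T" for v
        unfolding a_def
        by (subst integral_bounded_linear[OF blinfun.bounded_linear_right int[OF that], symmetric])
           (simp add: blinfun.scaleR_right)
      show ?thesis
        using weak[unfolded L2_weak_conv_def, rule_format, OF L2_functional_integral[OF T g(1,3), of f]]
        by (simp add: fa[OF u] fa[OF uk_L2])
    qed
    ultimately have "a u \<in> K"
      by (rule M[unfolded mosco_conv_def, THEN conjunct2, rule_format, OF nk])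
    moreover have "a u \<in> cball x r"
    proof (rule aC[OF closed_cball convex_cball u])
      show "AE t in time_measure T. g t \<noteq> 0 \<longrightarrow> u t \<in> cball x r"
        by (rule AE_I2) (auto simp: g_def A_def indicator_def split: if_splits)
    qed
    ultimately show False using disj by blast
  qed
  have "\<exists>r>0. cball x r \<subseteq> - K" if "x \<in> - K" for x
    using K(1) that open_contains_cball[of "- K"] by auto
  then obtain r where r: "\<And>x. x \<in> - K \<Longrightarrow> 0 < r x \<and> cball x (r x) \<subseteq> - K" by metis
  define F where "F = (\<lambda>x. ball x (r x)) ` (- K)"
  \<comment> \<open>Separability of V: countably many balls already cover the complement of
    \<open>K\<close>, so the exceptional null sets can be united.\<close>
  obtain F' where F': "F' \<subseteq> F" "countable F'" "\<Union>F' = \<Union>F"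
    by (rule Lindelof[of F]) (auto simp: F_def)
  have "AE t in time_measure T. \<forall>B\<in>F'. u t \<notin> B"
    unfolding AE_ball_countable[OF F'(2)]
  proof
    fix B assume "B \<in> F'"
    then obtain x where x: "x \<in> - K" "B = ball x (r x)" using F'(1) by (auto simp: F_def)
    then show "AE t in time_measure T. u t \<notin> B" using ball[of x "r x"] r[OF x(1)] by auto
  qed
  then have "AE t in time_measure T. u t \<in> K"
  proof eventually_elim
    case (elim t)
    show ?case
    proof (rule ccontr)
      assume "u t \<notin> K"
      then have "u t \<in> \<Union>F" using r[of "u t"] by (auto simp: F_def intro!: bexI[of _ "u t"])
      then show False using elim F'(3) by blast
    qed
  qed
  then show ?thesis using u by (simp add: L2_values_in_def)
qed

text \<open>For fixed \<open>\<phi>\<close> and fixed \<open>x\<close> in V, both sides of the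
  identity evaluated at \<open>x\<close> are L^2 functionals, of \<open>uk k\<close> and of its
  derivative; the identity therefore passes to the weak limits.\<close>

lemma weak_limit_distr_deriv:
  fixes u :: "real \<Rightarrow> 'v::{banach, second_countable_topology}" and j :: "'v \<Rightarrow>\<^sub>L 'h::real_inner"
  assumes T: "0 < T" and uk: "\<And>k. uk k \<in> W_space T j" and u: "u \<in> L2_space T" and w: "w \<in> L2_space T"
    and weak: "L2_weak_conv T uk u" "L2_weak_conv T (\<lambda>k. distr_deriv T j (uk k)) w"
  shows "has_distr_deriv T j u w"
  unfolding has_distr_deriv_def
proof (intro allI impI)
  fix \<phi> assume \<phi>: "test_function T \<phi>"
  let ?J = "dual_embed j"
  obtain B where B: "\<And>x. \<bar>\<phi> x\<bar> \<le> B" "\<And>x. \<bar>deriv \<phi> x\<bar> \<le> B"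
    by (rule test_function_bounded[OF \<phi>], rule that)
  obtain I I' where I: "has_bochner_int (time_measure T) (\<lambda>t. deriv \<phi> t *\<^sub>R ?J (u t)) I"
    and I': "has_bochner_int (time_measure T) (\<lambda>t. \<phi> t *\<^sub>R w t) I'"
    by (rule has_distr_deriv_bound[OF \<phi> u w], rule that)
  have ev: "bounded_linear (\<lambda>f :: 'v \<Rightarrow>\<^sub>L real. f x)" for x by (rule blinfun.bounded_linear_left)
  have apply_int: "(\<integral>t. p t * (v t) x \<partial>time_measure T) = L x"
    if "has_bochner_int (time_measure T) (\<lambda>t. p t *\<^sub>R v t) L" for p and v :: "real \<Rightarrow> 'v \<Rightarrow>\<^sub>L real" and L x
    using time.has_bochner_int_bounded_linear[OF ev[of x] that]
    by (simp add: time.has_bochner_int_iff_lebesgue has_bochner_integral_integral_eq blinfun.scaleR_left)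
  \<comment> \<open>An element of V' is determined by its values, so the vector identity may be
    checked at each \<open>x\<close>.\<close>
  have "I' = - I"
  proof (rule blinfun_eqI)
    fix x
    have bl: "bounded_linear (\<lambda>v. ?J v x)"
      using bounded_linear_compose[OF ev[of x] bounded_linear_dual_embed[of j]] by simp
    define f1 where "f1 = Blinfun (\<lambda>v. ?J v x)"
    have f1: "f1 v = ?J v x" for v unfolding f1_def by (simp add: bounded_linear_Blinfun_apply[OF bl])
    define f2 where "f2 = Blinfun (\<lambda>f :: 'v \<Rightarrow>\<^sub>L real. f x)"
    have f2: "f2 f = f x" for f unfolding f2_def by (simp add: bounded_linear_Blinfun_apply[OF ev])
    have "(\<lambda>k. \<integral>t. deriv \<phi> t * f1 (uk k t) \<partial>time_measure T) \<longlonglongrightarrow> (\<integral>t. deriv \<phi> t * f1 (u t) \<partial>time_measure T)"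
      using weak(1) L2_functional_integral[OF T test_function_measurable(2)[OF \<phi>] B(2), of f1]
      unfolding L2_weak_conv_def by blast
    then have 1: "(\<lambda>k. \<integral>t. deriv \<phi> t * ?J (uk k t) x \<partial>time_measure T) \<longlonglongrightarrow> I x"
      unfolding f1 apply_int[OF I] .
    have "(\<lambda>k. \<integral>t. \<phi> t * f2 (distr_deriv T j (uk k) t) \<partial>time_measure T) \<longlonglongrightarrow> (\<integral>t. \<phi> t * f2 (w t) \<partial>time_measure T)"
      using weak(2) L2_functional_integral[OF T test_function_measurable(1)[OF \<phi>] B(1), of f2]
      unfolding L2_weak_conv_def by blast
    then have 2: "(\<lambda>k. \<integral>t. \<phi> t * distr_deriv T j (uk k) t x \<partial>time_measure T) \<longlonglongrightarrow> I' x"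
      unfolding f2 apply_int[OF I'] .
    have "(\<integral>t. \<phi> t * distr_deriv T j (uk k) t x \<partial>time_measure T) = - (\<integral>t. deriv \<phi> t * ?J (uk k t) x \<partial>time_measure T)" for k
    proof -
      obtain L where L: "has_bochner_int (time_measure T) (\<lambda>t. deriv \<phi> t *\<^sub>R ?J (uk k t)) L"
        "has_bochner_int (time_measure T) (\<lambda>t. \<phi> t *\<^sub>R distr_deriv T j (uk k) t) (- L)"
        using distr_derivD(2)[OF uk[of k]] \<phi> unfolding has_distr_deriv_def by blast
      show ?thesis unfolding apply_int[OF L(1)] apply_int[OF L(2)] by (simp add: blinfun.minus_left)
    qed
    then have "(\<lambda>k. \<integral>t. \<phi> t * distr_deriv T j (uk k) t x \<partial>time_measure T) \<longlonglongrightarrow> - I x"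
      using tendsto_minus[OF 1] by simp
    with 2 have "I' x = - I x" by (rule LIMSEQ_unique)
    then show "I' x = (- I) x" by (simp add: blinfun.minus_left)
  qed
  then show "\<exists>I. has_bochner_int (time_measure T) (\<lambda>t. deriv \<phi> t *\<^sub>R ?J (u t)) I \<and>
      has_bochner_int (time_measure T) (\<lambda>t. \<phi> t *\<^sub>R w t) (- I)"
    using I I' by blast
qed

theorem theorem3p4:
  fixes j :: "'v::{banach, second_countable_topology} \<Rightarrow>\<^sub>L
              'h::{real_inner, banach, second_countable_topology}"
    and T :: real
    and Kn :: "nat \<Rightarrow> 'v set" and K :: "'v set"
  assumes "reflexive_space TYPE('v)"
    and "evolution_triple j"
    and "0 < T"
    and "\<And>n. closed (Kn n)" and "\<And>n. convex (Kn n)"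
    and "closed K" and "convex K"
  shows "(mosco_conv Kn K \<longleftrightarrow> mosco_conv_L2 T Kn K) \<and>
         (mosco_conv_L2 T Kn K \<longleftrightarrow> mosco_conv_W T j Kn K)"
proof -
  obtain \<beta> \<psi> :: "real \<Rightarrow> real" and B :: real where bump:
    "continuous_on UNIV \<beta>" "\<And>x. 0 \<le> \<beta> x" "\<And>x. \<beta> x \<le> B" "\<And>x. \<beta> x \<noteq> 0 \<Longrightarrow> 1/4 \<le> x \<and> x \<le> 3/4"
    "(\<beta> has_integral 1) {0..1}"
    "smooth_real \<psi>" "\<And>x. (\<psi> has_real_derivative \<beta> x - \<beta> (x - 1)) (at x)"
    "\<And>x. 0 \<le> \<psi> x" "\<And>x. \<psi> x \<le> 1" "\<And>x. \<psi> x \<noteq> 0 \<Longrightarrow> 1/4 \<le> x \<and> x \<le> 7/4"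
    "(\<psi> has_integral 1) {0..2}"
    by (rule smooth_bump_exists, rule that)
  interpret mesh \<beta> \<psi> B T
    by (rule mesh.intro[OF bump \<open>0 < T\<close>])
  have L2: "mosco_conv_L2 T Kn K" if M: "mosco_conv Kn K"
    unfolding mosco_conv_L2_def
  proof (intro conjI ballI allI impI)
    fix u assume u: "u \<in> L2_values_in T K"
    obtain un where "\<And>n. un n \<in> L2_values_in T (Kn n)" "(\<lambda>n. L2_norm T (\<lambda>t. un n t - u t)) \<longlonglongrightarrow> 0"
      by (rule mosco_imp_L2_recovery[where Kn=Kn, OF assms(6,7,5) u M[unfolded mosco_conv_def, THEN conjunct1, rule_format]],
          assumption, rule that)
    then show "\<exists>un. (\<forall>n. un n \<in> L2_values_in T (Kn n)) \<and> (\<lambda>n. L2_norm T (\<lambda>t. un n t - u t)) \<longlonglongrightarrow> 0"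
      by blast
  next
    fix nk :: "nat \<Rightarrow> nat" and uk :: "nat \<Rightarrow> real \<Rightarrow> 'v" and u
    assume "u \<in> L2_space T" "filterlim nk at_top sequentially"
      "\<forall>k. uk k \<in> L2_values_in T (Kn (nk k))" "L2_weak_conv T uk u"
    then show "u \<in> L2_values_in T K"
      by (intro mosco_imp_L2_closed[OF assms(3,6,4,5) M]) auto
  qed
  have W: "mosco_conv_W T j Kn K" if M: "mosco_conv Kn K"
    unfolding mosco_conv_W_def
  proof (intro conjI ballI allI impI)
    fix u assume u: "u \<in> W_space T j \<inter> L2_values_in T K"
    obtain un where "\<And>n. un n \<in> W_space T j \<inter> L2_values_in T (Kn n)" "(\<lambda>n. W_norm T j (\<lambda>t. un n t - u t)) \<longlonglongrightarrow> 0"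
      by (rule mosco_imp_W_recovery[where Kn=Kn, OF assms(6,7,5) IntD2[OF u] IntD1[OF u] M[unfolded mosco_conv_def, THEN conjunct1, rule_format]],
          assumption, rule that)
    then show "\<exists>un. (\<forall>n. un n \<in> W_space T j \<inter> L2_values_in T (Kn n)) \<and> (\<lambda>n. W_norm T j (\<lambda>t. un n t - u t)) \<longlonglongrightarrow> 0"
      by blast
  next
    fix nk :: "nat \<Rightarrow> nat" and uk :: "nat \<Rightarrow> real \<Rightarrow> 'v" and u w
    assume u: "u \<in> L2_space T" and w: "w \<in> L2_space T" and nk: "filterlim nk at_top sequentially"
      and uk: "\<forall>k. uk k \<in> W_space T j \<inter> L2_values_in T (Kn (nk k))"
      and weak: "L2_weak_conv T uk u" "L2_weak_conv T (\<lambda>k. distr_deriv T j (uk k)) w"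
    have uk': "uk k \<in> W_space T j" "uk k \<in> L2_values_in T (Kn (nk k))" for k using uk by auto
    show d: "has_distr_deriv T j u w"
      by (rule weak_limit_distr_deriv[OF assms(3) uk'(1) u w weak])
    show "u \<in> W_space T j \<inter> L2_values_in T K"
      using W_spaceI[OF u w d] mosco_imp_L2_closed[OF assms(3,6,4,5) M nk uk'(2) u weak(1)] by blast
  qed
  \<comment> \<open>The second and the third assertion are each equivalent to the first, so their
    equivalence passes through \<open>mosco_conv Kn K\<close>.\<close>
  show ?thesis
    using L2 W mosco_L2_imp_mosco[OF assms(3)] mosco_W_imp_mosco by blast
qed

end
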